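(* Consider the regression-based Monte Carlo DDP algorithm described in the context, on a compact state space $\mathcal{X}$, with $M$ basis functions and $L$ sampled states per period. Suppose that: (1) there is a measure $F$ with support $\mathcal{X}$ such that $\{\psi_m\}_{m\ge1}$ is orthonormal under $F$, i.e. $\int_{\mathbb{R}^n}\psi_i(x)\psi_j(x)\,dF(x)$ equals $1$ if $i=j$ and $0$ if $i\ne j$; (2) each sampling distribution $G_t$, $1\le t\le T$, is absolutely continuous with respect to $F$, and there are strictly positive constants $\epsilon$ and $D$ such that $\epsilon<\frac{dG_t}{dF}(x)<D$ for all $x\in\mathcal{X}$; (3) there is a constant $C_0$ such that, for every positive integer $M$, $\sup_{x\in\mathcal{X}}\big(\sum_{m=1}^M\psi_m^2(x)\big)^{1/2}\le C_0M$ and $\sup_{1\le m\le M}\mathbb{E}^{G}[\psi_m^2(X)]\le C_0$ (where $X\sim G_t$, for each $1\le t\le T$); (4) the optimal cost-to-go functions $V_t$, $0\le t\le T$, are bounded on $\mathcal{X}$. Then there exists a constant $C$, independent of $L$ and $M$, such that $$\mathbb{E}\Big[\big|\underline{\widehat{\mathfrak{V}}}^{T+1}_0(x)-V_0(x)\big|\Big]\le\Big(1+2l_M+C\Big(\frac{M^6}{L}\Big)^{1/4}\Big)^{T}\Big[(1+l_M)\Delta_M+C\Big(\frac{M^6}{L}\Big)^{1/4}\Big],$$ where $x=x_0$ is the initial state, $\underline{\widehat{\mathfrak{V}}}^{T+1}_0(x)$ is the algorithm's output after $T+1$ iterations, $l_M$ is the Lebesgue constant of the basis functions, and $\Delta_M=\max_{0\le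 t\le T}\inf_{\gamma_t\in\mathbb{R}^M}\|V_t-\Psi_M^{\top}\gamma_t\|_\infty$.
   Context: Setting (finite-horizon stochastic dynamic program). Let $T\ge1$, let $\mathcal{X}\subset\mathbb{R}^n$ be a compact state space, $A_t\subseteq\mathbb{R}^m$ ($0\le t\le T-1$) nonempty action sets, $\xi_0,\dots,\xi_{T-1}$ independent random vectors in $\mathbb{R}^d$, $f_t$ transition functions with $x_{t+1}=f_t(x_t,a_t,\xi_t)\in\mathcal{X}$, $r_t(x_t,a_t,\xi_t)$ stage costs, and $r_T(x_T)$ a terminal cost. The optimal cost-to-go functions $V_t$ (minimal expected cost $\mathbb{E}[\sum_{s=t}^{T-1}r_s(x_s,\alpha_s,\xi_s)+r_T(x_T)\mid x_t=x]$ over policies with $\alpha_s$ measurable with respect to $\sigma(x_0,\dots,x_s)$) satisfy $V_T=r_T$ and $V_t(x)=\inf_{a\in A_t}\mathbb{E}[r_t(x,a,\xi_t)+V_{t+1}(f_t(x,a,\xi_t))]$. All functions are measurable and all expectations are assumed well defined. Notation. $\psi_1,\psi_2,\dots:\mathbb{R}^n\to\mathbb{R}$ are basis functions and $\Psi_M(x)=(\psi_1(x),\dots,\psi_M(x))^{\top}$. $\|g\|_\infty=\sup_{x\in\mathcal{X}}|g(x)|$. $G_1,\dots,G_T$ are probability distributions on $\mathcal{X}$ (state samplers), and $\mathbb{E}^G$ denotes expectation when the state is distributed according to the sampler. Lebesgue constant. For $f$ with $0<\|f\|_\infty<\infty$ let $\widehat\beta_f=\arg\min_{\alpha\in\mathbb{R}^M}\mathbb{E}^G[(f(X)-\Psi_M^{\top}(X)\alpha)^2]$;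 then $l_M=\sup\{\|\Psi_M^{\top}\widehat\beta_f\|_\infty/\|f\|_\infty:\ 0<\|f\|_\infty<\infty\}$ (the maximum over the samplers $G=G_t$, $1\le t\le T$, is taken when they differ). Regression-based Monte Carlo DDP algorithm. Step 0. For each $1\le t\le T$ draw independently $x_t^{(1)},\dots,x_t^{(L)}\sim G_t$. Choose an initial approximation $\underline{\widehat{\mathfrak{V}}}^0_t=\sum_{m=1}^M\widehat\beta^0_{t,m}\psi_m$, $1\le t\le T$. Iteration $k=1,2,\dots$. Given $\underline{\widehat{\mathfrak{V}}}^{k-1}_t$, $1\le t\le T$, define for a state $x_t=x$, a path $\xi|t=(\xi_t,\dots,\xi_{T-1})$ and actions $a=(a_t,\dots,a_{T-1})$, with $x_{s+1}=f_s(x_s,a_s,\xi_s)$, $$\mathfrak{z}^k_t(a,\xi)=\sum_{s=t}^{T-1}\Big\{\mathbb{E}\big[r_s(x_s,a_s,\xi_s)+\underline{\widehat{\mathfrak{V}}}^{k-1}_{s+1}(f_s(x_s,a_s,\xi_s))\big]-\big(r_s(x_s,a_s,\xi_s)+\underline{\widehat{\mathfrak{V}}}^{k-1}_{s+1}(f_s(x_s,a_s,\xi_s))\big)\Big\}$$ (inner expectation over $\xi_s$ only, with $x_s,a_s$ and the approximations fixed) and $$\mathfrak{J}_{t,k}(\xi|t,x)=\inf_{a\in A_t\times\cdots\times A_{T-1}}\Big(\sum_{s=t}^{T-1}r_s(x_s,a_s,\xi_s)+r_T(x_T)+\mathfrak{z}^k_t(a,\xi)\Big),\qquad \mathfrak{J}_{T,k}(x)=r_T(x).$$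 These deterministic infima are assumed to be computed exactly. For $1\le t\le T$ and each $l$, independently simulate a path $\xi^{(l)}|t$ of the noise and set $\mathfrak{J}^{(l)}_{t,k}=\mathfrak{J}_{t,k}(\xi^{(l)}|t,x_t^{(l)})$; let $\widehat\beta^k_t=(\widehat B^t_{\psi\psi})^{-1}\widehat B^{t,k}_{\mathfrak{J}\psi}$ (whenever the inverse exists), where $\widehat B^t_{\psi\psi}=\frac1L\sum_{l=1}^L\Psi_M(x_t^{(l)})\Psi_M(x_t^{(l)})^{\top}$ and $\widehat B^{t,k}_{\mathfrak{J}\psi}=\frac1L\sum_{l=1}^L\mathfrak{J}^{(l)}_{t,k}\Psi_M(x_t^{(l)})$; put $\underline{\widehat{\mathfrak{V}}}^k_t=\Psi_M^{\top}\widehat\beta^k_t$. Output. At the initial state $x=x_0$ simulate $L$ independent noise paths $\xi^{(l)}|0$, set $\mathfrak{J}^{(l)}_{0,T+1}=\mathfrak{J}_{0,T+1}(\xi^{(l)}|0,x)$, and output $$\underline{\widehat{\mathfrak{V}}}^{T+1}_0(x)=\max\Big\{-K,\min\Big\{K,\frac1L\sum_{l=1}^L\mathfrak{J}^{(l)}_{0,T+1}\Big\}\Big\},$$ where $K$ is a pre-specified sufficiently large constant with $K\ge|V_0(x)|$ ($K$ does not depend on $L$, $M$). *)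

theory Defs
  imports "HOL-Probability.Probability" "Jordan_Normal_Form.Matrix"
begin

section \<open>The stochastic dynamic program\<close>

text \<open>
  States, actions and noise live in Euclidean spaces of arbitrary fixed dimension.  Transitions and
  stage costs only matter on \<open>X \<times> A t \<times> UNIV\<close>, terminal costs only on \<open>X\<close>, and
  measurability is required there only.
\<close>

locale stochastic_dp = prob_space P for P :: "'w measure" +
  fixes T :: nat
    and X :: "(real ^ 'n) set"
    and A :: "nat \<Rightarrow> (real ^ 'm) set"
    and \<xi> :: "nat \<Rightarrow> 'w \<Rightarrow> real ^ 'd"
    and f :: "nat \<Rightarrow> real ^ 'n \<Rightarrow> real ^ 'm \<Rightarrow> real ^ 'd \<Rightarrow> real ^ 'n"
    and r :: "nat \<Rightarrow> real ^ 'n \<Rightarrow> real ^ 'm \<Rightarrow> real ^ 'd \<Rightarrow> real"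
    and rT :: "real ^ 'n \<Rightarrow> real"
  assumes horizon: "1 \<le> T"
    and compact_states: "compact X"
    and actions_nonempty: "\<And>t. t < T \<Longrightarrow> A t \<noteq> {}"
    and noise_indep: "indep_vars (\<lambda>_. borel) \<xi> {..<T}"
    and transition_in: "\<And>t x a z. t < T \<Longrightarrow> x \<in> X \<Longrightarrow> a \<in> A t \<Longrightarrow> f t x a z \<in> X"
    and transition_meas: "\<And>t. t < T \<Longrightarrow>
      (\<lambda>(x, a, z). f t x a z) \<in> borel_measurable (restrict_space borel (X \<times> A t \<times> UNIV))"
    and cost_meas: "\<And>t. t < T \<Longrightarrow>
      (\<lambda>(x, a, z). r t x a z) \<in> borel_measurable (restrict_space borel (X \<times> A t \<times> UNIV))"
    and terminal_meas: "rT \<in> borel_measurable (restrict_space borel X)"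
    and cost_integrable: "\<And>t x a. t < T \<Longrightarrow> x \<in> X \<Longrightarrow> a \<in> A t \<Longrightarrow>
      integrable P (\<lambda>\<omega>. r t x a (\<xi> t \<omega>))"

text \<open>
  \<open>state_path f t x a z s\<close> is the state at time \<open>s \<ge> t\<close> when the system is in state \<open>x\<close> at
  time \<open>t\<close> and actions \<open>a\<close> and noise \<open>z\<close> are applied from then on (for \<open>s < t\<close> it has the dummy
  value \<open>x\<close>).
\<close>

primrec state_path :: "(nat \<Rightarrow> 'x \<Rightarrow> 'a \<Rightarrow> 'z \<Rightarrow> 'x) \<Rightarrow> nat \<Rightarrow> 'x \<Rightarrow>
    (nat \<Rightarrow> 'a) \<Rightarrow> (nat \<Rightarrow> 'z) \<Rightarrow> nat \<Rightarrow> 'x" where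
  "state_path f t x a z 0 = x"
| "state_path f t x a z (Suc s) =
     (if t \<le> s then f s (state_path f t x a z s) (a s) (z s) else x)"

definition path_cost :: "nat \<Rightarrow> (nat \<Rightarrow> 'x \<Rightarrow> 'a \<Rightarrow> 'z \<Rightarrow> 'x) \<Rightarrow>
    (nat \<Rightarrow> 'x \<Rightarrow> 'a \<Rightarrow> 'z \<Rightarrow> real) \<Rightarrow> ('x \<Rightarrow> real) \<Rightarrow>
    nat \<Rightarrow> 'x \<Rightarrow> (nat \<Rightarrow> 'a) \<Rightarrow> (nat \<Rightarrow> 'z) \<Rightarrow> real" where
  "path_cost T f r rT t x a z =
     (\<Sum>s\<in>{t..<T}. r s (state_path f t x a z s) (a s) (z s)) + rT (state_path f t x a z T)"

text \<open>
  A policy for the problem started in state \<open>x\<close> at time \<open>t\<close> is an action process whose value at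
  time \<open>s\<close> is measurable with respect to the sigma-algebra generated by the states at times
  \<open>t, \<dots>, s\<close> which that process itself produces.  Only policies with finite expected cost count.
\<close>

definition policies :: "'w measure \<Rightarrow> nat \<Rightarrow> (nat \<Rightarrow> (real ^ 'm) set) \<Rightarrow>
    (nat \<Rightarrow> 'w \<Rightarrow> 'z) \<Rightarrow> (nat \<Rightarrow> real ^ 'n \<Rightarrow> real ^ 'm \<Rightarrow> 'z \<Rightarrow> real ^ 'n) \<Rightarrow>
    (nat \<Rightarrow> real ^ 'n \<Rightarrow> real ^ 'm \<Rightarrow> 'z \<Rightarrow> real) \<Rightarrow> (real ^ 'n \<Rightarrow> real) \<Rightarrow>
    nat \<Rightarrow> real ^ 'n \<Rightarrow> (nat \<Rightarrow> 'w \<Rightarrow> real ^ 'm) set" where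
  "policies P T A \<xi> f r rT t x =
     {\<alpha>. (\<forall>s\<in>{t..<T}.
            \<alpha> s \<in> space P \<rightarrow> A s \<and>
            \<alpha> s \<in> borel_measurable
              (vimage_algebra (space P)
                (\<lambda>\<omega>. \<lambda>u\<in>{t..s}. state_path f t x (\<lambda>v. \<alpha> v \<omega>) (\<lambda>v. \<xi> v \<omega>) u)
                (Pi\<^sub>M {t..s} (\<lambda>_. borel)))) \<and>
          integrable P (\<lambda>\<omega>. path_cost T f r rT t x (\<lambda>s. \<alpha> s \<omega>) (\<lambda>s. \<xi> s \<omega>))}"

definition optimal_cost_to_go :: "'w measure \<Rightarrow> nat \<Rightarrow> (nat \<Rightarrow> (real ^ 'm) set) \<Rightarrow>
    (nat \<Rightarrow> 'w \<Rightarrow> 'z) \<Rightarrow> (nat \<Rightarrow> real ^ 'n \<Rightarrow> real ^ 'm \<Rightarrow> 'z \<Rightarrow> real ^ 'n) \<Rightarrow>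
    (nat \<Rightarrow> real ^ 'n \<Rightarrow> real ^ 'm \<Rightarrow> 'z \<Rightarrow> real) \<Rightarrow> (real ^ 'n \<Rightarrow> real) \<Rightarrow>
    nat \<Rightarrow> real ^ 'n \<Rightarrow> ereal" where
  "optimal_cost_to_go P T A \<xi> f r rT t x =
     (INF \<alpha>\<in>policies P T A \<xi> f r rT t x.
        ereal (\<integral>\<omega>. path_cost T f r rT t x (\<lambda>s. \<alpha> s \<omega>) (\<lambda>s. \<xi> s \<omega>) \<partial>P))"


section \<open>Basis functions\<close>

definition sup_norm :: "'x set \<Rightarrow> ('x \<Rightarrow> real) \<Rightarrow> real" where
  "sup_norm X g = (SUP x\<in>X. \<bar>g x\<bar>)"

text \<open>The basis functions are \<open>\<psi> 1, \<psi> 2, \<dots>\<close>, whereas vector entries are counted from 0.\<close>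

definition basis_vec :: "(nat \<Rightarrow> 'x \<Rightarrow> real) \<Rightarrow> nat \<Rightarrow> 'x \<Rightarrow> real Matrix.vec" where
  "basis_vec \<psi> M x = Matrix.vec M (\<lambda>i. \<psi> (Suc i) x)"

definition basis_comb :: "(nat \<Rightarrow> 'x \<Rightarrow> real) \<Rightarrow> nat \<Rightarrow> real Matrix.vec \<Rightarrow> 'x \<Rightarrow> real" where
  "basis_comb \<psi> M \<beta> x = scalar_prod (basis_vec \<psi> M x) \<beta>"

definition least_squares_coeff ::
    "(nat \<Rightarrow> 'x \<Rightarrow> real) \<Rightarrow> nat \<Rightarrow> 'x measure \<Rightarrow> ('x \<Rightarrow> real) \<Rightarrow> real Matrix.vec \<Rightarrow> bool" where
  "least_squares_coeff \<psi> M G h \<beta> \<longleftrightarrow>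
     is_arg_min (\<lambda>\<alpha>. \<integral>x. (h x - basis_comb \<psi> M \<alpha> x)\<^sup>2 \<partial>G) (\<lambda>\<alpha>. \<alpha> \<in> carrier_vec M) \<beta>"

definition lebesgue_constant ::
    "(nat \<Rightarrow> real ^ 'n \<Rightarrow> real) \<Rightarrow> (real ^ 'n) set \<Rightarrow> nat \<Rightarrow> (nat \<Rightarrow> (real ^ 'n) measure) \<Rightarrow>
      nat \<Rightarrow> real" where
  "lebesgue_constant \<psi> X T G M =
     (MAX t\<in>{1..T}. Sup {sup_norm X (basis_comb \<psi> M \<beta>) / sup_norm X h | h \<beta>.
        h \<in> borel_measurable borel \<and> bounded (h ` X) \<and> 0 < sup_norm X h \<and>
        least_squares_coeff \<psi> M (G t) h \<beta>})"

definition approx_error ::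
    "(nat \<Rightarrow> 'x \<Rightarrow> real) \<Rightarrow> 'x set \<Rightarrow> nat \<Rightarrow> (nat \<Rightarrow> 'x \<Rightarrow> real) \<Rightarrow> nat \<Rightarrow> real" where
  "approx_error \<psi> X T V M =
     (MAX t\<in>{0..T}. INF \<gamma>\<in>carrier_vec M. sup_norm X (\<lambda>x. V t x - basis_comb \<psi> M \<gamma> x))"

definition measure_support :: "'x::topological_space measure \<Rightarrow> 'x set" where
  "measure_support F = {x. \<forall>U. open U \<and> x \<in> U \<longrightarrow> emeasure F U > 0}"


section \<open>The regression-based Monte Carlo algorithm\<close>

definition penalty :: "'w measure \<Rightarrow> nat \<Rightarrow> (nat \<Rightarrow> 'w \<Rightarrow> 'z) \<Rightarrow>
    (nat \<Rightarrow> 'x \<Rightarrow> 'a \<Rightarrow> 'z \<Rightarrow> 'x) \<Rightarrow> (nat \<Rightarrow> 'x \<Rightarrow> 'a \<Rightarrow> 'z \<Rightarrow> real) \<Rightarrow>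
    (nat \<Rightarrow> 'x \<Rightarrow> real) \<Rightarrow> nat \<Rightarrow> 'x \<Rightarrow> (nat \<Rightarrow> 'a) \<Rightarrow> (nat \<Rightarrow> 'z) \<Rightarrow> real" where
  "penalty P T \<xi> f r W t x a z =
     (\<Sum>s\<in>{t..<T}. let y = state_path f t x a z s in
        (\<integral>\<omega>. r s y (a s) (\<xi> s \<omega>) + W (Suc s) (f s y (a s) (\<xi> s \<omega>)) \<partial>P)
        - (r s y (a s) (z s) + W (Suc s) (f s y (a s) (z s))))"

definition dual_value :: "'w measure \<Rightarrow> nat \<Rightarrow> (nat \<Rightarrow> 'a set) \<Rightarrow> (nat \<Rightarrow> 'w \<Rightarrow> 'z) \<Rightarrow>
    (nat \<Rightarrow> 'x \<Rightarrow> 'a \<Rightarrow> 'z \<Rightarrow> 'x) \<Rightarrow> (nat \<Rightarrow> 'x \<Rightarrow> 'a \<Rightarrow> 'z \<Rightarrow> real) \<Rightarrow> ('x \<Rightarrow> real) \<Rightarrow>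
    (nat \<Rightarrow> 'x \<Rightarrow> real) \<Rightarrow> nat \<Rightarrow> 'x \<Rightarrow> (nat \<Rightarrow> 'z) \<Rightarrow> real" where
  "dual_value P T A \<xi> f r rT W t x z =
     (INF a\<in>(\<Pi>\<^sub>E s\<in>{t..<T}. A s). path_cost T f r rT t x a z + penalty P T \<xi> f r W t x a z)"

text \<open>
  \<open>S t l\<close> is the \<open>l\<close>-th sampled state at time \<open>t\<close>, \<open>Z k t l s\<close> the time-\<open>s\<close> entry of the \<open>l\<close>-th
  noise path started at time \<open>t\<close> in iteration \<open>k\<close>, and \<open>\<beta> k t\<close> the coefficient vector computed for
  time \<open>t\<close> in iteration \<open>k\<close>.
\<close>

definition dual_sample :: "'w measure \<Rightarrow> nat \<Rightarrow> (nat \<Rightarrow> 'a set) \<Rightarrow> (nat \<Rightarrow> 'w \<Rightarrow> 'z) \<Rightarrow>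
    (nat \<Rightarrow> 'x \<Rightarrow> 'a \<Rightarrow> 'z \<Rightarrow> 'x) \<Rightarrow> (nat \<Rightarrow> 'x \<Rightarrow> 'a \<Rightarrow> 'z \<Rightarrow> real) \<Rightarrow> ('x \<Rightarrow> real) \<Rightarrow>
    (nat \<Rightarrow> 'x \<Rightarrow> real) \<Rightarrow> 'x \<Rightarrow> nat \<Rightarrow> (nat \<Rightarrow> nat \<Rightarrow> 'v \<Rightarrow> 'x) \<Rightarrow>
    (nat \<Rightarrow> nat \<Rightarrow> nat \<Rightarrow> nat \<Rightarrow> 'v \<Rightarrow> 'z) \<Rightarrow> (nat \<Rightarrow> nat \<Rightarrow> 'v \<Rightarrow> real Matrix.vec) \<Rightarrow>
    nat \<Rightarrow> nat \<Rightarrow> nat \<Rightarrow> 'v \<Rightarrow> real" where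
  "dual_sample P T A \<xi> f r rT \<psi> x0 M S Z \<beta> k t l \<omega> =
     dual_value P T A \<xi> f r rT (\<lambda>s. basis_comb \<psi> M (\<beta> (k - 1) s \<omega>)) t
       (if t = 0 then x0 else S t l \<omega>) (\<lambda>s. Z k t l s \<omega>)"

definition sample_gram ::
    "(nat \<Rightarrow> 'x \<Rightarrow> real) \<Rightarrow> nat \<Rightarrow> nat \<Rightarrow> (nat \<Rightarrow> 'x) \<Rightarrow> real Matrix.mat" where
  "sample_gram \<psi> M L xs =
     Matrix.mat M M (\<lambda>(i, j). (\<Sum>l=1..L. \<psi> (Suc i) (xs l) * \<psi> (Suc j) (xs l)) / real L)"

definition sample_cross ::
    "(nat \<Rightarrow> 'x \<Rightarrow> real) \<Rightarrow> nat \<Rightarrow> nat \<Rightarrow> (nat \<Rightarrow> 'x) \<Rightarrow> (nat \<Rightarrow> real) \<Rightarrow> real Matrix.vec" where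
  "sample_cross \<psi> M L xs ys = Matrix.vec M (\<lambda>i. (\<Sum>l=1..L. ys l * \<psi> (Suc i) (xs l)) / real L)"

definition noise_index :: "nat \<Rightarrow> nat \<Rightarrow> (nat \<times> nat \<times> nat \<times> nat) set" where
  "noise_index T L =
     {(k, t, l, s). k \<in> {1..T+1} \<and> t \<in> (if k = T + 1 then {0..T} else {1..T}) \<and>
        l \<in> {1..L} \<and> s \<in> {t..<T}}"

text \<open>
  Where the empirical Gram matrix is singular, nothing is assumed about the coefficients of that
  iteration (except their number), so every convention for this case is covered.

  The simulation may live on a probability space \<open>Q\<close> of its own.  Its samples take values in
  different spaces, so their joint independence is expressed through the sigma-algebras they
  generate.  Measurability of the sampled dual values has to be required because they are infima
  over possibly uncountable sets of actions.
\<close>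

locale ddp_run = prob_space Q for Q :: "'v measure" +
  fixes P :: "'w measure"
    and T :: nat
    and X :: "(real ^ 'n) set"
    and A :: "nat \<Rightarrow> (real ^ 'm) set"
    and \<xi> :: "nat \<Rightarrow> 'w \<Rightarrow> real ^ 'd"
    and f :: "nat \<Rightarrow> real ^ 'n \<Rightarrow> real ^ 'm \<Rightarrow> real ^ 'd \<Rightarrow> real ^ 'n"
    and r :: "nat \<Rightarrow> real ^ 'n \<Rightarrow> real ^ 'm \<Rightarrow> real ^ 'd \<Rightarrow> real"
    and rT :: "real ^ 'n \<Rightarrow> real"
    and G :: "nat \<Rightarrow> (real ^ 'n) measure"
    and \<psi> :: "nat \<Rightarrow> real ^ 'n \<Rightarrow> real"
    and x0 :: "real ^ 'n"
    and M L :: nat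
    and S :: "nat \<Rightarrow> nat \<Rightarrow> 'v \<Rightarrow> real ^ 'n"
    and Z :: "nat \<Rightarrow> nat \<Rightarrow> nat \<Rightarrow> nat \<Rightarrow> 'v \<Rightarrow> real ^ 'd"
    and \<beta> :: "nat \<Rightarrow> nat \<Rightarrow> 'v \<Rightarrow> real Matrix.vec"
  assumes states_sampled: "\<And>t l. t \<in> {1..T} \<Longrightarrow> l \<in> {1..L} \<Longrightarrow>
      S t l \<in> borel_measurable Q \<and> S t l \<in> space Q \<rightarrow> X \<and> distr Q borel (S t l) = G t"
    and noise_sampled: "\<And>k t l s. (k, t, l, s) \<in> noise_index T L \<Longrightarrow>
      Z k t l s \<in> borel_measurable Q \<and> distr Q borel (Z k t l s) = distr P borel (\<xi> s)"
    and samples_indep: "indep_sets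
      (case_sum (\<lambda>(t, l). sets (vimage_algebra (space Q) (S t l) borel))
                (\<lambda>(k, t, l, s). sets (vimage_algebra (space Q) (Z k t l s) borel)))
      (({1..T} \<times> {1..L}) <+> noise_index T L)"
    and initial_coeff: "\<And>t. t \<in> {1..T} \<Longrightarrow> \<exists>\<beta>0\<in>carrier_vec M. \<forall>\<omega>\<in>space Q. \<beta> 0 t \<omega> = \<beta>0"
    and coeff_carrier: "\<And>k t \<omega>. k \<in> {1..T+1} \<Longrightarrow> t \<in> {1..T} \<Longrightarrow> \<omega> \<in> space Q \<Longrightarrow>
      \<beta> k t \<omega> \<in> carrier_vec M"
    and regression: "\<And>k t \<omega> B.
      k \<in> {1..T+1} \<Longrightarrow> t \<in> {1..T} \<Longrightarrow> \<omega> \<in> space Q \<Longrightarrow> B \<in> carrier_mat M M \<Longrightarrow>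
      inverts_mat (sample_gram \<psi> M L (\<lambda>l. S t l \<omega>)) B \<Longrightarrow>
      inverts_mat B (sample_gram \<psi> M L (\<lambda>l. S t l \<omega>)) \<Longrightarrow>
      \<beta> k t \<omega> = mult_mat_vec B (sample_cross \<psi> M L (\<lambda>l. S t l \<omega>)
        (\<lambda>l. dual_sample P T A \<xi> f r rT \<psi> x0 M S Z \<beta> k t l \<omega>))"
    and dual_sample_meas: "\<And>k t l.
      k \<in> {1..T+1} \<Longrightarrow> t \<in> (if k = T + 1 then {0..T} else {1..T}) \<Longrightarrow> l \<in> {1..L} \<Longrightarrow>
      dual_sample P T A \<xi> f r rT \<psi> x0 M S Z \<beta> k t l \<in> borel_measurable Q"

definition ddp_output :: "'w measure \<Rightarrow> nat \<Rightarrow> (nat \<Rightarrow> 'a set) \<Rightarrow> (nat \<Rightarrow> 'w \<Rightarrow> 'z) \<Rightarrow>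
    (nat \<Rightarrow> 'x \<Rightarrow> 'a \<Rightarrow> 'z \<Rightarrow> 'x) \<Rightarrow> (nat \<Rightarrow> 'x \<Rightarrow> 'a \<Rightarrow> 'z \<Rightarrow> real) \<Rightarrow> ('x \<Rightarrow> real) \<Rightarrow>
    (nat \<Rightarrow> 'x \<Rightarrow> real) \<Rightarrow> 'x \<Rightarrow> real \<Rightarrow> nat \<Rightarrow> nat \<Rightarrow> (nat \<Rightarrow> nat \<Rightarrow> 'v \<Rightarrow> 'x) \<Rightarrow>
    (nat \<Rightarrow> nat \<Rightarrow> nat \<Rightarrow> nat \<Rightarrow> 'v \<Rightarrow> 'z) \<Rightarrow> (nat \<Rightarrow> nat \<Rightarrow> 'v \<Rightarrow> real Matrix.vec) \<Rightarrow>
    'v \<Rightarrow> real" where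
  "ddp_output P T A \<xi> f r rT \<psi> x0 K M L S Z \<beta> \<omega> =
     max (- K) (min K
       ((\<Sum>l=1..L. dual_sample P T A \<xi> f r rT \<psi> x0 M S Z \<beta> (T + 1) 0 l \<omega>) / real L))"

end

theory Submission
  imports Defs "Jordan_Normal_Form.Determinant"
begin

text \<open>
  Why the bound holds.  Every quantity that matters is reduced to a statement about the sampled
  states alone, one for each time \<open>t\<close>, that holds outside an event of probability
  \<open>O(\<eta>)\<close>, where \<open>\<eta> = (M\<^sup>6 / L)\<close> to the power \<open>1/4\<close>; everything else is deterministic.

  Dual values.  With the exact value functions in the penalty, the dual objective telescopes
  along every path and its infimum is exactly \<open>V t x\<close>.  Replacing \<open>V\<close> by an approximation \<open>W\<close>
  changes each summand twice by at most the sup-norm error of \<open>W\<close>, so the dual value differs from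
  \<open>V t x\<close> by at most twice the sum of the errors at the later times (\<open>dual_value_error\<close>).  This is a
  pathwise bound: it involves no averaging over the simulated noise.

  Regression.  The map from regression targets to the fitted function is linear, reproduces
  linear combinations of the basis functions, and its norm from the sup norm to the sup norm is an
  empirical version of the Lebesgue constant.  The population version is attained at targets
  \<open>sgn (\<Psi>(y) \<bullet> v)\<close>, where \<open>v\<close> is the inverse Gram matrix applied to \<open>\<Psi>(x)\<close>; hence
  \<open>E \<bar>\<Psi> \<bullet> v\<bar>\<close> is at most \<open>l\<^sub>M\<close> (\<open>Lebesgue_function_le\<close>).  The empirical constant exceeds it
  by at most the Gram matrix error, which is controlled in Frobenius norm by a variance computation
  (\<open>expected_gram_error_le\<close>), plus the largest deviation of a sample mean of \<open>\<bar>\<Psi> \<bullet> v\<bar>\<close> over all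
  relevant \<open>v\<close>.  The latter is a symmetrisation and contraction estimate
  (\<open>expected_max_deviation_le\<close>).  Both are bounded by a multiple of \<open>\<eta>\<close> outside an event of
  probability \<open>O(\<eta>)\<close> (\<open>unstable_sample_event\<close>).  The regression bound is uniform in
  the targets, which is essential: the dual values of one iteration depend on the sampled states and
  on all earlier noise paths through the previous approximation.

  Iteration.  On the good event let \<open>\<Lambda> = l\<^sub>M + O(\<eta>)\<close>.  The error \<open>e t\<close> at time \<open>t\<close> satisfies
  \<open>e t \<le> (1 + \<Lambda>) \<Delta> + 2 \<Lambda> (e (t + 1) + \<dots> + e T)\<close> as soon as the later times have been
  iterated often enough, and the solution of this recursion is geometric with ratio
  \<open>1 + 2 \<Lambda>\<close> (\<open>coefficient_error\<close>).  The final average and the truncation at \<open>K\<close> preserve the bound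
  because \<open>2 \<le> 2 \<Lambda>\<close> (\<open>output_error\<close>).  On the bad event, and whenever \<open>\<eta> > 1\<close>, the
  truncation alone bounds the error by \<open>2 K\<close>.
\<close>

section \<open>Symmetrisation and contraction\<close>

lemma (in prob_space) le_integral_bounded:
  fixes f g :: "'a \<Rightarrow> real"
  assumes "f \<in> borel_measurable M" "g \<in> borel_measurable M"
    and "\<And>x. x \<in> space M \<Longrightarrow> \<bar>f x\<bar> \<le> B" "\<And>x. x \<in> space M \<Longrightarrow> \<bar>g x\<bar> \<le> B'"
    and "\<And>x. x \<in> space M \<Longrightarrow> f x \<le> g x"
  shows "(\<integral>x. f x \<partial>M) \<le> (\<integral>x. g x \<partial>M)"
proof (rule integral_mono)
  show "integrable M f"
    by (rule integrable_const_bound[where B = B]) (use assms in auto)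
  show "integrable M g"
    by (rule integrable_const_bound[where B = B']) (use assms in auto)
qed (use assms in auto)

lemma abs_Max_le:
  fixes h :: "'i \<Rightarrow> real"
  assumes "finite V" "V \<noteq> {}" "\<And>v. v \<in> V \<Longrightarrow> \<bar>h v\<bar> \<le> B"
  shows "\<bar>MAX v\<in>V. h v\<bar> \<le> B"
proof -
  have "(MAX v\<in>V. h v) \<in> h ` V"
    using assms by (intro Max_in) auto
  then show ?thesis using assms(3) by auto
qed

text \<open>
  Symmetrisation and contraction in a single step. An independent copy \<open>y\<close> of the sample point \<open>x\<close>
  replaces the mean; exchanging \<open>x\<close> and \<open>y\<close> and adding the two maxima leaves only differences of
  the form \<open>\<bar>g v x\<bar> - \<bar>g w x\<bar>\<close>, which are at most \<open>g v x - g w x\<close> or its negative. Both choices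
  are covered because the two maxima on the right-hand side are taken independently.
\<close>

lemma (in prob_space) symmetrisation_step:
  fixes A :: "'v \<Rightarrow> real" and g :: "'v \<Rightarrow> 'a \<Rightarrow> real"
  assumes V: "finite V" "V \<noteq> {}"
    and meas[measurable]: "\<And>v. v \<in> V \<Longrightarrow> g v \<in> borel_measurable M"
    and bound: "\<And>v x. v \<in> V \<Longrightarrow> x \<in> space M \<Longrightarrow> \<bar>g v x\<bar> \<le> B"
  shows "(\<integral>x. (MAX v\<in>V. A v + \<bar>g v x\<bar> - (\<integral>y. \<bar>g v y\<bar> \<partial>M)) \<partial>M)
    \<le> (\<integral>x. ((MAX v\<in>V. A v + 2 * g v x) + (MAX v\<in>V. A v - 2 * g v x)) / 2 \<partial>M)"
proof -
  interpret pp: pair_prob_space M M ..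
  obtain a where a: "\<And>v. v \<in> V \<Longrightarrow> \<bar>A v\<bar> \<le> a"
  proof -
    have "\<And>v. v \<in> V \<Longrightarrow> \<bar>A v\<bar> \<le> (MAX v\<in>V. \<bar>A v\<bar>)" using V by auto
    then show ?thesis using that by blast
  qed
  have B0: "0 \<le> B"
  proof -
    obtain v where "v \<in> V" using V by auto
    moreover obtain x where "x \<in> space M" using not_empty by auto
    ultimately show ?thesis using bound[of v x] by linarith
  qed
  define p where "p x y = (MAX v\<in>V. A v + \<bar>g v x\<bar> - \<bar>g v y\<bar>)" for x y
  define R where "R x = (MAX v\<in>V. A v + 2 * g v x) + (MAX v\<in>V. A v - 2 * g v x)" for x
  have intg: "integrable M (\<lambda>y. \<bar>g v y\<bar>)" if "v \<in> V" for v
    by (rule integrable_const_bound[where B = B]) (use that bound in auto)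
  have Eg: "\<bar>\<integral>y. \<bar>g v y\<bar> \<partial>M\<bar> \<le> B" if "v \<in> V" for v
  proof -
    have "(\<integral>y. \<bar>g v y\<bar> \<partial>M) \<le> (\<integral>y. B \<partial>M)"
      by (rule integral_mono) (use that intg bound in auto)
    then show ?thesis by (simp add: prob_space)
  qed
  have mR[measurable]: "R \<in> borel_measurable M"
    unfolding R_def using V by measurable
  have bR: "\<bar>R x\<bar> \<le> 2 * (a + 2 * B)" if "x \<in> space M" for x
  proof -
    have "\<bar>MAX v\<in>V. A v + 2 * g v x\<bar> \<le> a + 2 * B" "\<bar>MAX v\<in>V. A v - 2 * g v x\<bar> \<le> a + 2 * B"
      using a bound[OF _ that] by (intro abs_Max_le V; fastforce simp: abs_le_iff)+
    moreover have "\<bar>u + w\<bar> \<le> 2 * c" if "\<bar>u\<bar> \<le> c" "\<bar>w\<bar> \<le> c" for u w c :: real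
      using that by linarith
    ultimately show ?thesis unfolding R_def by blast
  qed
  have mp[measurable]: "case_prod p \<in> borel_measurable (M \<Otimes>\<^sub>M M)"
    unfolding p_def case_prod_beta using V by measurable
  have bp: "\<bar>p x y\<bar> \<le> a + 2 * B" if "x \<in> space M" "y \<in> space M" for x y
    unfolding p_def
    using a bound[OF _ that(1)] bound[OF _ that(2)] by (intro abs_Max_le V) fastforce
  have ip: "integrable (M \<Otimes>\<^sub>M M) (case_prod p)"
    by (rule pp.P.integrable_const_bound[where B = "a + 2 * B"])
      (use bp in \<open>auto simp: space_pair_measure\<close>)
  have ip': "integrable (M \<Otimes>\<^sub>M M) (\<lambda>(x, y). p y x)"
    using ip pp.integrable_product_swap_iff[of "case_prod p"] by simp
  have iR: "integrable M R"
    by (rule integrable_const_bound[where B = "2 * (a + 2 * B)"]) (use bR in auto)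
  have step1: "(MAX v\<in>V. A v + \<bar>g v x\<bar> - (\<integral>y. \<bar>g v y\<bar> \<partial>M)) \<le> (\<integral>y. p x y \<partial>M)"
    if x: "x \<in> space M" for x
  proof -
    have "A v + \<bar>g v x\<bar> - (\<integral>y. \<bar>g v y\<bar> \<partial>M) \<le> (\<integral>y. p x y \<partial>M)" if v: "v \<in> V" for v
    proof -
      have "A v + \<bar>g v x\<bar> - (\<integral>y. \<bar>g v y\<bar> \<partial>M) = (\<integral>y. A v + \<bar>g v x\<bar> - \<bar>g v y\<bar> \<partial>M)"
        using intg[OF v] by (simp add: prob_space)
      also have "\<dots> \<le> (\<integral>y. p x y \<partial>M)"
      proof (rule le_integral_bounded)
        show "p x \<in> borel_measurable M" using mp x by measurable
        show "\<bar>p x y\<bar> \<le> a + 2 * B" if "y \<in> space M" for y using bp x that by blast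
        show "\<bar>A v + \<bar>g v x\<bar> - \<bar>g v y\<bar>\<bar> \<le> a + 2 * B" if "y \<in> space M" for y
          using a[OF v] bound[OF v x] bound[OF v that] by linarith
        show "A v + \<bar>g v x\<bar> - \<bar>g v y\<bar> \<le> p x y" for y
          unfolding p_def using V v by (intro Max_ge) auto
      qed (use v in measurable)
      finally show ?thesis .
    qed
    then show ?thesis using V by simp
  qed
  have step2: "p x y + p y x \<le> (R x + R y) / 2" if "x \<in> space M" "y \<in> space M" for x y
  proof -
    have at: "\<exists>v\<in>V. p x y = A v + \<bar>g v x\<bar> - \<bar>g v y\<bar>" for x y
    proof -
      have "p x y \<in> (\<lambda>v. A v + \<bar>g v x\<bar> - \<bar>g v y\<bar>) ` V"
        unfolding p_def using V by (intro Max_in) auto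
      then show ?thesis by auto
    qed
    obtain v where v: "v \<in> V" "p x y = A v + \<bar>g v x\<bar> - \<bar>g v y\<bar>" using at by blast
    obtain w where w: "w \<in> V" "p y x = A w + \<bar>g w y\<bar> - \<bar>g w x\<bar>" using at by blast
    have Rge: "A u + A u' + 2 * (\<bar>g u z\<bar> - \<bar>g u' z\<bar>) \<le> R z" if u: "u \<in> V" "u' \<in> V" for u u' z
    proof -
      have ge: "A w + 2 * g w z \<le> (MAX v\<in>V. A v + 2 * g v z)"
        "A w - 2 * g w z \<le> (MAX v\<in>V. A v - 2 * g v z)" if "w \<in> V" for w
        using V that by (auto intro!: Max_ge)
      show ?thesis unfolding R_def using ge[OF u(1)] ge[OF u(2)] by (cases "g u z \<ge> 0") auto
    qed
    from Rge[OF v(1) w(1), of x] Rge[OF w(1) v(1), of y] v(2) w(2) show ?thesis by argo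
  qed
  have "(\<integral>x. (MAX v\<in>V. A v + \<bar>g v x\<bar> - (\<integral>y. \<bar>g v y\<bar> \<partial>M)) \<partial>M) \<le> (\<integral>x. (\<integral>y. p x y \<partial>M) \<partial>M)"
  proof (rule integral_mono)
    show "integrable M (\<lambda>x. MAX v\<in>V. A v + \<bar>g v x\<bar> - (\<integral>y. \<bar>g v y\<bar> \<partial>M))"
    proof (rule integrable_const_bound[where B = "a + 2 * B"])
      show "AE x in M. norm (MAX v\<in>V. A v + \<bar>g v x\<bar> - (\<integral>y. \<bar>g v y\<bar> \<partial>M)) \<le> a + 2 * B"
        unfolding real_norm_def
      proof (intro AE_I2 abs_Max_le V)
        fix x v assume "x \<in> space M" "v \<in> V"
        then show "\<bar>A v + \<bar>g v x\<bar> - (\<integral>y. \<bar>g v y\<bar> \<partial>M)\<bar> \<le> a + 2 * B"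
          using a[of v] bound[of v x] Eg[of v] by linarith
      qed
      show "(\<lambda>x. MAX v\<in>V. A v + \<bar>g v x\<bar> - (\<integral>y. \<bar>g v y\<bar> \<partial>M)) \<in> borel_measurable M"
        using V by measurable
    qed
    show "integrable M (\<lambda>x. \<integral>y. p x y \<partial>M)" using pp.integrable_fst[OF ip] .
  qed (use step1 in auto)
  moreover have "2 * (\<integral>x. (\<integral>y. p x y \<partial>M) \<partial>M) \<le> (\<integral>x. R x \<partial>M)"
  proof -
    have "(\<integral>x. (\<integral>y. p x y \<partial>M) \<partial>M) = (\<integral>x. (\<integral>y. p y x \<partial>M) \<partial>M)"
      by (rule pp.Fubini_integral[OF ip, symmetric])
    then have "2 * (\<integral>x. (\<integral>y. p x y \<partial>M) \<partial>M)
        = (\<integral>z. (case z of (x, y) \<Rightarrow> p x y + p y x) \<partial>(M \<Otimes>\<^sub>M M))"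
      using pp.integral_fst[OF ip] pp.integral_fst[OF ip']
        Bochner_Integration.integral_add[OF ip ip'] by (simp add: case_prod_beta)
    also have "\<dots> \<le> (\<integral>z. (case z of (x, y) \<Rightarrow> (R x + R y) / 2) \<partial>(M \<Otimes>\<^sub>M M))"
    proof (rule pp.P.le_integral_bounded)
      show "\<bar>case z of (x, y) \<Rightarrow> p x y + p y x\<bar> \<le> 2 * (a + 2 * B)"
        if "z \<in> space (M \<Otimes>\<^sub>M M)" for z
        using bp[of "fst z" "snd z"] bp[of "snd z" "fst z"] that
        by (auto simp: space_pair_measure split: prod.splits)
      show "\<bar>case z of (x, y) \<Rightarrow> (R x + R y) / 2\<bar> \<le> 2 * (a + 2 * B)"
        if "z \<in> space (M \<Otimes>\<^sub>M M)" for z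
        using bR[of "fst z"] bR[of "snd z"] that
        by (auto simp: space_pair_measure split: prod.splits)
      show "(case z of (x, y) \<Rightarrow> p x y + p y x) \<le> (case z of (x, y) \<Rightarrow> (R x + R y) / 2)"
        if "z \<in> space (M \<Otimes>\<^sub>M M)" for z
        using step2 that by (auto simp: space_pair_measure)
    qed (use borel_measurable_integrable[OF ip] borel_measurable_integrable[OF ip'] in measurable)
    also have "\<dots> = (\<integral>x. (\<integral>y. (R x + R y) / 2 \<partial>M) \<partial>M)"
    proof (rule pp.integral_fst[symmetric])
      show "integrable (M \<Otimes>\<^sub>M M) (\<lambda>(x, y). (R x + R y) / 2)"
      proof (rule pp.P.integrable_const_bound[where B = "2 * (a + 2 * B)"])
        show "AE z in M \<Otimes>\<^sub>M M. norm (case z of (x, y) \<Rightarrow> (R x + R y) / 2) \<le> 2 * (a + 2 * B)"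
        proof (rule AE_I2)
          fix z assume "z \<in> space (M \<Otimes>\<^sub>M M)"
          then show "norm (case z of (x, y) \<Rightarrow> (R x + R y) / 2) \<le> 2 * (a + 2 * B)"
            using bR[of "fst z"] bR[of "snd z"]
            by (auto simp: space_pair_measure split: prod.splits)
        qed
      qed measurable
    qed
    also have "\<dots> = (\<integral>x. R x \<partial>M)"
      using iR by (simp add: prob_space)
    finally show ?thesis .
  qed
  ultimately show ?thesis unfolding R_def[symmetric] by simp
qed

lemma sum_mult_le_sqrt:
  fixes a b :: "'i \<Rightarrow> real"
  shows "\<bar>\<Sum>i\<in>I. a i * b i\<bar> \<le> sqrt (\<Sum>i\<in>I. (a i)\<^sup>2) * sqrt (\<Sum>i\<in>I. (b i)\<^sup>2)"
proof -
  have "sqrt ((\<Sum>i\<in>I. a i * b i)\<^sup>2) \<le> sqrt ((\<Sum>i\<in>I. (a i)\<^sup>2) * (\<Sum>i\<in>I. (b i)\<^sup>2))"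
    by (rule real_sqrt_le_mono[OF Cauchy_Schwarz_ineq_sum])
  then show ?thesis by (simp add: real_sqrt_mult)
qed

lemma mean_sqrt_le_sqrt_mean:
  assumes "0 \<le> a" "0 \<le> b"
  shows "(sqrt a + sqrt b) / 2 \<le> sqrt ((a + b) / 2)"
proof (rule real_le_rsqrt)
  have "0 \<le> (sqrt a - sqrt b)\<^sup>2" by simp
  then show "((sqrt a + sqrt b) / 2)\<^sup>2 \<le> (a + b) / 2"
    using assms by (simp add: power2_sum power2_diff power_divide field_simps)
qed

lemma (in prob_space) integral_sqrt_le:
  assumes [measurable]: "h \<in> borel_measurable M"
    and "\<And>x. x \<in> space M \<Longrightarrow> 0 \<le> h x" "\<And>x. x \<in> space M \<Longrightarrow> h x \<le> B"
  shows "(\<integral>x. sqrt (h x) \<partial>M) \<le> sqrt (\<integral>x. h x \<partial>M)"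
proof (rule real_le_rsqrt)
  have i: "integrable M (\<lambda>x. sqrt (h x))"
    by (rule integrable_const_bound[where B = "sqrt B"]) (use assms in auto)
  have i2: "integrable M (\<lambda>x. (sqrt (h x))\<^sup>2)"
    by (rule integrable_const_bound[where B = B]) (use assms in auto)
  have "0 \<le> variance (\<lambda>x. sqrt (h x))" by simp
  then have "(\<integral>x. sqrt (h x) \<partial>M)\<^sup>2 \<le> (\<integral>x. (sqrt (h x))\<^sup>2 \<partial>M)"
    using variance_eq[OF i i2] by simp
  also have "\<dots> = (\<integral>x. h x \<partial>M)"
    by (rule Bochner_Integration.integral_cong) (use assms in auto)
  finally show "(\<integral>x. sqrt (h x) \<partial>M)\<^sup>2 \<le> (\<integral>x. h x \<partial>M)" .
qed

text \<open>
  The linear term \<open>v \<bullet> u\<close> makes an induction over the sample possible: one application of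
  \<open>symmetrisation_step\<close> removes the contribution of one sample point \<open>y\<close> and shifts \<open>u\<close> by
  \<open>2 \<phi>(y)\<close> or \<open>- 2 \<phi>(y)\<close>.  Averaged over the two signs the squared length of \<open>u\<close> grows by
  \<open>4 \<parallel>\<phi>(y)\<parallel>\<^sup>2\<close>, and concavity of the square root moves both averages inside.
  The case \<open>u = 0\<close> is the Rademacher-type bound \<open>2 R sqrt (n E \<parallel>\<phi>\<parallel>\<^sup>2)\<close> for \<open>n\<close> points.
\<close>

lemma (in prob_space) expected_max_deviation_le:
  fixes \<phi> :: "nat \<Rightarrow> 'a \<Rightarrow> real" and V :: "(nat \<Rightarrow> real) set" and I :: "'i set"
  assumes V: "finite V" "V \<noteq> {}" and R: "0 \<le> R"
    and radius: "\<And>v. v \<in> V \<Longrightarrow> (\<Sum>i<m. (v i)\<^sup>2) \<le> R\<^sup>2"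
    and meas0: "\<And>i. i < m \<Longrightarrow> \<phi> i \<in> borel_measurable M"
    and bound: "\<And>i x. i < m \<Longrightarrow> x \<in> space M \<Longrightarrow> \<bar>\<phi> i x\<bar> \<le> b"
    and I: "finite I"
  shows "(\<integral>\<omega>. (MAX v\<in>V. (\<Sum>l\<in>I. \<bar>\<Sum>i<m. v i * \<phi> i (\<omega> l)\<bar> - (\<integral>x. \<bar>\<Sum>i<m. v i * \<phi> i x\<bar> \<partial>M))
        + (\<Sum>i<m. v i * u i)) \<partial>Pi\<^sub>M I (\<lambda>_. M))
    \<le> R * sqrt ((\<Sum>i<m. (u i)\<^sup>2) + 4 * card I * (\<integral>x. (\<Sum>i<m. (\<phi> i x)\<^sup>2) \<partial>M))"
proof -
  define g where "g v x = (\<Sum>i<m. v i * \<phi> i x)" for v x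
  define E where "E v = (\<integral>x. \<bar>g v x\<bar> \<partial>M)" for v
  define H where "H J u \<omega> = (MAX v\<in>V. (\<Sum>l\<in>J. \<bar>g v (\<omega> l)\<bar> - E v) + (\<Sum>i<m. v i * u i))"
    for J :: "'i set" and u \<omega>
  define q where "q x = (\<Sum>i<m. (\<phi> i x)\<^sup>2)" for x
  have meas[measurable]: "\<phi> i \<in> borel_measurable M" if "i \<in> {..<m}" for i
    using meas0 that by auto
  have mg[measurable]: "g v \<in> borel_measurable M" for v
    unfolding g_def by measurable
  obtain w where w: "\<And>v. v \<in> V \<Longrightarrow> (\<Sum>i<m. \<bar>v i\<bar>) \<le> w"
  proof -
    have "\<And>v. v \<in> V \<Longrightarrow> (\<Sum>i<m. \<bar>v i\<bar>) \<le> (MAX v\<in>V. (\<Sum>i<m. \<bar>v i\<bar>))" using V by auto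
    then show ?thesis using that by blast
  qed
  define c where "c = w * \<bar>b\<bar>"
  have lin: "\<bar>\<Sum>i<m. v i * y i\<bar> \<le> w * d" if "v \<in> V" "\<And>i. i < m \<Longrightarrow> \<bar>y i\<bar> \<le> d" "0 \<le> d" for v y d
  proof -
    have "\<bar>\<Sum>i<m. v i * y i\<bar> \<le> (\<Sum>i<m. \<bar>v i * y i\<bar>)" by (rule sum_abs)
    also have "\<dots> \<le> (\<Sum>i<m. \<bar>v i\<bar> * d)"
      by (rule sum_mono) (use that in \<open>auto simp: abs_mult intro!: mult_left_mono\<close>)
    also have "\<dots> = (\<Sum>i<m. \<bar>v i\<bar>) * d" by (simp add: sum_distrib_right)
    also have "\<dots> \<le> w * d" using w[OF that(1)] that(3) by (rule mult_right_mono)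
    finally show ?thesis .
  qed
  have bg: "\<bar>g v x\<bar> \<le> c" if "v \<in> V" "x \<in> space M" for v x
    unfolding g_def c_def using bound[OF _ that(2)] by (intro lin that(1)) (fastforce intro: order.trans[OF _ abs_ge_self])+
  have bE: "\<bar>E v\<bar> \<le> c" if v: "v \<in> V" for v
  proof -
    have "E v \<le> (\<integral>x. c \<partial>M)" unfolding E_def
    proof (rule integral_mono)
      show "integrable M (\<lambda>x. \<bar>g v x\<bar>)"
        by (rule integrable_const_bound[where B = c]) (use bg v in auto)
    qed (use bg v in auto)
    moreover have "0 \<le> E v" unfolding E_def by simp
    ultimately show ?thesis by (simp add: prob_space)
  qed
  have mH[measurable]: "H J u \<in> borel_measurable (Pi\<^sub>M J (\<lambda>_. M))" for J u
    unfolding H_def using V by measurable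
  have bH: "\<bar>H J u \<omega>\<bar> \<le> card J * (2 * c) + w * d"
    if "\<omega> \<in> space (Pi\<^sub>M J (\<lambda>_. M))" "\<And>i. i < m \<Longrightarrow> \<bar>u i\<bar> \<le> d" "0 \<le> d" for J u d \<omega>
    unfolding H_def
  proof (rule abs_Max_le[OF V])
    fix v assume v: "v \<in> V"
    have "\<bar>\<Sum>l\<in>J. \<bar>g v (\<omega> l)\<bar> - E v\<bar> \<le> (\<Sum>l\<in>J. \<bar>\<bar>g v (\<omega> l)\<bar> - E v\<bar>)" by (rule sum_abs)
    also have "\<dots> \<le> (\<Sum>l\<in>J. 2 * c)"
    proof (rule sum_mono)
      fix l assume "l \<in> J"
      then have "\<omega> l \<in> space M" using that(1) by (auto simp: space_PiM)
      then show "\<bar>\<bar>g v (\<omega> l)\<bar> - E v\<bar> \<le> 2 * c" using bg[OF v, of "\<omega> l"] bE[OF v] by linarith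
    qed
    finally have "\<bar>\<Sum>l\<in>J. \<bar>g v (\<omega> l)\<bar> - E v\<bar> \<le> card J * (2 * c)" by simp
    then show "\<bar>(\<Sum>l\<in>J. \<bar>g v (\<omega> l)\<bar> - E v) + (\<Sum>i<m. v i * u i)\<bar> \<le> card J * (2 * c) + w * d"
      using lin[OF v, of u d, OF that(2,3)] by linarith
  qed
  have q0: "0 \<le> q x" for x unfolding q_def by (simp add: sum_nonneg)
  have mq[measurable]: "q \<in> borel_measurable M" unfolding q_def by measurable
  have bq: "q x \<le> m * b\<^sup>2" if x: "x \<in> space M" for x
  proof -
    have "q x \<le> (\<Sum>i<m. b\<^sup>2)" unfolding q_def
    proof (rule sum_mono)
      fix i assume "i \<in> {..<m}"
      then have "\<bar>\<phi> i x\<bar> \<le> b" using bound x by auto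
      then show "(\<phi> i x)\<^sup>2 \<le> b\<^sup>2" by (rule abs_le_square_iff[THEN iffD1, OF order.trans]) simp
    qed
    then show ?thesis by simp
  qed
  have iq: "integrable M q"
    by (rule integrable_const_bound[where B = "m * b\<^sup>2"]) (use bq q0 in auto)
  have main: "(\<integral>\<omega>. H I u \<omega> \<partial>Pi\<^sub>M I (\<lambda>_. M)) \<le> R * sqrt ((\<Sum>i<m. (u i)\<^sup>2) + 4 * card I * (\<integral>x. q x \<partial>M))"
    for u using I
  proof (induction I arbitrary: u rule: finite_induct)
    case empty
    interpret p: prob_space "Pi\<^sub>M ({} :: 'i set) (\<lambda>_. M)" by (rule prob_space_PiM) (rule prob_space_axioms)
    have "(\<Sum>i<m. v i * u i) \<le> R * sqrt (\<Sum>i<m. (u i)\<^sup>2)" if v: "v \<in> V" for v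
    proof -
      have "(\<Sum>i<m. v i * u i) \<le> sqrt (\<Sum>i<m. (v i)\<^sup>2) * sqrt (\<Sum>i<m. (u i)\<^sup>2)"
        using sum_mult_le_sqrt[of v u "{..<m}"] by linarith
      also have "\<dots> \<le> R * sqrt (\<Sum>i<m. (u i)\<^sup>2)"
        using real_le_lsqrt[OF R radius[OF v]] by (intro mult_right_mono) (auto simp: sum_nonneg)
      finally show ?thesis .
    qed
    then show ?case using V by (simp add: H_def p.prob_space)
  next
    case (insert j J)
    interpret pJ: prob_space "Pi\<^sub>M J (\<lambda>_. M)" by (rule prob_space_PiM) (rule prob_space_axioms)
    interpret pI: prob_space "Pi\<^sub>M (insert j J) (\<lambda>_. M)" by (rule prob_space_PiM) (rule prob_space_axioms)
    interpret ps: product_prob_space "\<lambda>_. M" "UNIV :: 'i set" by unfold_locales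
    interpret pp: pair_prob_space "Pi\<^sub>M J (\<lambda>_. M)" M ..
    define d where "d = (\<Sum>i<m. \<bar>u i\<bar>) + 2 * \<bar>b\<bar>"
    have d0: "0 \<le> d" unfolding d_def by (simp add: sum_nonneg)
    have du: "\<bar>u i\<bar> \<le> d" "\<bar>u i + 2 * \<phi> i y\<bar> \<le> d" "\<bar>u i - 2 * \<phi> i y\<bar> \<le> d"
      if "i < m" "y \<in> space M" for i y
    proof -
      have "\<bar>u i\<bar> \<le> (\<Sum>i<m. \<bar>u i\<bar>)" using that by (intro member_le_sum) auto
      then show "\<bar>u i\<bar> \<le> d" "\<bar>u i + 2 * \<phi> i y\<bar> \<le> d" "\<bar>u i - 2 * \<phi> i y\<bar> \<le> d"
        unfolding d_def using bound[OF that] by linarith+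
    qed
    obtain y0 where y0: "y0 \<in> space M" using not_empty by auto
    define Bd where "Bd = card J * (2 * c) + w * d"
    define W where "W x y = (H J (\<lambda>i. u i + 2 * \<phi> i y) x + H J (\<lambda>i. u i - 2 * \<phi> i y) x) / 2" for x y
    have bW: "\<bar>W x y\<bar> \<le> Bd" if "x \<in> space (Pi\<^sub>M J (\<lambda>_. M))" "y \<in> space M" for x y
    proof -
      have "\<bar>H J (\<lambda>i. u i + 2 * \<phi> i y) x\<bar> \<le> Bd" "\<bar>H J (\<lambda>i. u i - 2 * \<phi> i y) x\<bar> \<le> Bd"
        unfolding Bd_def using du(2,3)[OF _ that(2)] by (intro bH that(1) d0; simp)+
      then show ?thesis unfolding W_def by (simp add: abs_le_iff)
    qed
    have mW[measurable]: "case_prod W \<in> borel_measurable (Pi\<^sub>M J (\<lambda>_. M) \<Otimes>\<^sub>M M)"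
      unfolding W_def H_def case_prod_beta using V by measurable
    have iW: "integrable (Pi\<^sub>M J (\<lambda>_. M) \<Otimes>\<^sub>M M) (case_prod W)"
      by (rule pp.P.integrable_const_bound[where B = Bd]) (use bW in \<open>auto simp: space_pair_measure\<close>)
    have iH: "integrable (Pi\<^sub>M (insert j J) (\<lambda>_. M)) (H (insert j J) u)"
      by (rule pI.integrable_const_bound[where B = "card (insert j J) * (2 * c) + w * d"])
        (use bH du(1)[OF _ y0] d0 in auto)
    have split: "H (insert j J) u (x(j := y))
        = (MAX v\<in>V. ((\<Sum>l\<in>J. \<bar>g v (x l)\<bar> - E v) + (\<Sum>i<m. v i * u i)) + \<bar>g v y\<bar> - E v)" for x y
    proof -
      have "(\<Sum>l\<in>J. \<bar>g v ((x(j := y)) l)\<bar> - E v) = (\<Sum>l\<in>J. \<bar>g v (x l)\<bar> - E v)" for v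
        by (rule sum.cong) (use insert.hyps in auto)
      then show ?thesis unfolding H_def using insert.hyps by (simp add: algebra_simps)
    qed
    have inner: "(\<integral>y. H (insert j J) u (x(j := y)) \<partial>M) \<le> (\<integral>y. W x y \<partial>M)"
      if x: "x \<in> space (Pi\<^sub>M J (\<lambda>_. M))" for x
    proof -
      have W: "W x y = ((MAX v\<in>V. ((\<Sum>l\<in>J. \<bar>g v (x l)\<bar> - E v) + (\<Sum>i<m. v i * u i)) + 2 * g v y)
          + (MAX v\<in>V. ((\<Sum>l\<in>J. \<bar>g v (x l)\<bar> - E v) + (\<Sum>i<m. v i * u i)) - 2 * g v y)) / 2" for y
        unfolding W_def H_def g_def
        by (simp add: algebra_simps sum.distrib sum_subtractf sum_distrib_left)
      show ?thesis unfolding split W E_def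
        by (rule symmetrisation_step[OF V, where B = c]) (use bg in auto)
    qed
    have "(\<integral>\<omega>. H (insert j J) u \<omega> \<partial>Pi\<^sub>M (insert j J) (\<lambda>_. M))
        = (\<integral>x. (\<integral>y. H (insert j J) u (x(j := y)) \<partial>M) \<partial>Pi\<^sub>M J (\<lambda>_. M))"
      by (rule ps.product_integral_insert[OF insert.hyps(1,2) iH])
    also have "\<dots> \<le> (\<integral>x. (\<integral>y. W x y \<partial>M) \<partial>Pi\<^sub>M J (\<lambda>_. M))"
    proof (rule integral_mono)
      have "integrable (Pi\<^sub>M J (\<lambda>_. M) \<Otimes>\<^sub>M M) (\<lambda>(x, y). H (insert j J) u (x(j := y)))"
      proof (rule pp.P.integrable_const_bound[where B = "card (insert j J) * (2 * c) + w * d"])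
        show "(\<lambda>(x, y). H (insert j J) u (x(j := y))) \<in> borel_measurable (Pi\<^sub>M J (\<lambda>_. M) \<Otimes>\<^sub>M M)"
          unfolding split case_prod_beta using V by measurable
        show "AE z in Pi\<^sub>M J (\<lambda>_. M) \<Otimes>\<^sub>M M. norm (case z of (x, y) \<Rightarrow> H (insert j J) u (x(j := y)))
            \<le> card (insert j J) * (2 * c) + w * d"
        proof (rule AE_I2)
          fix z assume "z \<in> space (Pi\<^sub>M J (\<lambda>_. M) \<Otimes>\<^sub>M M)"
          then have "(fst z)(j := snd z) \<in> space (Pi\<^sub>M (insert j J) (\<lambda>_. M))"
            by (auto simp: space_pair_measure space_PiM PiE_iff extensional_def)
          then show "norm (case z of (x, y) \<Rightarrow> H (insert j J) u (x(j := y)))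
              \<le> card (insert j J) * (2 * c) + w * d"
            using bH[of _ "insert j J" u d] du(1)[OF _ y0] d0 by (auto split: prod.splits)
        qed
      qed
      then show "integrable (Pi\<^sub>M J (\<lambda>_. M)) (\<lambda>x. \<integral>y. H (insert j J) u (x(j := y)) \<partial>M)"
        by (rule pp.integrable_fst)
      show "integrable (Pi\<^sub>M J (\<lambda>_. M)) (\<lambda>x. \<integral>y. W x y \<partial>M)"
        by (rule pp.integrable_fst[OF iW])
    qed (use inner in auto)
    also have "\<dots> = (\<integral>y. (\<integral>x. W x y \<partial>Pi\<^sub>M J (\<lambda>_. M)) \<partial>M)"
      by (rule pp.Fubini_integral[OF iW, symmetric])
    also have "\<dots> \<le> (\<integral>y. R * sqrt ((\<Sum>i<m. (u i)\<^sup>2) + 4 * q y + 4 * card J * (\<integral>x. q x \<partial>M)) \<partial>M)"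
    proof (rule integral_mono)
      show "integrable M (\<lambda>y. \<integral>x. W x y \<partial>Pi\<^sub>M J (\<lambda>_. M))" by (rule pp.integrable_snd[OF iW])
      show "integrable M (\<lambda>y. R * sqrt ((\<Sum>i<m. (u i)\<^sup>2) + 4 * q y + 4 * card J * (\<integral>x. q x \<partial>M)))"
      proof (rule integrable_const_bound[where
            B = "R * sqrt ((\<Sum>i<m. (u i)\<^sup>2) + 4 * (m * b\<^sup>2) + 4 * card J * (\<integral>x. q x \<partial>M))"])
        show "AE y in M. norm (R * sqrt ((\<Sum>i<m. (u i)\<^sup>2) + 4 * q y + 4 * card J * (\<integral>x. q x \<partial>M)))
          \<le> R * sqrt ((\<Sum>i<m. (u i)\<^sup>2) + 4 * (m * b\<^sup>2) + 4 * card J * (\<integral>x. q x \<partial>M))"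
          using R q0 bq by (auto intro!: AE_I2 mult_left_mono simp: abs_mult sum_nonneg)
      qed measurable
      fix y assume y: "y \<in> space M"
      let ?a = "(\<Sum>i<m. (u i + 2 * \<phi> i y)\<^sup>2) + 4 * card J * (\<integral>x. q x \<partial>M)"
      let ?b = "(\<Sum>i<m. (u i - 2 * \<phi> i y)\<^sup>2) + 4 * card J * (\<integral>x. q x \<partial>M)"
      have i1: "integrable (Pi\<^sub>M J (\<lambda>_. M)) (H J u')" if "\<And>i. i < m \<Longrightarrow> \<bar>u' i\<bar> \<le> d" for u'
        by (rule pJ.integrable_const_bound[where B = "card J * (2 * c) + w * d"])
          (use bH that d0 in auto)
      have "(\<integral>x. W x y \<partial>Pi\<^sub>M J (\<lambda>_. M))
        = ((\<integral>x. H J (\<lambda>i. u i + 2 * \<phi> i y) x \<partial>Pi\<^sub>M J (\<lambda>_. M))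
          + (\<integral>x. H J (\<lambda>i. u i - 2 * \<phi> i y) x \<partial>Pi\<^sub>M J (\<lambda>_. M))) / 2"
        unfolding W_def using i1[OF du(2)[OF _ y]] i1[OF du(3)[OF _ y]] by simp
      also have "\<dots> \<le> (R * sqrt ?a + R * sqrt ?b) / 2"
        using insert.IH by (intro divide_right_mono add_mono) auto
      also have "\<dots> = R * ((sqrt ?a + sqrt ?b) / 2)" by (simp add: algebra_simps)
      also have "\<dots> \<le> R * sqrt ((?a + ?b) / 2)"
        using R q0 by (intro mult_left_mono mean_sqrt_le_sqrt_mean add_nonneg_nonneg sum_nonneg
            mult_nonneg_nonneg integral_nonneg_AE) auto
      also have "(?a + ?b) / 2 = (\<Sum>i<m. (u i)\<^sup>2) + 4 * q y + 4 * card J * (\<integral>x. q x \<partial>M)"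
      proof -
        have "(\<Sum>i<m. (u i + 2 * \<phi> i y)\<^sup>2) + (\<Sum>i<m. (u i - 2 * \<phi> i y)\<^sup>2)
            = (\<Sum>i<m. 2 * (u i)\<^sup>2 + 8 * (\<phi> i y)\<^sup>2)"
          unfolding sum.distrib[symmetric]
          by (rule sum.cong) (auto simp: power2_eq_square algebra_simps)
        also have "\<dots> = 2 * (\<Sum>i<m. (u i)\<^sup>2) + 8 * q y"
          by (simp add: q_def sum.distrib sum_distrib_left)
        finally show ?thesis by (simp add: field_simps)
      qed
      finally show "(\<integral>x. W x y \<partial>Pi\<^sub>M J (\<lambda>_. M))
        \<le> R * sqrt ((\<Sum>i<m. (u i)\<^sup>2) + 4 * q y + 4 * card J * (\<integral>x. q x \<partial>M))" .
    qed
    also have "\<dots> = R * (\<integral>y. sqrt ((\<Sum>i<m. (u i)\<^sup>2) + 4 * q y + 4 * card J * (\<integral>x. q x \<partial>M)) \<partial>M)"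
      by simp
    also have "\<dots> \<le> R * sqrt (\<integral>y. (\<Sum>i<m. (u i)\<^sup>2) + 4 * q y + 4 * card J * (\<integral>x. q x \<partial>M) \<partial>M)"
    proof (rule mult_left_mono[OF _ R], rule integral_sqrt_le)
      show "(\<Sum>i<m. (u i)\<^sup>2) + 4 * q y + 4 * card J * (\<integral>x. q x \<partial>M)
        \<le> (\<Sum>i<m. (u i)\<^sup>2) + 4 * (m * b\<^sup>2) + 4 * card J * (\<integral>x. q x \<partial>M)" if "y \<in> space M" for y
        using bq[OF that] by simp
      show "0 \<le> (\<Sum>i<m. (u i)\<^sup>2) + 4 * q y + 4 * card J * (\<integral>x. q x \<partial>M)" for y
        using q0 by (intro add_nonneg_nonneg sum_nonneg mult_nonneg_nonneg integral_nonneg_AE) auto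
    qed measurable
    also have "(\<integral>y. (\<Sum>i<m. (u i)\<^sup>2) + 4 * q y + 4 * card J * (\<integral>x. q x \<partial>M) \<partial>M)
        = (\<Sum>i<m. (u i)\<^sup>2) + 4 * card (insert j J) * (\<integral>x. q x \<partial>M)"
      using iq insert.hyps by (simp add: prob_space algebra_simps)
    finally show ?case .
  qed
  show ?thesis using main[of u] unfolding H_def g_def E_def q_def .
qed

text \<open>The cross terms of independent centred summands vanish.\<close>

lemma (in prob_space) integral_square_sum_PiM:
  fixes h :: "'a \<Rightarrow> real" and I :: "'i set"
  assumes [measurable]: "h \<in> borel_measurable M"
    and bound: "\<And>x. x \<in> space M \<Longrightarrow> \<bar>h x\<bar> \<le> B"
    and centred: "(\<integral>x. h x \<partial>M) = 0" and I: "finite I"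
  shows "(\<integral>\<omega>. (\<Sum>l\<in>I. h (\<omega> l))\<^sup>2 \<partial>Pi\<^sub>M I (\<lambda>_. M)) = card I * (\<integral>x. (h x)\<^sup>2 \<partial>M)"
  using I
proof (induction I rule: finite_induct)
  case (insert j J)
  interpret pJ: prob_space "Pi\<^sub>M J (\<lambda>_. M)" by (rule prob_space_PiM) (rule prob_space_axioms)
  interpret pI: prob_space "Pi\<^sub>M (insert j J) (\<lambda>_. M)" by (rule prob_space_PiM) (rule prob_space_axioms)
  interpret ps: product_prob_space "\<lambda>_. M" "UNIV :: 'i set" by unfold_locales
  have bs: "\<bar>\<Sum>l\<in>K. h (\<omega> l)\<bar> \<le> card K * B" if "\<omega> \<in> space (Pi\<^sub>M K (\<lambda>_. M))" for \<omega> K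
  proof -
    have "\<bar>\<Sum>l\<in>K. h (\<omega> l)\<bar> \<le> (\<Sum>l\<in>K. B)"
      by (rule order.trans[OF sum_abs sum_mono]) (use that bound in \<open>auto simp: space_PiM\<close>)
    then show ?thesis by simp
  qed
  have sq: "\<bar>z\<^sup>2\<bar> \<le> c\<^sup>2" if "\<bar>z\<bar> \<le> c" for z c :: real
    using that by (metis abs_ge_zero abs_power2 power2_abs power_mono)
  have ih: "integrable M h" by (rule integrable_const_bound[where B = B]) (use bound in auto)
  have ih2: "integrable M (\<lambda>x. (h x)\<^sup>2)"
    by (rule integrable_const_bound[where B = "B\<^sup>2"]) (use bound sq in auto)
  have is2: "integrable (Pi\<^sub>M K (\<lambda>_. M)) (\<lambda>\<omega>. (\<Sum>l\<in>K. h (\<omega> l))\<^sup>2)" if "finite K" for K :: "'i set"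
  proof -
    interpret pK: prob_space "Pi\<^sub>M K (\<lambda>_. M)" by (rule prob_space_PiM) (rule prob_space_axioms)
    show ?thesis
      by (rule pK.integrable_const_bound[where B = "(card K * B)\<^sup>2"]) (use sq[OF bs] in auto)
  qed
  have "(\<integral>\<omega>. (\<Sum>l\<in>insert j J. h (\<omega> l))\<^sup>2 \<partial>Pi\<^sub>M (insert j J) (\<lambda>_. M))
      = (\<integral>x. (\<integral>y. (\<Sum>l\<in>insert j J. h ((x(j := y)) l))\<^sup>2 \<partial>M) \<partial>Pi\<^sub>M J (\<lambda>_. M))"
    using insert.hyps by (intro ps.product_integral_insert is2) auto
  also have "\<dots> = (\<integral>x. (\<Sum>l\<in>J. h (x l))\<^sup>2 + (\<integral>y. (h y)\<^sup>2 \<partial>M) \<partial>Pi\<^sub>M J (\<lambda>_. M))"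
  proof (rule Bochner_Integration.integral_cong[OF refl])
    fix x
    have "(\<Sum>l\<in>J. h ((x(j := y)) l)) = (\<Sum>l\<in>J. h (x l))" for y
      by (rule sum.cong) (use insert.hyps in auto)
    then have "(\<integral>y. (\<Sum>l\<in>insert j J. h ((x(j := y)) l))\<^sup>2 \<partial>M)
        = (\<integral>y. (h y)\<^sup>2 + (2 * (\<Sum>l\<in>J. h (x l))) * h y + (\<Sum>l\<in>J. h (x l))\<^sup>2 \<partial>M)"
      using insert.hyps by (simp add: power2_sum algebra_simps)
    also have "\<dots> = (\<Sum>l\<in>J. h (x l))\<^sup>2 + (\<integral>y. (h y)\<^sup>2 \<partial>M)"
      using ih ih2 centred by (simp add: prob_space)
    finally show "(\<integral>y. (\<Sum>l\<in>insert j J. h ((x(j := y)) l))\<^sup>2 \<partial>M)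
      = (\<Sum>l\<in>J. h (x l))\<^sup>2 + (\<integral>y. (h y)\<^sup>2 \<partial>M)" .
  qed
  also have "\<dots> = card (insert j J) * (\<integral>x. (h x)\<^sup>2 \<partial>M)"
    using insert.hyps insert.IH is2[of J] by (simp add: pJ.prob_space algebra_simps)
  finally show ?case .
qed simp

section \<open>Concentration of the empirical Gram matrix and Lebesgue functions\<close>

lemma integral_double_sum:
  fixes F :: "nat \<Rightarrow> nat \<Rightarrow> 'a \<Rightarrow> real"
  assumes F: "\<And>i j. i < m \<Longrightarrow> j < m \<Longrightarrow> integrable M (F i j)"
  shows "(\<integral>x. (\<Sum>i<m. \<Sum>j<m. F i j x) \<partial>M) = (\<Sum>i<m. \<Sum>j<m. (\<integral>x. F i j x \<partial>M))"
proof -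
  have "(\<integral>x. (\<Sum>i<m. \<Sum>j<m. F i j x) \<partial>M) = (\<Sum>i<m. (\<integral>x. (\<Sum>j<m. F i j x) \<partial>M))"
    using F by (intro Bochner_Integration.integral_sum Bochner_Integration.integrable_sum) auto
  also have "\<dots> = (\<Sum>i<m. \<Sum>j<m. (\<integral>x. F i j x \<partial>M))"
    using F by (intro sum.cong refl Bochner_Integration.integral_sum) auto
  finally show ?thesis .
qed

text \<open>
  The entries of the empirical Gram matrix are sample means, so the expected squared Frobenius
  error is \<open>1 / L\<close> times a sum of variances.  That sum is at most \<open>E \<parallel>\<phi>\<parallel>\<^sup>4\<close>, of which one factor
  \<open>\<parallel>\<phi>\<parallel>\<^sup>2\<close> is bounded pointwise and the other in expectation.
\<close>

lemma (in prob_space) expected_gram_error_le: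
  fixes \<phi> :: "nat \<Rightarrow> 'a \<Rightarrow> real"
  assumes meas0: "\<And>i. i < m \<Longrightarrow> \<phi> i \<in> borel_measurable M"
    and bound: "\<And>x. x \<in> space M \<Longrightarrow> (\<Sum>i<m. (\<phi> i x)\<^sup>2) \<le> b\<^sup>2" and b: "0 \<le> b"
    and L: "1 \<le> L"
  shows "(\<integral>\<omega>. (\<Sum>i<m. \<Sum>j<m. ((\<Sum>l=1..L. \<phi> i (\<omega> l) * \<phi> j (\<omega> l)) / real L
          - (\<integral>x. \<phi> i x * \<phi> j x \<partial>M))\<^sup>2) \<partial>Pi\<^sub>M {1..L} (\<lambda>_. M))
      \<le> b\<^sup>2 * (\<integral>x. (\<Sum>i<m. (\<phi> i x)\<^sup>2) \<partial>M) / L" (is "?lhs \<le> ?rhs")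
    and "integrable (Pi\<^sub>M {1..L} (\<lambda>_. M)) (\<lambda>\<omega>. \<Sum>i<m. \<Sum>j<m.
        ((\<Sum>l=1..L. \<phi> i (\<omega> l) * \<phi> j (\<omega> l)) / real L - (\<integral>x. \<phi> i x * \<phi> j x \<partial>M))\<^sup>2)" (is ?int)
proof -
  interpret P: prob_space "Pi\<^sub>M {1..L} (\<lambda>_. M)" by (rule prob_space_PiM) (rule prob_space_axioms)
  have meas[measurable]: "\<phi> i \<in> borel_measurable M" if "i \<in> {..<m}" for i
    using meas0 that by auto
  have bi: "\<bar>\<phi> i x\<bar> \<le> b" if "i < m" "x \<in> space M" for i x
  proof -
    have "(\<phi> i x)\<^sup>2 \<le> (\<Sum>i<m. (\<phi> i x)\<^sup>2)" using that by (intro member_le_sum) auto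
    then have "(\<phi> i x)\<^sup>2 \<le> b\<^sup>2" using bound[OF that(2)] by linarith
    then show ?thesis using b abs_le_square_iff[of "\<phi> i x" b] by simp
  qed
  have bij: "\<bar>\<phi> i x * \<phi> j x\<bar> \<le> b * b" if "i < m" "j < m" "x \<in> space M" for i j x
    unfolding abs_mult using bi that b by (intro mult_mono) auto
  define e where "e i j = (\<integral>x. \<phi> i x * \<phi> j x \<partial>M)" for i j
  define h where "h i j x = \<phi> i x * \<phi> j x - e i j" for i j x
  have mh[measurable]: "h i j \<in> borel_measurable M" if "i \<in> {..<m}" "j \<in> {..<m}" for i j
    unfolding h_def using that by measurable
  have iij: "integrable M (\<lambda>x. \<phi> i x * \<phi> j x)" if "i < m" "j < m" for i j
    by (rule integrable_const_bound[where B = "b * b"]) (use that bij meas0 in auto)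
  have iij2: "integrable M (\<lambda>x. (\<phi> i x * \<phi> j x)\<^sup>2)" if "i < m" "j < m" for i j
  proof (rule integrable_const_bound[where B = "(b * b)\<^sup>2"])
    show "AE x in M. norm ((\<phi> i x * \<phi> j x)\<^sup>2) \<le> (b * b)\<^sup>2"
      unfolding real_norm_def abs_power2
      using bij[OF that] b by (intro AE_I2) (subst power2_le_iff_abs_le; simp)
  qed (use that meas0 in auto)
  have bh: "\<bar>h i j x\<bar> \<le> b * b + \<bar>e i j\<bar>" if "i < m" "j < m" "x \<in> space M" for i j x
    unfolding h_def using bij[OF that] by linarith
  have h0: "(\<integral>x. h i j x \<partial>M) = 0" if "i < m" "j < m" for i j
    unfolding h_def using iij[OF that] by (simp add: prob_space e_def)
  have vh: "(\<integral>x. (h i j x)\<^sup>2 \<partial>M) \<le> (\<integral>x. (\<phi> i x * \<phi> j x)\<^sup>2 \<partial>M)" if "i < m" "j < m" for i j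
    using variance_eq[OF iij[OF that] iij2[OF that]] unfolding h_def e_def by simp
  have eq: "(\<Sum>l=1..L. \<phi> i (\<omega> l) * \<phi> j (\<omega> l)) / real L - e i j = (\<Sum>l=1..L. h i j (\<omega> l)) / L" for i j \<omega>
    using L by (simp add: h_def sum_subtractf field_simps)
  have bs: "\<bar>\<Sum>l=1..L. h i j (\<omega> l)\<bar> \<le> L * (b * b + \<bar>e i j\<bar>)"
    if "i < m" "j < m" "\<omega> \<in> space (Pi\<^sub>M {1..L} (\<lambda>_. M))" for i j \<omega>
  proof -
    have "\<bar>\<Sum>l=1..L. h i j (\<omega> l)\<bar> \<le> (\<Sum>l=1..L. b * b + \<bar>e i j\<bar>)"
      by (rule order.trans[OF sum_abs sum_mono]) (use that bh in \<open>auto simp: space_PiM PiE_iff\<close>)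
    then show ?thesis by simp
  qed
  have ih: "integrable (Pi\<^sub>M {1..L} (\<lambda>_. M)) (\<lambda>\<omega>. (\<Sum>l=1..L. h i j (\<omega> l))\<^sup>2)" if "i < m" "j < m" for i j
  proof (rule P.integrable_const_bound[where B = "(L * (b * b + \<bar>e i j\<bar>))\<^sup>2"])
    show "AE \<omega> in Pi\<^sub>M {1..L} (\<lambda>_. M). norm ((\<Sum>l=1..L. h i j (\<omega> l))\<^sup>2) \<le> (L * (b * b + \<bar>e i j\<bar>))\<^sup>2"
      using bs[OF that] b by (intro AE_I2) (simp add: abs_le_square_iff[symmetric] abs_mult)
    show "(\<lambda>\<omega>. (\<Sum>l=1..L. h i j (\<omega> l))\<^sup>2) \<in> borel_measurable (Pi\<^sub>M {1..L} (\<lambda>_. M))"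
    proof -
      have [measurable]: "h i j \<in> borel_measurable M" using mh[of i j] that by simp
      show ?thesis by measurable
    qed
  qed
  show ?int unfolding e_def[symmetric] eq power_divide
    using ih by (intro Bochner_Integration.integrable_sum) auto
  have "?lhs = (\<Sum>i<m. \<Sum>j<m. (\<integral>\<omega>. (\<Sum>l=1..L. h i j (\<omega> l))\<^sup>2 \<partial>Pi\<^sub>M {1..L} (\<lambda>_. M)) / (real L)\<^sup>2)"
    unfolding e_def[symmetric] eq power_divide using ih by (subst integral_double_sum) auto
  also have "\<dots> = (\<Sum>i<m. \<Sum>j<m. (\<integral>x. (h i j x)\<^sup>2 \<partial>M) / L)"
  proof (intro sum.cong refl)
    fix i j assume "i \<in> {..<m}" "j \<in> {..<m}"
    then have "(\<integral>\<omega>. (\<Sum>l=1..L. h i j (\<omega> l))\<^sup>2 \<partial>Pi\<^sub>M {1..L} (\<lambda>_. M)) = card {1..L} * (\<integral>x. (h i j x)\<^sup>2 \<partial>M)"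
      using bh h0 by (intro integral_square_sum_PiM) auto
    then show "(\<integral>\<omega>. (\<Sum>l=1..L. h i j (\<omega> l))\<^sup>2 \<partial>Pi\<^sub>M {1..L} (\<lambda>_. M)) / (real L)\<^sup>2
        = (\<integral>x. (h i j x)\<^sup>2 \<partial>M) / L"
      using L by (simp add: power2_eq_square)
  qed
  also have "\<dots> \<le> (\<Sum>i<m. \<Sum>j<m. (\<integral>x. (\<phi> i x * \<phi> j x)\<^sup>2 \<partial>M) / L)"
    using vh by (intro sum_mono divide_right_mono) auto
  also have "\<dots> = (\<integral>x. (\<Sum>i<m. \<Sum>j<m. (\<phi> i x * \<phi> j x)\<^sup>2) \<partial>M) / L"
    using iij2 by (subst integral_double_sum) (auto simp: sum_divide_distrib)
  also have "\<dots> \<le> (\<integral>x. b\<^sup>2 * (\<Sum>i<m. (\<phi> i x)\<^sup>2) \<partial>M) / L"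
  proof (intro divide_right_mono integral_mono)
    show "integrable M (\<lambda>x. \<Sum>i<m. \<Sum>j<m. (\<phi> i x * \<phi> j x)\<^sup>2)"
      using iij2 by (intro Bochner_Integration.integrable_sum) auto
    show "integrable M (\<lambda>x. b\<^sup>2 * (\<Sum>i<m. (\<phi> i x)\<^sup>2))"
      using iij by (intro integrable_mult_right Bochner_Integration.integrable_sum)
        (auto simp: power2_eq_square)
    fix x assume x: "x \<in> space M"
    have "(\<Sum>i<m. \<Sum>j<m. (\<phi> i x * \<phi> j x)\<^sup>2) = (\<Sum>i<m. (\<phi> i x)\<^sup>2) * (\<Sum>i<m. (\<phi> i x)\<^sup>2)"
      by (simp add: sum_product power_mult_distrib)
    also have "\<dots> \<le> b\<^sup>2 * (\<Sum>i<m. (\<phi> i x)\<^sup>2)"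
      using bound[OF x] by (intro mult_right_mono) (auto simp: sum_nonneg)
    finally show "(\<Sum>i<m. \<Sum>j<m. (\<phi> i x * \<phi> j x)\<^sup>2) \<le> b\<^sup>2 * (\<Sum>i<m. (\<phi> i x)\<^sup>2)" .
  qed auto
  finally show "?lhs \<le> ?rhs" by simp
qed

text \<open>
  Markov's inequality for the two expectations above, carried from the product space of the sample
  to the space \<open>M\<close> on which the sample lives.  The zero vector belongs to \<open>V\<close> so that
  the maximal deviation is nonnegative, as Markov's inequality requires.
\<close>

lemma (in prob_space) prob_regression_failure_le:
  fixes \<phi> :: "nat \<Rightarrow> 'b \<Rightarrow> real" and S :: "nat \<Rightarrow> 'a \<Rightarrow> 'b" and V :: "(nat \<Rightarrow> real) set"
  assumes N: "prob_space N"
    and S: "indep_vars (\<lambda>_. N) S {1..L}" "\<And>l. l \<in> {1..L} \<Longrightarrow> distr M N (S l) = N"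
    and meas0: "\<And>i. i < m \<Longrightarrow> \<phi> i \<in> borel_measurable N"
    and bound: "\<And>x. x \<in> space N \<Longrightarrow> (\<Sum>i<m. (\<phi> i x)\<^sup>2) \<le> b\<^sup>2" and b: "0 \<le> b"
    and moment: "(\<integral>x. (\<Sum>i<m. (\<phi> i x)\<^sup>2) \<partial>N) \<le> \<mu>"
    and V: "finite V" "(\<lambda>i. 0) \<in> V" and R: "0 \<le> R"
    and radius: "\<And>v. v \<in> V \<Longrightarrow> (\<Sum>i<m. (v i)\<^sup>2) \<le> R\<^sup>2"
    and L: "1 \<le> L" and \<kappa>: "0 < \<kappa>" and t: "0 < t"
  defines "bad \<equiv> {\<omega> \<in> space M.
      \<kappa> \<le> (\<Sum>i<m. \<Sum>j<m. ((\<Sum>l=1..L. \<phi> i (S l \<omega>) * \<phi> j (S l \<omega>)) / real L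
          - (\<integral>x. \<phi> i x * \<phi> j x \<partial>N))\<^sup>2)
      \<or> (\<exists>v\<in>V. t \<le> (\<Sum>l=1..L. \<bar>\<Sum>i<m. v i * \<phi> i (S l \<omega>)\<bar>) / real L
          - (\<integral>x. \<bar>\<Sum>i<m. v i * \<phi> i x\<bar> \<partial>N))}"
  shows "bad \<in> events" and "prob bad \<le> b\<^sup>2 * \<mu> / (L * \<kappa>) + 2 * R * sqrt (\<mu> / L) / t"
proof -
  interpret N: prob_space N by (rule N)
  let ?P = "Pi\<^sub>M {1..L} (\<lambda>_. N)"
  interpret P: prob_space ?P by (rule prob_space_PiM) (rule N)
  let ?S = "\<lambda>\<omega>. \<lambda>l\<in>{1..L}. S l \<omega>"
  have meas[measurable]: "\<phi> i \<in> borel_measurable N" if "i \<in> {..<m}" for i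
    using meas0 that by auto
  have bi: "\<bar>\<phi> i x\<bar> \<le> b" if "i < m" "x \<in> space N" for i x
  proof -
    have "(\<phi> i x)\<^sup>2 \<le> (\<Sum>i<m. (\<phi> i x)\<^sup>2)" using that by (intro member_le_sum) auto
    then have "(\<phi> i x)\<^sup>2 \<le> b\<^sup>2" using bound[OF that(2)] by linarith
    then show ?thesis using b abs_le_square_iff[of "\<phi> i x" b] by simp
  qed
  have rv: "S l \<in> measurable M N" if "l \<in> {1..L}" for l
    using S(1) that by (auto simp: indep_vars_def2)
  have joint: "distr M ?P ?S = ?P"
  proof -
    have "distr M ?P ?S = (\<Pi>\<^sub>M l\<in>{1..L}. distr M N (S l))"
      using S(1) L rv by (subst indep_vars_iff_distr_eq_PiM'[symmetric]) auto
    also have "\<dots> = ?P" using S(2) by (intro PiM_cong) auto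
    finally show ?thesis .
  qed
  have mS[measurable]: "?S \<in> measurable M ?P" using rv by (intro measurable_restrict) auto
  define U where "U \<omega> = (\<Sum>i<m. \<Sum>j<m. ((\<Sum>l=1..L. \<phi> i (\<omega> l) * \<phi> j (\<omega> l)) / real L
          - (\<integral>x. \<phi> i x * \<phi> j x \<partial>N))\<^sup>2)" for \<omega> :: "nat \<Rightarrow> 'b"
  define D where "D v \<omega> = (\<Sum>l=1..L. \<bar>\<Sum>i<m. v i * \<phi> i (\<omega> l)\<bar>) / real L
          - (\<integral>x. \<bar>\<Sum>i<m. v i * \<phi> i x\<bar> \<partial>N)" for v and \<omega> :: "nat \<Rightarrow> 'b"
  define W where "W \<omega> = (MAX v\<in>V. D v \<omega>)" for \<omega>
  have V': "V \<noteq> {}" using V by auto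
  have mU[measurable]: "U \<in> borel_measurable ?P" unfolding U_def by measurable
  have mD[measurable]: "D v \<in> borel_measurable ?P" for v unfolding D_def by measurable
  have mW[measurable]: "W \<in> borel_measurable ?P" unfolding W_def using V by measurable
  let ?bad = "{\<omega> \<in> space ?P. \<kappa> \<le> U \<omega> \<or> t \<le> W \<omega>}"
  have sb: "?bad \<in> sets ?P" by measurable
  have W_iff: "t \<le> W \<omega> \<longleftrightarrow> (\<exists>v\<in>V. t \<le> D v \<omega>)" for \<omega>
    unfolding W_def using V V' by (subst Max_ge_iff) auto
  have badeq: "bad = ?S -` ?bad \<inter> space M"
  proof -
    have "U (?S \<omega>) = U (\<lambda>l. S l \<omega>)" "D v (?S \<omega>) = D v (\<lambda>l. S l \<omega>)" for \<omega> v
      unfolding U_def D_def by (simp_all cong: sum.cong_simp)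
    moreover have "?S \<omega> \<in> space ?P" if "\<omega> \<in> space M" for \<omega>
      using measurable_space[OF mS that] .
    ultimately show ?thesis unfolding bad_def W_iff by (auto simp: U_def D_def)
  qed
  show "bad \<in> events" unfolding badeq using mS sb by (rule measurable_sets)
  have "prob bad = measure (distr M ?P ?S) ?bad"
    unfolding badeq by (rule measure_distr[OF mS sb, symmetric])
  also have "\<dots> = P.prob ?bad" unfolding joint ..
  also have "?bad = {\<omega> \<in> space ?P. \<kappa> \<le> U \<omega>} \<union> {\<omega> \<in> space ?P. t \<le> W \<omega>}" by auto
  also have "P.prob \<dots> \<le> P.prob {\<omega> \<in> space ?P. \<kappa> \<le> U \<omega>} + P.prob {\<omega> \<in> space ?P. t \<le> W \<omega>}"
    by (intro measure_Un_le) measurable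
  also have "P.prob {\<omega> \<in> space ?P. \<kappa> \<le> U \<omega>} \<le> (b\<^sup>2 * \<mu> / L) / \<kappa>"
  proof -
    have U0: "0 \<le> U \<omega>" for \<omega> unfolding U_def by (intro sum_nonneg) simp
    have "integrable ?P U" unfolding U_def
      by (rule N.expected_gram_error_le(2)[OF meas0 bound b L])
    then have "P.prob {\<omega> \<in> space ?P. \<kappa> \<le> U \<omega>} \<le> (\<integral>\<omega>. U \<omega> \<partial>?P) / \<kappa>"
      using \<kappa> U0 by (intro integral_Markov_inequality_measure[where A = "space ?P"]) auto
    also have "(\<integral>\<omega>. U \<omega> \<partial>?P) \<le> b\<^sup>2 * (\<integral>x. (\<Sum>i<m. (\<phi> i x)\<^sup>2) \<partial>N) / L" unfolding U_def
      by (rule N.expected_gram_error_le(1)[OF meas0 bound b L])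
    also have "\<dots> \<le> b\<^sup>2 * \<mu> / L" using moment by (intro divide_right_mono mult_left_mono) auto
    finally show ?thesis using \<kappa> by (simp add: divide_right_mono)
  qed
  also have "P.prob {\<omega> \<in> space ?P. t \<le> W \<omega>} \<le> 2 * R * sqrt (\<mu> / L) / t"
  proof -
    have "0 \<le> D (\<lambda>i. 0) \<omega>" for \<omega> unfolding D_def by simp
    then have W0: "0 \<le> W \<omega>" for \<omega> unfolding W_def using V by (subst Max_ge_iff) auto
    have LW: "L * W \<omega> = (MAX v\<in>V. (\<Sum>l=1..L. \<bar>\<Sum>i<m. v i * \<phi> i (\<omega> l)\<bar>
        - (\<integral>x. \<bar>\<Sum>i<m. v i * \<phi> i x\<bar> \<partial>N)) + (\<Sum>i<m. v i * 0))" for \<omega>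
    proof -
      have "mono (\<lambda>x. real L * x)" by (rule monoI) (simp add: mult_left_mono)
      then have "real L * W \<omega> = Max ((\<lambda>x. real L * x) ` (\<lambda>v. D v \<omega>) ` V)" unfolding W_def
        by (rule mono_Max_commute) (use V V' in auto)
      also have "(\<lambda>x. real L * x) ` (\<lambda>v. D v \<omega>) ` V = (\<lambda>v. (\<Sum>l=1..L. \<bar>\<Sum>i<m. v i * \<phi> i (\<omega> l)\<bar>
        - (\<integral>x. \<bar>\<Sum>i<m. v i * \<phi> i x\<bar> \<partial>N)) + (\<Sum>i<m. v i * 0)) ` V"
        unfolding image_image using L by (intro image_cong) (auto simp: D_def sum_subtractf right_diff_distrib)
      finally show ?thesis .
    qed
    obtain w where w: "\<And>v. v \<in> V \<Longrightarrow> (\<Sum>i<m. \<bar>v i\<bar>) \<le> w"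
    proof -
      have "\<And>v. v \<in> V \<Longrightarrow> (\<Sum>i<m. \<bar>v i\<bar>) \<le> (MAX v\<in>V. (\<Sum>i<m. \<bar>v i\<bar>))" using V by auto
      then show ?thesis using that by blast
    qed
    have iW: "integrable ?P W"
    proof (rule P.integrable_const_bound[where B = "w * b"])
      show "AE \<omega> in ?P. norm (W \<omega>) \<le> w * b"
      proof (rule AE_I2)
        fix \<omega> assume \<omega>: "\<omega> \<in> space ?P"
        have "D v \<omega> \<le> w * b" if v: "v \<in> V" for v
        proof -
          have "\<bar>\<Sum>i<m. v i * \<phi> i (\<omega> l)\<bar> \<le> w * b" if "l \<in> {1..L}" for l
          proof -
            have "\<omega> l \<in> space N" using \<omega> that by (auto simp: space_PiM)
            then have "\<bar>\<Sum>i<m. v i * \<phi> i (\<omega> l)\<bar> \<le> (\<Sum>i<m. \<bar>v i\<bar> * b)"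
              using bi by (intro order.trans[OF sum_abs sum_mono]) (auto simp: abs_mult intro!: mult_left_mono)
            also have "\<dots> \<le> w * b" using w[OF v] b
              by (simp add: sum_distrib_right[symmetric] mult_right_mono)
            finally show ?thesis .
          qed
          then have "(\<Sum>l=1..L. \<bar>\<Sum>i<m. v i * \<phi> i (\<omega> l)\<bar>) \<le> (\<Sum>l=1..L. w * b)" by (intro sum_mono)
          then have "(\<Sum>l=1..L. \<bar>\<Sum>i<m. v i * \<phi> i (\<omega> l)\<bar>) / L \<le> w * b"
            using L by (simp add: field_simps)
          moreover have "0 \<le> (\<integral>x. \<bar>\<Sum>i<m. v i * \<phi> i x\<bar> \<partial>N)" by simp
          ultimately show ?thesis unfolding D_def by linarith
        qed
        then have "W \<omega> \<le> w * b" unfolding W_def using V V' by simp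
        then show "norm (W \<omega>) \<le> w * b" using W0[of \<omega>] by simp
      qed
    qed measurable
    have "L * (\<integral>\<omega>. W \<omega> \<partial>?P) = (\<integral>\<omega>. L * W \<omega> \<partial>?P)" by simp
    also have "\<dots> \<le> R * sqrt ((\<Sum>i<m. 0\<^sup>2) + 4 * card {1..L} * (\<integral>x. (\<Sum>i<m. (\<phi> i x)\<^sup>2) \<partial>N))"
      unfolding LW using V V' R radius meas0 bi by (intro N.expected_max_deviation_le[where b = b]) auto
    also have "\<dots> \<le> R * sqrt (4 * L * \<mu>)"
      using moment R by (intro mult_left_mono) (auto intro!: mult_left_mono)
    also have "\<dots> = L * (2 * R * sqrt (\<mu> / L))"
    proof -
      have "sqrt (4 * L * \<mu>) = sqrt ((2 * real L)\<^sup>2 * (\<mu> / L))"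
        using L by (simp add: power2_eq_square)
      also have "\<dots> = 2 * L * sqrt (\<mu> / L)" unfolding real_sqrt_mult real_sqrt_abs by simp
      finally show ?thesis by simp
    qed
    finally have "(\<integral>\<omega>. W \<omega> \<partial>?P) \<le> 2 * R * sqrt (\<mu> / L)" using L by simp
    moreover have "P.prob {\<omega> \<in> space ?P. t \<le> W \<omega>} \<le> (\<integral>\<omega>. W \<omega> \<partial>?P) / t"
      using t iW W0 by (intro integral_Markov_inequality_measure[where A = "space ?P"]) auto
    ultimately show ?thesis using t by (meson divide_right_mono less_imp_le order.trans)
  qed
  finally show "prob bad \<le> b\<^sup>2 * \<mu> / (L * \<kappa>) + 2 * R * sqrt (\<mu> / L) / t" by simp
qed

section \<open>Positive definite matrices and regression\<close>

lemma bilinear_le_frobenius: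
  fixes N :: "'i \<Rightarrow> 'i \<Rightarrow> real"
  shows "\<bar>\<Sum>i\<in>I. \<Sum>j\<in>I. u i * N i j * v j\<bar>
    \<le> sqrt (\<Sum>i\<in>I. \<Sum>j\<in>I. (N i j)\<^sup>2) * (sqrt (\<Sum>i\<in>I. (u i)\<^sup>2) * sqrt (\<Sum>i\<in>I. (v i)\<^sup>2))"
proof -
  have "\<bar>\<Sum>i\<in>I. \<Sum>j\<in>I. u i * N i j * v j\<bar> = \<bar>\<Sum>p\<in>I \<times> I. N (fst p) (snd p) * (u (fst p) * v (snd p))\<bar>"
    by (simp add: sum.cartesian_product case_prod_beta mult_ac)
  also have "\<dots> \<le> sqrt (\<Sum>p\<in>I \<times> I. (N (fst p) (snd p))\<^sup>2) * sqrt (\<Sum>p\<in>I \<times> I. (u (fst p) * v (snd p))\<^sup>2)"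
    by (rule sum_mult_le_sqrt)
  also have "(\<Sum>p\<in>I \<times> I. (u (fst p) * v (snd p))\<^sup>2) = (\<Sum>i\<in>I. (u i)\<^sup>2) * (\<Sum>i\<in>I. (v i)\<^sup>2)"
    by (simp add: sum_product sum.cartesian_product case_prod_beta power_mult_distrib)
  also have "(\<Sum>p\<in>I \<times> I. (N (fst p) (snd p))\<^sup>2) = (\<Sum>i\<in>I. \<Sum>j\<in>I. (N i j)\<^sup>2)"
    by (simp add: sum.cartesian_product case_prod_beta)
  finally show ?thesis by (simp add: real_sqrt_mult)
qed

lemma positive_definite_invertible:
  fixes H :: "nat \<Rightarrow> nat \<Rightarrow> real"
  assumes pos: "\<And>v. \<exists>i<m. v i \<noteq> 0 \<Longrightarrow> 0 < (\<Sum>i<m. \<Sum>j<m. v i * H i j * v j)"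
  obtains B where "B \<in> carrier_mat m m"
    "inverts_mat (Matrix.mat m m (\<lambda>(i, j). H i j)) B" "inverts_mat B (Matrix.mat m m (\<lambda>(i, j). H i j))"
proof -
  let ?A = "Matrix.mat m m (\<lambda>(i, j). H i j)"
  have A: "?A \<in> carrier_mat m m" by simp
  have "Determinant.det ?A \<noteq> 0"
  proof
    assume "Determinant.det ?A = 0"
    then obtain v where v: "v \<in> carrier_vec m" "v \<noteq> 0\<^sub>v m" "?A *\<^sub>v v = 0\<^sub>v m"
      using det_0_iff_vec_prod_zero_field[OF A] by blast
    define w where "w i = Matrix.vec_index v i" for i
    have "\<exists>i<m. w i \<noteq> 0"
    proof (rule ccontr)
      assume "\<not> (\<exists>i<m. w i \<noteq> 0)"
      then have "v = 0\<^sub>v m" using v(1) by (intro eq_vecI) (auto simp: w_def)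
      then show False using v(2) by simp
    qed
    then have "0 < (\<Sum>i<m. \<Sum>j<m. w i * H i j * w j)" by (rule pos)
    also have "\<dots> = (\<Sum>i<m. w i * (\<Sum>j<m. H i j * w j))"
      by (simp add: sum_distrib_left mult.assoc)
    also have "\<dots> = 0"
    proof (rule sum.neutral, rule ballI)
      fix i assume i: "i \<in> {..<m}"
      have "(\<Sum>j<m. H i j * w j) = Matrix.vec_index (?A *\<^sub>v v) i"
        using i v(1) by (auto simp: scalar_prod_def w_def lessThan_atLeast0 intro!: sum.cong)
      then show "w i * (\<Sum>j<m. H i j * w j) = 0" using v(3) i by simp
    qed
    finally show False by simp
  qed
  then have "?A \<in> Units (ring_mat TYPE(real) m ())" by (rule det_non_zero_imp_unit[OF A])
  then obtain B where "B \<in> carrier_mat m m" "?A * B = 1\<^sub>m m" "B * ?A = 1\<^sub>m m"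
    by (auto simp: Units_def ring_mat_simps)
  then show ?thesis by (intro that[of B]) (auto simp: inverts_mat_def)
qed

lemma positive_definite_solvable:
  fixes H :: "nat \<Rightarrow> nat \<Rightarrow> real"
  assumes pos: "\<And>v. \<exists>i<m. v i \<noteq> 0 \<Longrightarrow> 0 < (\<Sum>i<m. \<Sum>j<m. v i * H i j * v j)"
  obtains v where "\<And>i. i < m \<Longrightarrow> (\<Sum>j<m. H i j * v j) = b i"
proof -
  let ?A = "Matrix.mat m m (\<lambda>(i, j). H i j)"
  obtain B where B: "B \<in> carrier_mat m m" "inverts_mat ?A B"
    using positive_definite_invertible[OF pos] by blast
  let ?v = "B *\<^sub>v Matrix.vec m b"
  have v: "?v \<in> carrier_vec m" using B by simp
  have "?A *\<^sub>v ?v = (?A * B) *\<^sub>v Matrix.vec m b"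
    using B(1) by (intro assoc_mult_mat_vec[symmetric]) auto
  also have "\<dots> = Matrix.vec m b" using B by (simp add: inverts_mat_def)
  finally have eq: "?A *\<^sub>v ?v = Matrix.vec m b" .
  have "(\<Sum>j<m. H i j * Matrix.vec_index ?v j) = b i" if i: "i < m" for i
  proof -
    have "(\<Sum>j<m. H i j * Matrix.vec_index ?v j) = Matrix.vec_index (?A *\<^sub>v ?v) i"
      using i v B by (auto simp: scalar_prod_def lessThan_atLeast0 intro!: sum.cong)
    then show ?thesis using eq i by simp
  qed
  then show ?thesis by (rule that)
qed

lemma positive_definite_perturbation:
  fixes H H' :: "nat \<Rightarrow> nat \<Rightarrow> real"
  assumes coercive: "\<And>v. \<epsilon> * (\<Sum>i<m. (v i)\<^sup>2) \<le> (\<Sum>i<m. \<Sum>j<m. v i * H i j * v j)"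
    and close: "(\<Sum>i<m. \<Sum>j<m. (H' i j - H i j)\<^sup>2) \<le> \<kappa>\<^sup>2" and \<kappa>: "0 \<le> \<kappa>"
  shows "(\<epsilon> - \<kappa>) * (\<Sum>i<m. (v i)\<^sup>2) \<le> (\<Sum>i<m. \<Sum>j<m. v i * H' i j * v j)"
proof -
  have "\<bar>\<Sum>i<m. \<Sum>j<m. v i * (H' i j - H i j) * v j\<bar>
      \<le> sqrt (\<Sum>i<m. \<Sum>j<m. (H' i j - H i j)\<^sup>2) * (sqrt (\<Sum>i<m. (v i)\<^sup>2) * sqrt (\<Sum>i<m. (v i)\<^sup>2))"
    by (rule bilinear_le_frobenius)
  also have "\<dots> \<le> \<kappa> * (\<Sum>i<m. (v i)\<^sup>2)"
    using real_le_lsqrt[OF \<kappa> close] by (simp add: sum_nonneg mult_right_mono)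
  finally have "- (\<kappa> * (\<Sum>i<m. (v i)\<^sup>2)) \<le> (\<Sum>i<m. \<Sum>j<m. v i * (H' i j - H i j) * v j)"
    by linarith
  moreover have "(\<Sum>i<m. \<Sum>j<m. v i * (H' i j - H i j) * v j)
      = (\<Sum>i<m. \<Sum>j<m. v i * H' i j * v j) - (\<Sum>i<m. \<Sum>j<m. v i * H i j * v j)"
    by (simp add: algebra_simps sum_subtractf)
  ultimately show ?thesis using coercive[of v] by (simp add: algebra_simps)
qed

text \<open>
  The value \<open>p \<bullet> \<beta>\<close> of a regression with targets \<open>d\<close> is tested against \<open>v\<close>, the solution of
  \<open>H v = p\<close> for the population Gram matrix \<open>H\<close>: \<open>p \<bullet> \<beta> = v \<bullet> H' \<beta> - v \<bullet> (H' - H) \<beta>\<close>.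
  The first term is a sample mean of \<open>d (v \<bullet> y)\<close> by the normal equations, hence at most
  \<open>\<delta>\<close> times the empirical Lebesgue function; the second is a perturbation.  Working with the
  inverse of \<open>H\<close> instead of that of \<open>H'\<close> keeps \<open>v\<close> independent of the sample.
\<close>

lemma regression_operator_bound:
  fixes H :: "nat \<Rightarrow> nat \<Rightarrow> real" and y :: "nat \<Rightarrow> nat \<Rightarrow> real" and L :: nat
  defines "H' \<equiv> \<lambda>i j. (\<Sum>l=1..L. y l i * y l j) / real L"
  assumes L: "1 \<le> L" and \<epsilon>: "0 < \<epsilon>"
    and sym: "\<And>i j. H i j = H j i"
    and coercive: "\<And>v. \<epsilon> * (\<Sum>i<m. (v i)\<^sup>2) \<le> (\<Sum>i<m. \<Sum>j<m. v i * H i j * v j)"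
    and close: "(\<Sum>i<m. \<Sum>j<m. (H' i j - H i j)\<^sup>2) \<le> \<kappa>\<^sup>2" and \<kappa>: "0 \<le> \<kappa>" "\<kappa> \<le> \<epsilon> / 2"
    and \<beta>: "\<And>i. i < m \<Longrightarrow> (\<Sum>j<m. H' i j * \<beta> j) = (\<Sum>l=1..L. d l * y l i) / real L"
    and d: "\<And>l. l \<in> {1..L} \<Longrightarrow> \<bar>d l\<bar> \<le> \<delta>" and \<delta>: "0 \<le> \<delta>"
    and v: "\<And>i. i < m \<Longrightarrow> (\<Sum>j<m. H i j * v j) = p i"
  shows "\<bar>\<Sum>i<m. p i * \<beta> i\<bar>
    \<le> ((\<Sum>l=1..L. \<bar>\<Sum>i<m. v i * y l i\<bar>) / real L + \<kappa> * sqrt (\<Sum>i<m. (v i)\<^sup>2) * sqrt (2 / \<epsilon>)) * \<delta>"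
proof -
  define z where "z l = (\<Sum>i<m. \<beta> i * y l i)" for l
  define s where "s = (\<Sum>l=1..L. (z l)\<^sup>2) / L"
  have s0: "0 \<le> s" unfolding s_def by (simp add: sum_nonneg)
  have test: "(\<Sum>i<m. \<Sum>j<m. w i * H' i j * \<beta> j) = (\<Sum>l=1..L. d l * (\<Sum>i<m. w i * y l i)) / L" for w
  proof -
    have "(\<Sum>i<m. \<Sum>j<m. w i * H' i j * \<beta> j) = (\<Sum>i<m. w i * ((\<Sum>l=1..L. d l * y l i) / real L))"
      using \<beta> by (intro sum.cong refl) (simp add: sum_distrib_left[symmetric] mult.assoc)
    also have "\<dots> = (\<Sum>i<m. \<Sum>l=1..L. d l * (w i * y l i)) / L"
      by (simp add: sum_distrib_left sum_divide_distrib mult_ac)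
    also have "\<dots> = (\<Sum>l=1..L. d l * (\<Sum>i<m. w i * y l i)) / L"
      by (subst sum.swap) (simp add: sum_distrib_left)
    finally show ?thesis .
  qed
  have quad: "(\<Sum>i<m. \<Sum>j<m. \<beta> i * H' i j * \<beta> j) = s"
  proof -
    have "s = (\<Sum>l=1..L. \<Sum>i<m. \<Sum>j<m. \<beta> i * y l i * (\<beta> j * y l j)) / L"
      unfolding s_def z_def power2_eq_square sum_product ..
    also have "\<dots> = (\<Sum>i<m. \<Sum>j<m. \<Sum>l=1..L. \<beta> i * y l i * (\<beta> j * y l j)) / L"
      by (subst sum.swap, subst (2) sum.swap) simp
    also have "\<dots> = (\<Sum>i<m. \<Sum>j<m. \<beta> i * H' i j * \<beta> j)"
      unfolding H'_def
      by (simp add: sum_divide_distrib sum_distrib_left sum_distrib_right mult_ac)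
    finally show ?thesis by simp
  qed
  \<comment> \<open>Energy estimate: pairing the normal equations with \<open>\<beta>\<close> itself bounds the empirical norm.\<close>
  have "s = (\<Sum>l=1..L. d l * z l) / L" using test[of \<beta>] quad by (simp add: z_def)
  also have "\<dots> \<le> (\<Sum>l=1..L. \<delta> * \<bar>z l\<bar>) / L"
  proof (intro divide_right_mono sum_mono)
    fix l assume "l \<in> {1..L}"
    then have "\<bar>d l * z l\<bar> \<le> \<delta> * \<bar>z l\<bar>" using d by (simp add: abs_mult mult_right_mono)
    then show "d l * z l \<le> \<delta> * \<bar>z l\<bar>" by linarith
  qed simp
  also have "\<dots> = \<delta> * ((\<Sum>l=1..L. \<bar>z l\<bar>) / L)" by (simp add: sum_distrib_left)
  also have "(\<Sum>l=1..L. \<bar>z l\<bar>) / L \<le> sqrt s"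
  proof (rule real_le_rsqrt)
    have "(\<Sum>l=1..L. \<bar>z l\<bar> * 1)\<^sup>2 \<le> (\<Sum>l=1..L. \<bar>z l\<bar>\<^sup>2) * (\<Sum>l=1..L. 1\<^sup>2)"
      by (rule Cauchy_Schwarz_ineq_sum)
    then have "(\<Sum>l=1..L. \<bar>z l\<bar>)\<^sup>2 \<le> (\<Sum>l=1..L. (z l)\<^sup>2) * L" by simp
    then show "((\<Sum>l=1..L. \<bar>z l\<bar>) / L)\<^sup>2 \<le> s"
      using L unfolding s_def by (simp add: power2_eq_square field_simps)
  qed
  finally have "s \<le> \<delta> * sqrt s" using \<delta> by (simp add: mult_left_mono)
  then have "sqrt s * sqrt s \<le> \<delta> * sqrt s" using s0 by simp
  then have "sqrt s \<le> \<delta>"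
    using s0 \<delta> mult_right_le_imp_le[of "sqrt s" "sqrt s" \<delta>] by (cases "s = 0") simp_all
  then have s1: "s \<le> \<delta>\<^sup>2" using s0 real_sqrt_le_iff by (metis real_sqrt_abs abs_of_nonneg \<delta>)
  have "(\<epsilon> / 2) * (\<Sum>i<m. (\<beta> i)\<^sup>2) \<le> (\<epsilon> - \<kappa>) * (\<Sum>i<m. (\<beta> i)\<^sup>2)"
    using \<kappa> by (intro mult_right_mono) (auto simp: sum_nonneg)
  also have "\<dots> \<le> s"
    using positive_definite_perturbation[OF coercive close \<kappa>(1), of \<beta>] quad by simp
  also note s1
  finally have "(\<Sum>i<m. (\<beta> i)\<^sup>2) \<le> 2 / \<epsilon> * \<delta>\<^sup>2" using \<epsilon> by (simp add: field_simps)
  then have "sqrt (\<Sum>i<m. (\<beta> i)\<^sup>2) \<le> sqrt (2 / \<epsilon> * \<delta>\<^sup>2)" by (rule real_sqrt_le_mono)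
  then have \<beta>n: "sqrt (\<Sum>i<m. (\<beta> i)\<^sup>2) \<le> sqrt (2 / \<epsilon>) * \<delta>" 
    using \<delta> unfolding real_sqrt_mult real_sqrt_abs by simp
  have "(\<Sum>i<m. p i * \<beta> i) = (\<Sum>i<m. \<Sum>j<m. v j * H j i * \<beta> i)"
  proof (rule sum.cong[OF refl])
    fix i assume i: "i \<in> {..<m}"
    show "p i * \<beta> i = (\<Sum>j<m. v j * H j i * \<beta> i)"
      using v[of i, symmetric] i by (simp add: sum_distrib_left sym[of i] mult.commute)
  qed
  also have "\<dots> = (\<Sum>i<m. \<Sum>j<m. v i * H i j * \<beta> j)" by (rule sum.swap)
  also have "\<dots> = (\<Sum>i<m. \<Sum>j<m. v i * H' i j * \<beta> j) - (\<Sum>i<m. \<Sum>j<m. v i * (H' i j - H i j) * \<beta> j)"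
    by (simp add: algebra_simps sum_subtractf)
  finally have "\<bar>\<Sum>i<m. p i * \<beta> i\<bar> \<le> \<bar>(\<Sum>l=1..L. d l * (\<Sum>i<m. v i * y l i)) / L\<bar>
      + \<bar>\<Sum>i<m. \<Sum>j<m. v i * (H' i j - H i j) * \<beta> j\<bar>" unfolding test by linarith
  also have "\<bar>(\<Sum>l=1..L. d l * (\<Sum>i<m. v i * y l i)) / L\<bar> \<le> (\<Sum>l=1..L. \<bar>\<Sum>i<m. v i * y l i\<bar>) / L * \<delta>"
  proof -
    have "\<bar>\<Sum>l=1..L. d l * (\<Sum>i<m. v i * y l i)\<bar> \<le> (\<Sum>l=1..L. \<bar>\<Sum>i<m. v i * y l i\<bar> * \<delta>)"
    proof (rule order.trans[OF sum_abs sum_mono])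
      fix l assume "l \<in> {1..L}"
      then show "\<bar>d l * (\<Sum>i<m. v i * y l i)\<bar> \<le> \<bar>\<Sum>i<m. v i * y l i\<bar> * \<delta>"
        unfolding abs_mult mult.commute[of "\<bar>d l\<bar>"] using d by (intro mult_left_mono) auto
    qed
    then show ?thesis by (simp add: sum_distrib_right[symmetric] divide_right_mono)
  qed
  also have "\<bar>\<Sum>i<m. \<Sum>j<m. v i * (H' i j - H i j) * \<beta> j\<bar>
      \<le> \<kappa> * (sqrt (\<Sum>i<m. (v i)\<^sup>2) * (sqrt (2 / \<epsilon>) * \<delta>))"
    by (rule order.trans[OF bilinear_le_frobenius])
      (intro mult_mono real_le_lsqrt \<kappa> close \<beta>n order.refl; simp add: sum_nonneg \<kappa>)
  finally show ?thesis by (simp add: algebra_simps)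
qed

section \<open>Lebesgue constants of the basis\<close>

definition basis_sum :: "(nat \<Rightarrow> 'x \<Rightarrow> real) \<Rightarrow> nat \<Rightarrow> (nat \<Rightarrow> real) \<Rightarrow> 'x \<Rightarrow> real" where
  "basis_sum \<psi> m v x = (\<Sum>i<m. v i * \<psi> (Suc i) x)"

lemma basis_comb_eq_basis_sum:
  "\<beta> \<in> carrier_vec m \<Longrightarrow> basis_comb \<psi> m \<beta> x = basis_sum \<psi> m (Matrix.vec_index \<beta>) x"
  by (auto simp: basis_comb_def basis_vec_def basis_sum_def scalar_prod_def lessThan_atLeast0
      mult.commute intro!: sum.cong)

lemma sup_norm_ge:
  assumes "bdd_above ((\<lambda>x. \<bar>g x\<bar>) ` X)" "x \<in> X"
  shows "\<bar>g x\<bar> \<le> sup_norm X g"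
  unfolding sup_norm_def by (rule cSUP_upper[OF assms(2,1)])

lemma sup_norm_le:
  assumes "X \<noteq> {}" "\<And>x. x \<in> X \<Longrightarrow> \<bar>g x\<bar> \<le> B"
  shows "sup_norm X g \<le> B"
  unfolding sup_norm_def by (rule cSUP_least[OF assms])

lemma bdd_above_abs_of_bounded:
  fixes h :: "'x \<Rightarrow> real"
  assumes "bounded (h ` X)"
  shows "bdd_above ((\<lambda>x. \<bar>h x\<bar>) ` X)"
  using assms by (auto simp: bounded_iff bdd_above_def)

text \<open>The set whose supremum is the Lebesgue constant of a single sampler.\<close>

definition projection_ratios ::
    "(nat \<Rightarrow> (real ^ 'n) \<Rightarrow> real) \<Rightarrow> (real ^ 'n) set \<Rightarrow> nat \<Rightarrow> (real ^ 'n) measure \<Rightarrow> real set" where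
  "projection_ratios \<psi> X m N = {sup_norm X (basis_comb \<psi> m \<beta>) / sup_norm X h | h \<beta>.
     h \<in> borel_measurable borel \<and> bounded (h ` X) \<and> 0 < sup_norm X h \<and>
     least_squares_coeff \<psi> m N h \<beta>}"

text \<open>
  One sampler \<open>N\<close> together with the basis functions that are used for regression.  The constant \<open>c\<close>
  bounds the length of the basis vector on the state space, and \<open>\<epsilon>\<close> bounds the least eigenvalue of
  the population Gram matrix from below.
\<close>

locale regression_basis = prob_space N for N :: "(real ^ 'n) measure" +
  fixes X :: "(real ^ 'n) set" and \<psi> :: "nat \<Rightarrow> real ^ 'n \<Rightarrow> real" and m :: nat and c \<epsilon> :: real
  assumes sets_N: "sets N = sets borel"
    and X_borel: "X \<in> sets borel" and X_ne: "X \<noteq> {}"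
    and AE_X: "AE x in N. x \<in> X"
    and psi_meas: "\<And>i. i < m \<Longrightarrow> \<psi> (Suc i) \<in> borel_measurable borel"
    and psi_bound: "\<And>x. x \<in> X \<Longrightarrow> (\<Sum>i<m. (\<psi> (Suc i) x)\<^sup>2) \<le> c\<^sup>2"
    and c_nonneg: "0 \<le> c" and eps_pos: "0 < \<epsilon>"
    and coercive: "\<And>v. \<epsilon> * (\<Sum>i<m. (v i)\<^sup>2) \<le> (\<integral>x. (basis_sum \<psi> m v x)\<^sup>2 \<partial>N)"
begin

definition gram :: "nat \<Rightarrow> nat \<Rightarrow> real" where
  "gram i j = (\<integral>x. \<psi> (Suc i) x * \<psi> (Suc j) x \<partial>N)"

lemma borel_measurable_N: "f \<in> borel_measurable borel \<Longrightarrow> f \<in> borel_measurable N"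
  using measurable_cong_sets[OF sets_N refl] by auto

lemma integrable_bounded_on_X:
  fixes f :: "real ^ 'n \<Rightarrow> real"
  assumes "f \<in> borel_measurable borel" "\<And>x. x \<in> X \<Longrightarrow> \<bar>f x\<bar> \<le> B"
  shows "integrable N f"
  by (rule integrable_const_bound[where B = B])
    (use assms AE_X borel_measurable_N in \<open>auto elim: eventually_mono\<close>)

lemma basis_sum_bound:
  assumes "x \<in> X"
  shows "\<bar>basis_sum \<psi> m v x\<bar> \<le> sqrt (\<Sum>i<m. (v i)\<^sup>2) * c"
proof -
  have "\<bar>basis_sum \<psi> m v x\<bar> \<le> sqrt (\<Sum>i<m. (v i)\<^sup>2) * sqrt (\<Sum>i<m. (\<psi> (Suc i) x)\<^sup>2)"
    unfolding basis_sum_def by (rule sum_mult_le_sqrt)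
  also have "\<dots> \<le> sqrt (\<Sum>i<m. (v i)\<^sup>2) * c"
    using real_le_lsqrt[OF c_nonneg psi_bound[OF assms]]
    by (intro mult_left_mono) (auto simp: sum_nonneg)
  finally show ?thesis .
qed

lemma psi_bound_single:
  assumes "i < m" "x \<in> X"
  shows "\<bar>\<psi> (Suc i) x\<bar> \<le> c"
proof -
  have "(\<psi> (Suc i) x)\<^sup>2 \<le> (\<Sum>i<m. (\<psi> (Suc i) x)\<^sup>2)" using assms by (intro member_le_sum) auto
  then have "(\<psi> (Suc i) x)\<^sup>2 \<le> c\<^sup>2" using psi_bound[OF assms(2)] by linarith
  then show ?thesis using c_nonneg by (simp add: power2_le_iff_abs_le)
qed

lemma basis_sum_meas[measurable]: "basis_sum \<psi> m v \<in> borel_measurable borel"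
  unfolding basis_sum_def using psi_meas by (auto intro!: borel_measurable_sum borel_measurable_times)

lemma integrable_psi_times:
  assumes "i < m" and [measurable]: "h \<in> borel_measurable borel" and B: "\<And>x. x \<in> X \<Longrightarrow> \<bar>h x\<bar> \<le> B"
  shows "integrable N (\<lambda>x. h x * \<psi> (Suc i) x)"
proof (rule integrable_bounded_on_X[where B = "B * c"])
  show "(\<lambda>x. h x * \<psi> (Suc i) x) \<in> borel_measurable borel"
    using psi_meas[OF assms(1)] by measurable
  fix x assume "x \<in> X"
  then show "\<bar>h x * \<psi> (Suc i) x\<bar> \<le> B * c"
    unfolding abs_mult using B[of x] psi_bound_single[OF assms(1), of x]
    by (intro mult_mono) auto
qed

lemma integral_times_basis_sum:
  assumes h: "h \<in> borel_measurable borel" "\<And>x. x \<in> X \<Longrightarrow> \<bar>h x\<bar> \<le> B"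
  shows "(\<integral>x. h x * basis_sum \<psi> m v x \<partial>N) = (\<Sum>i<m. v i * (\<integral>x. h x * \<psi> (Suc i) x \<partial>N))"
proof -
  have "(\<integral>x. h x * basis_sum \<psi> m v x \<partial>N) = (\<integral>x. (\<Sum>i<m. v i * (h x * \<psi> (Suc i) x)) \<partial>N)"
    unfolding basis_sum_def by (simp add: sum_distrib_left mult_ac)
  also have "\<dots> = (\<Sum>i<m. v i * (\<integral>x. h x * \<psi> (Suc i) x \<partial>N))"
    using integrable_psi_times[OF _ h] by (subst Bochner_Integration.integral_sum) auto
  finally show ?thesis .
qed

lemma gram_times:
  assumes "i < m"
  shows "(\<Sum>j<m. gram i j * v j) = (\<integral>x. basis_sum \<psi> m v x * \<psi> (Suc i) x \<partial>N)"
proof -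
  have "(\<integral>x. \<psi> (Suc i) x * basis_sum \<psi> m v x \<partial>N) = (\<Sum>j<m. v j * gram i j)"
    unfolding gram_def
    by (rule integral_times_basis_sum[OF psi_meas[OF assms] psi_bound_single[OF assms]])
  then show ?thesis by (simp add: mult.commute)
qed

lemma gram_quadratic:
  "(\<Sum>i<m. \<Sum>j<m. v i * gram i j * v j) = (\<integral>x. (basis_sum \<psi> m v x)\<^sup>2 \<partial>N)"
proof -
  have "(\<Sum>i<m. \<Sum>j<m. v i * gram i j * v j) = (\<Sum>i<m. v i * (\<integral>x. basis_sum \<psi> m v x * \<psi> (Suc i) x \<partial>N))"
    by (intro sum.cong refl) (simp add: gram_times[symmetric] sum_distrib_left mult.assoc)
  also have "\<dots> = (\<integral>x. (basis_sum \<psi> m v x)\<^sup>2 \<partial>N)"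
    unfolding power2_eq_square
    by (rule integral_times_basis_sum[OF basis_sum_meas basis_sum_bound, symmetric])
  finally show ?thesis .
qed

lemma gram_sym: "gram i j = gram j i"
  unfolding gram_def by (simp add: mult.commute)

lemma gram_coercive: "\<epsilon> * (\<Sum>i<m. (v i)\<^sup>2) \<le> (\<Sum>i<m. \<Sum>j<m. v i * gram i j * v j)"
  using coercive[of v] gram_quadratic[of v] by simp

lemma gram_solvable:
  obtains v where "\<And>i. i < m \<Longrightarrow> (\<Sum>j<m. gram i j * v j) = b i"
proof (rule positive_definite_solvable)
  fix v :: "nat \<Rightarrow> real" assume "\<exists>i<m. v i \<noteq> 0"
  then obtain i where i: "i < m" "v i \<noteq> 0" by blast
  have "0 < (v i)\<^sup>2" using i by simp
  also have "\<dots> \<le> (\<Sum>i<m. (v i)\<^sup>2)" using i by (intro member_le_sum) auto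
  finally have "0 < \<epsilon> * (\<Sum>i<m. (v i)\<^sup>2)" using eps_pos by simp
  then show "0 < (\<Sum>i<m. \<Sum>j<m. v i * gram i j * v j)" using gram_coercive[of v] by linarith
qed (rule that)

text \<open>
  \<open>v\<close> represents evaluation at \<open>x\<close> on the span of the basis.  Its length is bounded by testing the
  defining equation with \<open>v\<close> itself and using coercivity.
\<close>

lemma representer_bound:
  assumes x: "x \<in> X" and v: "\<And>i. i < m \<Longrightarrow> (\<Sum>j<m. gram i j * v j) = \<psi> (Suc i) x"
  shows "sqrt (\<Sum>i<m. (v i)\<^sup>2) \<le> c / \<epsilon>"
proof -
  let ?n = "sqrt (\<Sum>i<m. (v i)\<^sup>2)"
  have n0: "0 \<le> ?n" by (simp add: sum_nonneg)
  have "\<epsilon> * (?n * ?n) = \<epsilon> * (\<Sum>i<m. (v i)\<^sup>2)" by (simp add: sum_nonneg)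
  also have "\<dots> \<le> (\<Sum>i<m. \<Sum>j<m. v i * gram i j * v j)" by (rule gram_coercive)
  also have "\<dots> = (\<Sum>i<m. v i * \<psi> (Suc i) x)"
    by (intro sum.cong refl) (simp add: v[symmetric] sum_distrib_left mult.assoc)
  also have "\<dots> \<le> ?n * c" using basis_sum_bound[OF x, of v] unfolding basis_sum_def by linarith
  finally have *: "(\<epsilon> * ?n) * ?n \<le> c * ?n" by (simp add: mult_ac)
  show ?thesis
  proof (cases "?n = 0")
    case True
    then show ?thesis using c_nonneg eps_pos by simp
  next
    case False
    then have "\<epsilon> * ?n \<le> c" using n0 * mult_right_le_imp_le by (metis less_eq_real_def)
    then show ?thesis using eps_pos by (simp add: field_simps)
  qed
qed

lemma least_squares_of_normal_equations:
  assumes [measurable]: "h \<in> borel_measurable borel" and B: "\<And>x. x \<in> X \<Longrightarrow> \<bar>h x\<bar> \<le> B"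
    and \<beta>: "\<beta> \<in> carrier_vec m"
    and normal: "\<And>i. i < m \<Longrightarrow> (\<Sum>j<m. gram i j * Matrix.vec_index \<beta> j) = (\<integral>x. h x * \<psi> (Suc i) x \<partial>N)"
  shows "least_squares_coeff \<psi> m N h \<beta>"
  unfolding least_squares_coeff_def is_arg_min_def
proof (intro conjI notI \<beta>)
  assume "\<exists>\<alpha>. \<alpha> \<in> carrier_vec m \<and> (\<integral>x. (h x - basis_comb \<psi> m \<alpha> x)\<^sup>2 \<partial>N)
      < (\<integral>x. (h x - basis_comb \<psi> m \<beta> x)\<^sup>2 \<partial>N)"
  then obtain \<alpha> where \<alpha>: "\<alpha> \<in> carrier_vec m"
    and less: "(\<integral>x. (h x - basis_comb \<psi> m \<alpha> x)\<^sup>2 \<partial>N) < (\<integral>x. (h x - basis_comb \<psi> m \<beta> x)\<^sup>2 \<partial>N)"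
    by blast
  let ?b = "basis_sum \<psi> m (Matrix.vec_index \<beta>)" and ?a = "basis_sum \<psi> m (Matrix.vec_index \<alpha>)"
  let ?w = "\<lambda>i. Matrix.vec_index \<beta> i - Matrix.vec_index \<alpha> i"
  let ?d = "basis_sum \<psi> m ?w"
  let ?nb = "sqrt (\<Sum>i<m. (Matrix.vec_index \<beta> i)\<^sup>2) * c" and ?nd = "sqrt (\<Sum>i<m. (?w i)\<^sup>2) * c"
  have hb: "\<bar>h x - ?b x\<bar> \<le> B + ?nb" if "x \<in> X" for x
    using B[OF that] basis_sum_bound[OF that, of "Matrix.vec_index \<beta>"] by linarith
  have mb: "(\<lambda>x. h x - ?b x) \<in> borel_measurable borel" by measurable
  have sq: "\<bar>u * w\<bar> \<le> p * q" if "\<bar>u\<bar> \<le> p" "\<bar>w\<bar> \<le> q" for u w p q :: real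
    unfolding abs_mult using that by (intro mult_mono) auto
  have i1: "integrable N (\<lambda>x. (h x - ?b x) * (h x - ?b x))"
    by (rule integrable_bounded_on_X[where B = "(B + ?nb) * (B + ?nb)"], measurable, (rule sq; rule hb))
  have i2: "integrable N (\<lambda>x. ?d x * ?d x)"
    by (rule integrable_bounded_on_X[where B = "?nd * ?nd"], measurable, (rule sq; rule basis_sum_bound))
  have i3: "integrable N (\<lambda>x. (h x - ?b x) * ?d x)"
    by (rule integrable_bounded_on_X[where B = "(B + ?nb) * ?nd"], measurable, rule sq, rule hb,
        assumption, rule basis_sum_bound)
  have "(\<integral>x. (h x - ?b x) * ?d x \<partial>N) = (\<Sum>i<m. ?w i * (\<integral>x. (h x - ?b x) * \<psi> (Suc i) x \<partial>N))"
    by (rule integral_times_basis_sum[OF mb hb])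
  also have "\<dots> = 0"
  proof (rule sum.neutral, rule ballI)
    fix i assume "i \<in> {..<m}"
    then have i: "i < m" by simp
    have "(\<integral>x. (h x - ?b x) * \<psi> (Suc i) x \<partial>N)
        = (\<integral>x. h x * \<psi> (Suc i) x \<partial>N) - (\<integral>x. ?b x * \<psi> (Suc i) x \<partial>N)"
      using integrable_psi_times[OF i assms(1) B] integrable_psi_times[OF i basis_sum_meas basis_sum_bound]
      by (simp add: left_diff_distrib)
    also have "\<dots> = 0" using normal[OF i] gram_times[OF i] by simp
    finally show "?w i * (\<integral>x. (h x - ?b x) * \<psi> (Suc i) x \<partial>N) = 0" by simp
  qed
  finally have cross: "(\<integral>x. (h x - ?b x) * ?d x \<partial>N) = 0" .
  have "?a x = ?b x - ?d x" for x
    by (simp add: basis_sum_def left_diff_distrib sum_subtractf)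
  then have "(h x - ?a x)\<^sup>2 = (h x - ?b x) * (h x - ?b x) + ?d x * ?d x + 2 * ((h x - ?b x) * ?d x)" for x
    by (simp only: power2_eq_square) (simp add: algebra_simps)
  then have "(\<integral>x. (h x - ?a x)\<^sup>2 \<partial>N)
      = (\<integral>x. (h x - ?b x) * (h x - ?b x) + ?d x * ?d x + 2 * ((h x - ?b x) * ?d x) \<partial>N)"
    by simp
  also have "\<dots> = (\<integral>x. (h x - ?b x)\<^sup>2 \<partial>N) + (\<integral>x. ?d x * ?d x \<partial>N)"
    using i1 i2 i3 cross by (simp add: power2_eq_square)
  also have "\<dots> \<ge> (\<integral>x. (h x - ?b x)\<^sup>2 \<partial>N)" by simp
  finally show False using less unfolding basis_comb_eq_basis_sum[OF \<alpha>] basis_comb_eq_basis_sum[OF \<beta>]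
    by simp
qed

text \<open>
  Finiteness of the Lebesgue constant has to be checked before its supremum can be used.  A least
  squares fit is not worse than the zero function, which bounds its second moment by that of \<open>h\<close>;
  coercivity turns this into a bound for the coefficients.
\<close>

lemma projection_ratios_bdd: "bdd_above (projection_ratios \<psi> X m N)"
proof (rule bdd_aboveI)
  fix \<rho> assume "\<rho> \<in> projection_ratios \<psi> X m N"
  then obtain h \<beta> where \<rho>: "\<rho> = sup_norm X (basis_comb \<psi> m \<beta>) / sup_norm X h"
    and h[measurable]: "h \<in> borel_measurable borel" and bh: "bounded (h ` X)" and s: "0 < sup_norm X h"
    and ls: "least_squares_coeff \<psi> m N h \<beta>"
    unfolding projection_ratios_def by blast
  let ?s = "sup_norm X h"
  have hs: "\<bar>h x\<bar> \<le> ?s" if "x \<in> X" for x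
    by (rule sup_norm_ge[OF bdd_above_abs_of_bounded[OF bh] that])
  have \<beta>: "\<beta> \<in> carrier_vec m" using ls by (simp add: least_squares_coeff_def is_arg_min_def)
  let ?b = "basis_sum \<psi> m (Matrix.vec_index \<beta>)" and ?n = "sqrt (\<Sum>i<m. (Matrix.vec_index \<beta> i)\<^sup>2)"
  have sq: "\<bar>u\<^sup>2\<bar> \<le> p\<^sup>2" if "\<bar>u\<bar> \<le> p" for u p :: real
    using that by (simp add: abs_le_square_iff[symmetric])
  have bb: "\<bar>?b x\<bar> \<le> ?n * c" if "x \<in> X" for x by (rule basis_sum_bound[OF that])
  have hb: "\<bar>h x - ?b x\<bar> \<le> ?s + ?n * c" if "x \<in> X" for x using hs[OF that] bb[OF that] by linarith
  have i1: "integrable N (\<lambda>x. (h x)\<^sup>2)"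
    by (rule integrable_bounded_on_X[where B = "?s\<^sup>2"]) (use hs sq in auto)
  have i2: "integrable N (\<lambda>x. (h x - ?b x)\<^sup>2)"
    by (rule integrable_bounded_on_X[where B = "(?s + ?n * c)\<^sup>2"]) (use hb sq in auto)
  have i3: "integrable N (\<lambda>x. (?b x)\<^sup>2)"
    by (rule integrable_bounded_on_X[where B = "(?n * c)\<^sup>2"]) (use bb sq in auto)
  have h2: "(\<integral>x. (h x)\<^sup>2 \<partial>N) \<le> ?s\<^sup>2"
  proof -
    have "(\<integral>x. (h x)\<^sup>2 \<partial>N) \<le> (\<integral>x. ?s\<^sup>2 \<partial>N)"
    proof (rule integral_mono_AE[OF i1])
      show "AE x in N. (h x)\<^sup>2 \<le> ?s\<^sup>2"
        using AE_X by eventually_elim (use sq[OF hs] in simp)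
    qed simp
    then show ?thesis by (simp add: prob_space)
  qed
  have "(\<integral>x. (h x - ?b x)\<^sup>2 \<partial>N) \<le> (\<integral>x. (h x - basis_comb \<psi> m (0\<^sub>v m) x)\<^sup>2 \<partial>N)"
    using ls unfolding least_squares_coeff_def is_arg_min_def basis_comb_eq_basis_sum[OF \<beta>, symmetric]
    by (auto simp: not_less)
  also have "\<dots> = (\<integral>x. (h x)\<^sup>2 \<partial>N)"
    by (simp add: basis_comb_eq_basis_sum basis_sum_def)
  finally have res: "(\<integral>x. (h x - ?b x)\<^sup>2 \<partial>N) \<le> ?s\<^sup>2" using h2 by linarith
  have "\<epsilon> * (\<Sum>i<m. (Matrix.vec_index \<beta> i)\<^sup>2) \<le> (\<integral>x. (?b x)\<^sup>2 \<partial>N)" by (rule coercive)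
  also have "\<dots> \<le> (\<integral>x. 2 * (h x - ?b x)\<^sup>2 + 2 * (h x)\<^sup>2 \<partial>N)"
  proof (rule integral_mono[OF i3])
    show "(?b x)\<^sup>2 \<le> 2 * (h x - ?b x)\<^sup>2 + 2 * (h x)\<^sup>2" for x
    proof -
      have "0 \<le> (2 * h x - ?b x)\<^sup>2" by simp
      then show ?thesis by (simp add: power2_eq_square algebra_simps)
    qed
  qed (use i1 i2 in simp)
  also have "\<dots> \<le> 4 * ?s\<^sup>2" using i1 i2 res h2 by simp
  finally have "(\<Sum>i<m. (Matrix.vec_index \<beta> i)\<^sup>2) \<le> (2 * ?s)\<^sup>2 / \<epsilon>"
    using eps_pos by (simp add: field_simps)
  then have "?n \<le> sqrt ((2 * ?s)\<^sup>2 / \<epsilon>)" by (rule real_sqrt_le_mono)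
  also have "\<dots> = 2 * ?s / sqrt \<epsilon>" unfolding real_sqrt_divide real_sqrt_abs using s by simp
  finally have n: "?n \<le> 2 * ?s / sqrt \<epsilon>" .
  have "sup_norm X (basis_comb \<psi> m \<beta>) \<le> 2 * ?s / sqrt \<epsilon> * c"
    unfolding basis_comb_eq_basis_sum[OF \<beta>, abs_def]
  proof (rule sup_norm_le[OF X_ne])
    fix x assume "x \<in> X"
    then have "\<bar>?b x\<bar> \<le> ?n * c" by (rule bb)
    also have "\<dots> \<le> 2 * ?s / sqrt \<epsilon> * c" using n c_nonneg by (rule mult_right_mono)
    finally show "\<bar>?b x\<bar> \<le> 2 * ?s / sqrt \<epsilon> * c" .
  qed
  then show "\<rho> \<le> 2 / sqrt \<epsilon> * c" unfolding \<rho> using s by (simp add: field_simps)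
qed

text \<open>
  The projection of the sign of \<open>basis_sum \<psi> m v\<close>, evaluated at \<open>x\<close>, equals the mean of
  \<open>\<bar>basis_sum \<psi> m v\<bar>\<close>, and the sign has sup norm one.
\<close>

lemma Lebesgue_function_le:
  assumes x: "x \<in> X" and v: "\<And>i. i < m \<Longrightarrow> (\<Sum>j<m. gram i j * v j) = \<psi> (Suc i) x"
  shows "(\<integral>y. \<bar>basis_sum \<psi> m v y\<bar> \<partial>N) \<le> Sup (projection_ratios \<psi> X m N)"
proof -
  define h where "h y = (if 0 \<le> basis_sum \<psi> m v y then 1 else - 1 :: real)" for y
  have mh: "h \<in> borel_measurable borel" unfolding h_def by measurable
  have h1: "\<bar>h y\<bar> = 1" for y by (simp add: h_def)
  have nh: "sup_norm X h = 1" unfolding sup_norm_def h1 using X_ne by simp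
  have bh: "bounded (h ` X)" using h1 by (auto simp: bounded_iff intro!: exI[of _ 1])
  obtain b where b: "\<And>i. i < m \<Longrightarrow> (\<Sum>j<m. gram i j * b j) = (\<integral>x. h x * \<psi> (Suc i) x \<partial>N)"
    using gram_solvable[of "\<lambda>i. \<integral>x. h x * \<psi> (Suc i) x \<partial>N"] by blast
  let ?\<beta> = "Matrix.vec m b"
  have \<beta>: "?\<beta> \<in> carrier_vec m" by simp
  have "least_squares_coeff \<psi> m N h ?\<beta>"
  proof (rule least_squares_of_normal_equations[OF mh _ \<beta>])
    show "\<bar>h x\<bar> \<le> 1" for x by (simp add: h1)
    show "(\<Sum>j<m. gram i j * Matrix.vec_index ?\<beta> j) = (\<integral>x. h x * \<psi> (Suc i) x \<partial>N)" if "i < m" for i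
      using b[OF that] by simp
  qed
  then have mem: "sup_norm X (basis_comb \<psi> m ?\<beta>) / sup_norm X h \<in> projection_ratios \<psi> X m N"
    unfolding projection_ratios_def using mh bh nh by fastforce
  have "(\<integral>y. \<bar>basis_sum \<psi> m v y\<bar> \<partial>N) = (\<integral>y. h y * basis_sum \<psi> m v y \<partial>N)"
    by (rule Bochner_Integration.integral_cong) (auto simp: h_def)
  also have "\<dots> = (\<Sum>i<m. v i * (\<integral>x. h x * \<psi> (Suc i) x \<partial>N))"
    by (rule integral_times_basis_sum[OF mh, of 1]) (simp add: h1)
  also have "\<dots> = (\<Sum>i<m. \<Sum>j<m. v i * gram i j * b j)"
    using b[symmetric] by (intro sum.cong refl) (simp add: sum_distrib_left mult.assoc)
  also have "\<dots> = (\<Sum>j<m. \<Sum>i<m. b j * (gram j i * v i))"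
    by (subst sum.swap) (simp add: gram_sym mult_ac)
  also have "\<dots> = (\<Sum>j<m. b j * \<psi> (Suc j) x)"
    using v by (intro sum.cong refl) (simp add: sum_distrib_left[symmetric])
  also have "\<dots> = basis_comb \<psi> m ?\<beta> x"
    unfolding basis_comb_eq_basis_sum[OF \<beta>] by (auto simp: basis_sum_def)
  also have "\<dots> \<le> sup_norm X (basis_comb \<psi> m ?\<beta>)"
  proof -
    have "bdd_above ((\<lambda>x. \<bar>basis_comb \<psi> m ?\<beta> x\<bar>) ` X)"
      unfolding basis_comb_eq_basis_sum[OF \<beta>] using basis_sum_bound by (auto intro!: bdd_aboveI2)
    from sup_norm_ge[OF this x] show ?thesis by linarith
  qed
  also have "\<dots> \<le> Sup (projection_ratios \<psi> X m N)"
    using cSup_upper[OF mem projection_ratios_bdd] nh by simp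
  finally show ?thesis .
qed

text \<open>
  The projection fixes the first basis function.  In the recursion for the errors this makes the
  last step, an average of dual values without regression, no worse than a regression step.
\<close>

lemma one_le_Lebesgue:
  assumes m: "1 \<le> m"
  shows "1 \<le> Sup (projection_ratios \<psi> X m N)"
proof -
  let ?h = "\<psi> (Suc 0)" and ?v = "\<lambda>i::nat. if i = 0 then 1 else 0 :: real"
  let ?\<beta> = "unit_vec m 0 :: real Matrix.vec"
  have \<beta>: "?\<beta> \<in> carrier_vec m" by simp
  have bs: "basis_sum \<psi> m ?v = ?h"
    using m by (auto simp: basis_sum_def fun_eq_iff if_distrib[of "\<lambda>a. a * _"] sum.delta cong: if_cong)
  have comb: "basis_comb \<psi> m ?\<beta> = ?h"
  proof
    fix x
    have "basis_comb \<psi> m ?\<beta> x = basis_sum \<psi> m ?v x"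
      unfolding basis_comb_eq_basis_sum[OF \<beta>] basis_sum_def
      using m by (intro sum.cong refl) (auto simp: unit_vec_def)
    then show "basis_comb \<psi> m ?\<beta> x = ?h x" by (simp add: bs)
  qed
  have mh: "?h \<in> borel_measurable borel" and hc: "\<And>x. x \<in> X \<Longrightarrow> \<bar>?h x\<bar> \<le> c"
    using psi_meas[of 0] psi_bound_single[of 0] m by auto
  have bh: "bounded (?h ` X)" using hc by (auto simp: bounded_iff)
  have "\<exists>x\<in>X. ?h x \<noteq> 0"
  proof (rule ccontr)
    assume "\<not> (\<exists>x\<in>X. ?h x \<noteq> 0)"
    then have "AE x in N. (?h x)\<^sup>2 = 0" using AE_X by (auto elim!: eventually_mono)
    then have "(\<integral>x. (?h x)\<^sup>2 \<partial>N) = 0" by (rule integral_eq_zero_AE)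
    moreover have "\<epsilon> * (\<Sum>i<m. (?v i)\<^sup>2) \<le> (\<integral>x. (basis_sum \<psi> m ?v x)\<^sup>2 \<partial>N)" by (rule coercive)
    moreover have "(\<Sum>i<m. (?v i)\<^sup>2) = 1"
      using m by (simp add: if_distrib[of "\<lambda>a. a\<^sup>2"] sum.delta cong: if_cong)
    ultimately show False using eps_pos unfolding bs by simp
  qed
  then obtain x where x: "x \<in> X" "?h x \<noteq> 0" by blast
  have pos: "0 < sup_norm X ?h"
    using sup_norm_ge[OF bdd_above_abs_of_bounded[OF bh] x(1)] x(2) by linarith
  have "least_squares_coeff \<psi> m N ?h ?\<beta>"
    unfolding least_squares_coeff_def is_arg_min_def comb by (simp add: not_less)
  then have "sup_norm X (basis_comb \<psi> m ?\<beta>) / sup_norm X ?h \<in> projection_ratios \<psi> X m N"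
    unfolding projection_ratios_def using mh bh pos by blast
  then show ?thesis using cSup_upper[OF _ projection_ratios_bdd] pos unfolding comb by fastforce
qed

end

text \<open>
  The complement of the support is a union of open null sets; in Euclidean space countably many of
  them suffice.
\<close>

lemma AE_measure_support:
  fixes F :: "(real ^ 'n) measure"
  assumes sets: "sets F = sets borel"
  shows "AE x in F. x \<in> measure_support F"
proof -
  let ?N = "{U. open U \<and> emeasure F U = 0}"
  obtain N' where N': "N' \<subseteq> ?N" "countable N'" "\<Union>N' = \<Union>?N"
    using Lindelof[of ?N] by auto
  have "(\<Union>U\<in>N'. U) \<in> null_sets F"
  proof (rule null_sets_UN'[OF N'(2)])
    fix U assume "U \<in> N'"
    then have "open U" "emeasure F U = 0" using N'(1) by auto
    then show "U \<in> null_sets F" using sets by (intro null_setsI) auto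
  qed
  then have "AE x in F. x \<notin> \<Union>?N" unfolding N'(3)[symmetric] by (auto dest: AE_not_in)
  then show ?thesis
    by eventually_elim (auto simp: measure_support_def zero_less_iff_neq_zero)
qed

text \<open>
  Orthonormality under \<open>F\<close> gives coercivity under \<open>N\<close> because the density of \<open>N\<close> exceeds \<open>\<epsilon>\<close> on the
  support of \<open>F\<close>, so that second moments under \<open>N\<close> are at least \<open>\<epsilon>\<close> times those under \<open>F\<close>.
\<close>

lemma regression_basis_of_density:
  fixes F N :: "(real ^ 'n) measure"
  assumes N: "prob_space N" "sets N = sets borel" "AE x in N. x \<in> X"
    and X: "compact X" "X \<noteq> {}"
    and F: "sets F = sets borel" "measure_support F = X"
    and psi_meas: "\<And>m. m \<ge> 1 \<Longrightarrow> \<psi> m \<in> borel_measurable borel"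
    and orthonormal: "\<And>i j. i \<ge> 1 \<Longrightarrow> j \<ge> 1 \<Longrightarrow>
      integrable F (\<lambda>x. \<psi> i x * \<psi> j x) \<and> (\<integral>x. \<psi> i x * \<psi> j x \<partial>F) = (if i = j then 1 else 0)"
    and \<epsilon>: "0 < \<epsilon>"
    and g: "g \<in> borel_measurable F" "N = density F (\<lambda>x. ennreal (g x))" "\<And>x. x \<in> X \<Longrightarrow> \<epsilon> < g x"
    and growth: "\<And>x. x \<in> X \<Longrightarrow> (\<Sum>i<m. (\<psi> (Suc i) x)\<^sup>2) \<le> c\<^sup>2" and c: "0 \<le> c"
  shows "regression_basis N X \<psi> m c \<epsilon>"
proof -
  interpret N: prob_space N by (rule N(1))
  have XF: "AE x in F. x \<in> X" using AE_measure_support[OF F(1)] F(2) by simp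
  have meas: "basis_sum \<psi> m v \<in> borel_measurable borel" for v
    unfolding basis_sum_def using psi_meas by (auto intro!: borel_measurable_sum borel_measurable_times)
  have coercive: "\<epsilon> * (\<Sum>i<m. (v i)\<^sup>2) \<le> (\<integral>x. (basis_sum \<psi> m v x)\<^sup>2 \<partial>N)" for v
  proof -
    let ?q = "\<lambda>x. (basis_sum \<psi> m v x)\<^sup>2"
    have q: "?q = (\<lambda>x. \<Sum>i<m. \<Sum>j<m. v i * v j * (\<psi> (Suc i) x * \<psi> (Suc j) x))"
      unfolding basis_sum_def power2_eq_square sum_product by (simp add: mult_ac)
    have iF: "integrable F ?q" unfolding q
      using orthonormal by (intro Bochner_Integration.integrable_sum integrable_mult_right) auto
    have "(\<integral>x. ?q x \<partial>F) = (\<Sum>i<m. \<Sum>j<m. v i * v j * (if i = j then 1 else 0))"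
      unfolding q using orthonormal by (subst integral_double_sum) auto
    also have "\<dots> = (\<Sum>i<m. (v i)\<^sup>2)"
      by (simp add: if_distrib[of "\<lambda>a. _ * a"] power2_eq_square sum.delta cong: if_cong)
    finally have norm: "(\<integral>x. ?q x \<partial>F) = (\<Sum>i<m. (v i)\<^sup>2)" .
    have mq: "?q \<in> borel_measurable F" using iF by auto
    have g0: "AE x in F. 0 \<le> g x" using XF
    proof eventually_elim
      case (elim x)
      then show ?case using g(3)[of x] \<epsilon> by simp
    qed
    have iN: "integrable N ?q"
    proof (rule N.integrable_const_bound[where B = "(sqrt (\<Sum>i<m. (v i)\<^sup>2) * c)\<^sup>2"])
      show "AE x in N. norm (?q x) \<le> (sqrt (\<Sum>i<m. (v i)\<^sup>2) * c)\<^sup>2" using N(3)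
      proof eventually_elim
        case (elim x)
        have "\<bar>basis_sum \<psi> m v x\<bar> \<le> sqrt (\<Sum>i<m. (v i)\<^sup>2) * sqrt (\<Sum>i<m. (\<psi> (Suc i) x)\<^sup>2)"
          unfolding basis_sum_def by (rule sum_mult_le_sqrt)
        also have "\<dots> \<le> sqrt (\<Sum>i<m. (v i)\<^sup>2) * c"
          using real_le_lsqrt[OF c growth[OF elim]] by (intro mult_left_mono) (auto simp: sum_nonneg)
        finally show ?case using c by (simp add: power2_le_iff_abs_le sum_nonneg del: power_mult_distrib)
      qed
      show "?q \<in> borel_measurable N"
        using measurable_cong_sets[OF N(2) refl] meas[of v] by (auto intro!: borel_measurable_power)
    qed
    have "integrable F (\<lambda>x. g x *\<^sub>R ?q x)"
      using iN integrable_density[OF mq g(1) g0] unfolding g(2) by simp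
    then have "\<epsilon> * (\<integral>x. ?q x \<partial>F) \<le> (\<integral>x. g x *\<^sub>R ?q x \<partial>F)"
      unfolding integral_mult_right_zero[symmetric]
    proof (rule integral_mono_AE[rotated])
      show "integrable F (\<lambda>x. \<epsilon> * ?q x)" using iF by simp
      show "AE x in F. \<epsilon> * ?q x \<le> g x *\<^sub>R ?q x" using XF
      proof eventually_elim
        case (elim x)
        then show ?case using g(3)[of x] by (auto intro!: mult_right_mono)
      qed
    qed
    also have "\<dots> = (\<integral>x. ?q x \<partial>N)"
      unfolding g(2) by (rule integral_density[OF mq g(1) g0, symmetric])
    finally show ?thesis unfolding norm .
  qed
  show ?thesis
    by unfold_locales
      (use N X psi_meas growth c \<epsilon> coercive in \<open>auto intro: borel_closed compact_imp_closed\<close>)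
qed

section \<open>Samples on which regression is stable\<close>

text \<open>
  The deviation bound is for finitely many coefficient vectors, whereas the representers of all
  states are needed.  A grid of arbitrarily small mesh closes the gap: the bound does not depend on
  the number of grid points.
\<close>

lemma finite_grid:
  fixes R h :: real
  assumes R: "0 \<le> R" and h: "0 < h"
  obtains V :: "(nat \<Rightarrow> real) set" where "finite V" "(\<lambda>i. 0) \<in> V"
    "\<And>v i. v \<in> V \<Longrightarrow> \<bar>v i\<bar> \<le> R"
    "\<And>w. (\<And>i. i < m \<Longrightarrow> \<bar>w i\<bar> \<le> R) \<Longrightarrow> \<exists>v\<in>V. \<forall>i<m. \<bar>w i - v i\<bar> \<le> h"
proof -
  have "seq_compact {-R..R}" using compact_Icc[of "-R" R] by (rule compact_imp_seq_compact)
  from seq_compact_imp_totally_bounded[OF this, rule_format, OF h]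
  obtain k where k: "finite k" "k \<subseteq> {-R..R}" "{-R..R} \<subseteq> (\<Union>a\<in>k. ball a h)"
    by (elim exE conjE)
  define A where "A = insert 0 k"
  define V where "V = (\<lambda>f i. if i < m then f i else 0) ` (PiE {..<m} (\<lambda>_. A))"
  show ?thesis
  proof (rule that[of V])
    show "finite V" unfolding V_def A_def using k by (intro finite_imageI finite_PiE) auto
    show "(\<lambda>i. 0) \<in> V" unfolding V_def
      by (rule image_eqI[of _ _ "\<lambda>i\<in>{..<m}. 0"]) (auto simp: A_def restrict_PiE_iff)
    show "\<bar>v i\<bar> \<le> R" if "v \<in> V" for v i
    proof -
      obtain f where f: "f \<in> PiE {..<m} (\<lambda>_. A)" "v = (\<lambda>i. if i < m then f i else 0)"
        using \<open>v \<in> V\<close> unfolding V_def by blast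
      show ?thesis
      proof (cases "i < m")
        case True
        then have "f i \<in> A" using f(1) by auto
        then have "f i \<in> {-R..R}" using k(2) R by (auto simp: A_def)
        then show ?thesis using True f(2) by (simp add: abs_le_iff)
      qed (use f R in simp)
    qed
    show "\<exists>v\<in>V. \<forall>i<m. \<bar>w i - v i\<bar> \<le> h" if w: "\<And>i. i < m \<Longrightarrow> \<bar>w i\<bar> \<le> R" for w
    proof -
      have "\<exists>a\<in>A. \<bar>w i - a\<bar> \<le> h" if "i < m" for i
      proof -
        have "w i \<in> {-R..R}" using w[OF that] by (auto simp: abs_le_iff)
        from subsetD[OF k(3) this] obtain a where a: "a \<in> k" "w i \<in> ball a h" by (rule UN_E)
        have "\<bar>w i - a\<bar> \<le> h" using a(2) by (simp add: dist_real_def abs_minus_commute)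
        then show ?thesis using a(1) by (intro bexI[of _ a]) (simp_all add: A_def)
      qed
      then have "\<forall>i\<in>{..<m}. \<exists>a. a \<in> A \<and> \<bar>w i - a\<bar> \<le> h" by blast
      from bchoice[OF this] obtain g where g: "\<And>i. i < m \<Longrightarrow> g i \<in> A \<and> \<bar>w i - g i\<bar> \<le> h" by auto
      show ?thesis
      proof (rule bexI)
        have "(\<lambda>i\<in>{..<m}. g i) \<in> PiE {..<m} (\<lambda>_. A)" using g by (intro restrict_PiE_iff[THEN iffD2]) blast
        then show "(\<lambda>i. if i < m then (\<lambda>i\<in>{..<m}. g i) i else 0) \<in> V"
          unfolding V_def by (rule imageI)
        show "\<forall>i<m. \<bar>w i - (if i < m then (\<lambda>i\<in>{..<m}. g i) i else 0)\<bar> \<le> h" using g by simp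
      qed
    qed
  qed
qed

context regression_basis
begin

definition sampled_gram :: "nat \<Rightarrow> (nat \<Rightarrow> real ^ 'n) \<Rightarrow> nat \<Rightarrow> nat \<Rightarrow> real" where
  "sampled_gram L xs i j = (\<Sum>l=1..L. \<psi> (Suc i) (xs l) * \<psi> (Suc j) (xs l)) / real L"

text \<open>
  The two properties of the sampled states on which the error recursion rests: the empirical Gram matrix
  is invertible, and regression of arbitrary bounded targets is bounded by \<open>\<Lambda>\<close> in sup norm.
\<close>

definition stable_sample :: "nat \<Rightarrow> real \<Rightarrow> (nat \<Rightarrow> real ^ 'n) \<Rightarrow> bool" where
  "stable_sample L \<Lambda> xs \<longleftrightarrow>
     (\<forall>v. \<epsilon> / 2 * (\<Sum>i<m. (v i)\<^sup>2) \<le> (\<Sum>i<m. \<Sum>j<m. v i * sampled_gram L xs i j * v j)) \<and>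
     (\<forall>\<beta> d \<delta>. (\<forall>i<m. (\<Sum>j<m. sampled_gram L xs i j * \<beta> j)
            = (\<Sum>l=1..L. d l * \<psi> (Suc i) (xs l)) / real L) \<longrightarrow>
        (\<forall>l\<in>{1..L}. \<bar>d l\<bar> \<le> \<delta>) \<longrightarrow> (\<forall>x\<in>X. \<bar>basis_sum \<psi> m \<beta> x\<bar> \<le> \<Lambda> * \<delta>))"

text \<open>
  Only \<open>v\<close> of length at most \<open>c / \<epsilon>\<close> have to be controlled, since the representers of all states are
  that short.
\<close>

lemma stable_sampleI:
  assumes L: "1 \<le> L" and xs: "\<And>l. l \<in> {1..L} \<Longrightarrow> xs l \<in> X"
    and \<kappa>: "0 \<le> \<kappa>" "\<kappa> \<le> \<epsilon> / 2" and \<tau>: "0 \<le> \<tau>"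
    and close: "(\<Sum>i<m. \<Sum>j<m. (sampled_gram L xs i j - gram i j)\<^sup>2) \<le> \<kappa>\<^sup>2"
    and dev: "\<And>v. sqrt (\<Sum>i<m. (v i)\<^sup>2) \<le> c / \<epsilon> \<Longrightarrow>
      (\<Sum>l=1..L. \<bar>basis_sum \<psi> m v (xs l)\<bar>) / real L \<le> (\<integral>x. \<bar>basis_sum \<psi> m v x\<bar> \<partial>N) + \<tau>"
  shows "stable_sample L (Sup (projection_ratios \<psi> X m N) + \<tau> + \<kappa> * (c / \<epsilon>) * sqrt (2 / \<epsilon>)) xs"
  unfolding stable_sample_def
proof (intro conjI allI impI ballI)
  fix v :: "nat \<Rightarrow> real"
  have "\<epsilon> / 2 * (\<Sum>i<m. (v i)\<^sup>2) \<le> (\<epsilon> - \<kappa>) * (\<Sum>i<m. (v i)\<^sup>2)"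
    using \<kappa> by (intro mult_right_mono) (auto simp: sum_nonneg)
  also have "\<dots> \<le> (\<Sum>i<m. \<Sum>j<m. v i * sampled_gram L xs i j * v j)"
    by (rule positive_definite_perturbation[OF gram_coercive close \<kappa>(1)])
  finally show "\<epsilon> / 2 * (\<Sum>i<m. (v i)\<^sup>2) \<le> (\<Sum>i<m. \<Sum>j<m. v i * sampled_gram L xs i j * v j)" .
next
  fix \<beta> d \<delta> x
  assume \<beta>: "\<forall>i<m. (\<Sum>j<m. sampled_gram L xs i j * \<beta> j) = (\<Sum>l=1..L. d l * \<psi> (Suc i) (xs l)) / real L"
    and d: "\<forall>l\<in>{1..L}. \<bar>d l\<bar> \<le> \<delta>" and x: "x \<in> X"
  have "\<bar>d 1\<bar> \<le> \<delta>" using d L by simp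
  then have \<delta>: "0 \<le> \<delta>" by (rule order.trans[OF abs_ge_zero])
  obtain v where v: "\<And>i. i < m \<Longrightarrow> (\<Sum>j<m. gram i j * v j) = \<psi> (Suc i) x"
    using gram_solvable[of "\<lambda>i. \<psi> (Suc i) x"] by blast
  have vn: "sqrt (\<Sum>i<m. (v i)\<^sup>2) \<le> c / \<epsilon>" by (rule representer_bound[OF x v])
  have "\<bar>basis_sum \<psi> m \<beta> x\<bar> = \<bar>\<Sum>i<m. \<psi> (Suc i) x * \<beta> i\<bar>"
    by (simp add: basis_sum_def mult.commute)
  also have "\<dots> \<le> ((\<Sum>l=1..L. \<bar>\<Sum>i<m. v i * \<psi> (Suc i) (xs l)\<bar>) / real L
      + \<kappa> * sqrt (\<Sum>i<m. (v i)\<^sup>2) * sqrt (2 / \<epsilon>)) * \<delta>"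
  proof (rule regression_operator_bound[OF L eps_pos gram_sym gram_coercive _ \<kappa> _ _ \<delta> v])
    show "\<bar>d l\<bar> \<le> \<delta>" if "l \<in> {1..L}" for l using d that by blast
    show "(\<Sum>i<m. \<Sum>j<m. ((\<Sum>l = 1..L. \<psi> (Suc i) (xs l) * \<psi> (Suc j) (xs l)) / real L - gram i j)\<^sup>2) \<le> \<kappa>\<^sup>2"
      using close unfolding sampled_gram_def .
    show "(\<Sum>j<m. (\<Sum>l = 1..L. \<psi> (Suc i) (xs l) * \<psi> (Suc j) (xs l)) / real L * \<beta> j)
        = (\<Sum>l = 1..L. d l * \<psi> (Suc i) (xs l)) / real L" if "i < m" for i
      using \<beta> that unfolding sampled_gram_def by simp
  qed
  also have "\<dots> \<le> (Sup (projection_ratios \<psi> X m N) + \<tau> + \<kappa> * (c / \<epsilon>) * sqrt (2 / \<epsilon>)) * \<delta>"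
  proof (rule mult_right_mono[OF add_mono \<delta>])
    show "(\<Sum>l=1..L. \<bar>\<Sum>i<m. v i * \<psi> (Suc i) (xs l)\<bar>) / real L \<le> Sup (projection_ratios \<psi> X m N) + \<tau>"
      unfolding basis_sum_def[symmetric]
      by (rule order.trans[OF dev[OF vn] add_right_mono[OF Lebesgue_function_le[OF x v]]])
    show "\<kappa> * sqrt (\<Sum>i<m. (v i)\<^sup>2) * sqrt (2 / \<epsilon>) \<le> \<kappa> * (c / \<epsilon>) * sqrt (2 / \<epsilon>)"
      by (rule mult_right_mono[OF mult_left_mono[OF vn \<kappa>(1)]]) (use eps_pos in simp)
  qed
  finally show "\<bar>basis_sum \<psi> m \<beta> x\<bar>
      \<le> (Sup (projection_ratios \<psi> X m N) + \<tau> + \<kappa> * (c / \<epsilon>) * sqrt (2 / \<epsilon>)) * \<delta>" .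
qed

text \<open>
  Both the mean and the sample mean of \<open>\<bar>basis_sum \<psi> m v\<bar>\<close> are Lipschitz in \<open>v\<close>; within the mesh of the
  grid each of them changes by at most \<open>\<tau>\<close>.
\<close>

lemma deviation_of_close_coefficients:
  assumes L: "1 \<le> L" and xs: "\<And>l. l \<in> {1..L} \<Longrightarrow> xs l \<in> X" and \<tau>: "0 < \<tau>"
    and close: "\<And>i. i < m \<Longrightarrow> \<bar>w i - v i\<bar> \<le> \<tau> / (m * c + 1)"
    and dev: "(\<Sum>l=1..L. \<bar>basis_sum \<psi> m v (xs l)\<bar>) / real L \<le> (\<integral>x. \<bar>basis_sum \<psi> m v x\<bar> \<partial>N) + \<tau>"
  shows "(\<Sum>l=1..L. \<bar>basis_sum \<psi> m w (xs l)\<bar>) / real L \<le> (\<integral>x. \<bar>basis_sum \<psi> m w x\<bar> \<partial>N) + 3 * \<tau>"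
proof -
  have mc: "0 < m * c + 1" using c_nonneg by (simp add: add_nonneg_pos)
  have chain: "p \<le> q \<Longrightarrow> q = r + \<tau> \<Longrightarrow> s \<le> t + \<tau> \<Longrightarrow> r \<le> s + \<tau> \<Longrightarrow> p \<le> t + 3 * \<tau>"
    for p q r s t :: real by linarith
  have diff: "\<bar>basis_sum \<psi> m w x - basis_sum \<psi> m v x\<bar> \<le> \<tau>" if x: "x \<in> X" for x
  proof -
    have "\<bar>basis_sum \<psi> m w x - basis_sum \<psi> m v x\<bar> = \<bar>\<Sum>i<m. (w i - v i) * \<psi> (Suc i) x\<bar>"
      by (simp add: basis_sum_def left_diff_distrib sum_subtractf)
    also have "\<dots> \<le> (\<Sum>i<m. \<tau> / (m * c + 1) * c)"
    proof (rule order.trans[OF sum_abs sum_mono])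
      fix i assume "i \<in> {..<m}"
      then have i: "i < m" by simp
      show "\<bar>(w i - v i) * \<psi> (Suc i) x\<bar> \<le> \<tau> / (m * c + 1) * c"
        unfolding abs_mult
        by (rule mult_mono[OF close[OF i] psi_bound_single[OF i x]]) (use \<tau> mc in simp_all)
    qed
    also have "\<dots> = \<tau> * (m * c / (m * c + 1))" by simp
    also have "\<dots> \<le> \<tau> * 1"
    proof (rule mult_left_mono)
      show "m * c / (m * c + 1) \<le> 1" using mc by (simp add: divide_le_eq)
    qed (use \<tau> in simp)
    finally show ?thesis by simp
  qed
  have le: "\<bar>basis_sum \<psi> m w x\<bar> \<le> \<bar>basis_sum \<psi> m v x\<bar> + \<tau>"
    "\<bar>basis_sum \<psi> m v x\<bar> \<le> \<bar>basis_sum \<psi> m w x\<bar> + \<tau>" if "x \<in> X" for x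
    using diff[OF that] by linarith+
  have i: "integrable N (\<lambda>x. \<bar>basis_sum \<psi> m u x\<bar>)" for u
  proof (rule integrable_bounded_on_X)
    show "(\<lambda>x. \<bar>basis_sum \<psi> m u x\<bar>) \<in> borel_measurable borel" by measurable
    show "\<bar>\<bar>basis_sum \<psi> m u x\<bar>\<bar> \<le> sqrt (\<Sum>i<m. (u i)\<^sup>2) * c" if "x \<in> X" for x
      using basis_sum_bound[OF that] by simp
  qed
  have "(\<Sum>l=1..L. \<bar>basis_sum \<psi> m w (xs l)\<bar>) \<le> (\<Sum>l=1..L. \<bar>basis_sum \<psi> m v (xs l)\<bar> + \<tau>)"
    by (rule sum_mono) (rule le(1)[OF xs])
  also have "\<dots> = (\<Sum>l=1..L. \<bar>basis_sum \<psi> m v (xs l)\<bar>) + L * \<tau>" by (simp add: sum.distrib)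
  finally have "(\<Sum>l=1..L. \<bar>basis_sum \<psi> m w (xs l)\<bar>) / L
      \<le> ((\<Sum>l=1..L. \<bar>basis_sum \<psi> m v (xs l)\<bar>) + L * \<tau>) / L"
    by (rule divide_right_mono) simp
  moreover have "((\<Sum>l=1..L. \<bar>basis_sum \<psi> m v (xs l)\<bar>) + L * \<tau>) / L
      = (\<Sum>l=1..L. \<bar>basis_sum \<psi> m v (xs l)\<bar>) / L + \<tau>"
    using L by (simp add: add_divide_distrib)
  moreover have "(\<integral>x. \<bar>basis_sum \<psi> m v x\<bar> \<partial>N) \<le> (\<integral>x. \<bar>basis_sum \<psi> m w x\<bar> \<partial>N) + \<tau>"
  proof -
    have "(\<integral>x. \<bar>basis_sum \<psi> m v x\<bar> \<partial>N) \<le> (\<integral>x. \<bar>basis_sum \<psi> m w x\<bar> + \<tau> \<partial>N)"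
    proof (rule integral_mono_AE[OF i])
      show "AE x in N. \<bar>basis_sum \<psi> m v x\<bar> \<le> \<bar>basis_sum \<psi> m w x\<bar> + \<tau>"
        using AE_X by eventually_elim (rule le(2))
    qed (use i in simp)
    then show ?thesis using i by (simp add: prob_space)
  qed
  moreover note dev
  ultimately show ?thesis by (rule chain)
qed

text \<open>Truncation to \<open>X\<close> changes nothing almost surely but makes the basis functions bounded everywhere.\<close>

definition cutoff_basis :: "nat \<Rightarrow> real ^ 'n \<Rightarrow> real" where
  "cutoff_basis i x = indicator X x * \<psi> (Suc i) x"

lemma cutoff_basis_on_X: "x \<in> X \<Longrightarrow> cutoff_basis i x = \<psi> (Suc i) x"
  by (simp add: cutoff_basis_def)

lemma cutoff_basis_meas: "i < m \<Longrightarrow> cutoff_basis i \<in> borel_measurable N"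
  unfolding cutoff_basis_def using psi_meas X_borel
  by (intro borel_measurable_N borel_measurable_times borel_measurable_indicator) auto

lemma cutoff_basis_bound: "(\<Sum>i<m. (cutoff_basis i x)\<^sup>2) \<le> c\<^sup>2"
  using psi_bound[of x] by (cases "x \<in> X") (auto simp: cutoff_basis_def)

lemma integral_cutoff_basis:
  fixes F :: "(nat \<Rightarrow> real) \<Rightarrow> real"
  assumes "(\<lambda>x. F (\<lambda>i. cutoff_basis i x)) \<in> borel_measurable N"
    "(\<lambda>x. F (\<lambda>i. \<psi> (Suc i) x)) \<in> borel_measurable N"
  shows "(\<integral>x. F (\<lambda>i. cutoff_basis i x) \<partial>N) = (\<integral>x. F (\<lambda>i. \<psi> (Suc i) x) \<partial>N)"
proof (rule integral_cong_AE[OF assms])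
  show "AE x in N. F (\<lambda>i. cutoff_basis i x) = F (\<lambda>i. \<psi> (Suc i) x)"
    using AE_X by eventually_elim (simp add: cutoff_basis_on_X)
qed

lemma cutoff_basis_integrals:
  shows "i < m \<Longrightarrow> j < m \<Longrightarrow> (\<integral>x. cutoff_basis i x * cutoff_basis j x \<partial>N) = gram i j"
    and "(\<integral>x. \<bar>\<Sum>i<m. v i * cutoff_basis i x\<bar> \<partial>N) = (\<integral>x. \<bar>basis_sum \<psi> m v x\<bar> \<partial>N)"
    and "(\<integral>x. (\<Sum>i<m. (cutoff_basis i x)\<^sup>2) \<partial>N) = (\<integral>x. (\<Sum>i<m. (\<psi> (Suc i) x)\<^sup>2) \<partial>N)"
proof -
  have m\<psi>: "\<psi> (Suc i) \<in> borel_measurable N" if "i < m" for i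
    using psi_meas[OF that] by (rule borel_measurable_N)
  show "(\<integral>x. cutoff_basis i x * cutoff_basis j x \<partial>N) = gram i j" if "i < m" "j < m"
    unfolding gram_def using that
    by (intro integral_cutoff_basis[of "\<lambda>y. y i * y j"] borel_measurable_times cutoff_basis_meas m\<psi>)
  show "(\<integral>x. \<bar>\<Sum>i<m. v i * cutoff_basis i x\<bar> \<partial>N) = (\<integral>x. \<bar>basis_sum \<psi> m v x\<bar> \<partial>N)"
    unfolding basis_sum_def
    by (rule integral_cutoff_basis[of "\<lambda>y. \<bar>\<Sum>i<m. v i * y i\<bar>"])
      (auto intro!: borel_measurable_abs borel_measurable_sum borel_measurable_times cutoff_basis_meas m\<psi>)
  show "(\<integral>x. (\<Sum>i<m. (cutoff_basis i x)\<^sup>2) \<partial>N) = (\<integral>x. (\<Sum>i<m. (\<psi> (Suc i) x)\<^sup>2) \<partial>N)"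
    by (rule integral_cutoff_basis[of "\<lambda>y. \<Sum>i<m. (y i)\<^sup>2"])
      (auto intro!: borel_measurable_sum borel_measurable_power cutoff_basis_meas m\<psi>)
qed

text \<open>
  The parameters \<open>\<kappa>\<close> and \<open>\<tau>\<close> are the tolerated Gram error and deviation.  Grid vectors have
  coordinates up to \<open>c / \<epsilon>\<close> and therefore length up to \<open>c / \<epsilon> * sqrt m\<close>; this loses a factor
  \<open>sqrt m\<close>, which the rate can afford.
\<close>

lemma unstable_sample_event:
  fixes Q :: "'q measure"
  assumes Q: "prob_space Q" and L: "1 \<le> L"
    and S: "prob_space.indep_vars Q (\<lambda>_. borel) S {1..L}"
      "\<And>l. l \<in> {1..L} \<Longrightarrow> distr Q borel (S l) = N"
      "\<And>l \<omega>. l \<in> {1..L} \<Longrightarrow> \<omega> \<in> space Q \<Longrightarrow> S l \<omega> \<in> X"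
    and moment: "(\<integral>x. (\<Sum>i<m. (\<psi> (Suc i) x)\<^sup>2) \<partial>N) \<le> \<mu>"
    and \<kappa>: "0 < \<kappa>" "\<kappa> \<le> \<epsilon> / 2" and \<tau>: "0 < \<tau>"
  shows "\<exists>bad. bad \<in> sets Q \<and>
    measure Q bad \<le> c\<^sup>2 * \<mu> / (L * \<kappa>\<^sup>2) + 2 * (c / \<epsilon> * sqrt m) * sqrt (\<mu> / L) / \<tau> \<and>
    (\<forall>\<omega>\<in>space Q - bad. stable_sample L
      (Sup (projection_ratios \<psi> X m N) + 3 * \<tau> + \<kappa> * (c / \<epsilon>) * sqrt (2 / \<epsilon>)) (\<lambda>l. S l \<omega>))"
proof -
  interpret Q: prob_space Q by (rule Q)
  have h: "0 < \<tau> / (m * c + 1)" using \<tau> c_nonneg by (simp add: add_nonneg_pos)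
  have R0: "0 \<le> c / \<epsilon>" using c_nonneg eps_pos by simp
  obtain V :: "(nat \<Rightarrow> real) set" where V: "finite V" "(\<lambda>i. 0) \<in> V"
    and VR: "\<And>v i. v \<in> V \<Longrightarrow> \<bar>v i\<bar> \<le> c / \<epsilon>"
    and net: "\<And>w. (\<And>i. i < m \<Longrightarrow> \<bar>w i\<bar> \<le> c / \<epsilon>) \<Longrightarrow> \<exists>v\<in>V. \<forall>i<m. \<bar>w i - v i\<bar> \<le> \<tau> / (m * c + 1)"
    by (rule finite_grid[OF R0 h, of m]) blast
  have radius: "(\<Sum>i<m. (v i)\<^sup>2) \<le> (c / \<epsilon> * sqrt m)\<^sup>2" if "v \<in> V" for v
  proof -
    have "(\<Sum>i<m. (v i)\<^sup>2) \<le> (\<Sum>i<m. (c / \<epsilon>)\<^sup>2)"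
      using VR[OF that] R0 by (intro sum_mono) (simp add: power2_le_iff_abs_le)
    then show ?thesis unfolding power_mult_distrib by (simp add: mult.commute)
  qed
  have mt: "S l \<in> measurable Q N" if "l \<in> {1..L}" for l
    using S(1) that by (simp add: Q.indep_vars_def2 measurable_cong_sets[OF refl sets_N])
  have indep: "Q.indep_vars (\<lambda>_. N) S {1..L}"
    using S(1) mt by (simp add: Q.indep_vars_def2 sets_N)
  have dist: "distr Q N (S l) = N" if "l \<in> {1..L}" for l
    using S(2)[OF that] distr_cong[OF refl sets_N, of Q "S l" "S l"] by simp
  define U where "U \<omega> = (\<Sum>i<m. \<Sum>j<m.
      ((\<Sum>l=1..L. cutoff_basis i (S l \<omega>) * cutoff_basis j (S l \<omega>)) / real L
      - (\<integral>x. cutoff_basis i x * cutoff_basis j x \<partial>N))\<^sup>2)" for \<omega>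
  define D where "D v \<omega> = (\<Sum>l=1..L. \<bar>\<Sum>i<m. v i * cutoff_basis i (S l \<omega>)\<bar>) / real L
      - (\<integral>x. \<bar>\<Sum>i<m. v i * cutoff_basis i x\<bar> \<partial>N)" for v \<omega>
  let ?bad = "{\<omega> \<in> space Q. \<kappa>\<^sup>2 \<le> U \<omega> \<or> (\<exists>v\<in>V. \<tau> \<le> D v \<omega>)}"
  have R1: "0 \<le> c / \<epsilon> * sqrt m" using R0 by (rule mult_nonneg_nonneg) simp
  have \<kappa>2: "0 < \<kappa>\<^sup>2" using \<kappa> by simp
  have moment': "(\<integral>x. (\<Sum>i<m. (cutoff_basis i x)\<^sup>2) \<partial>N) \<le> \<mu>"
    using moment cutoff_basis_integrals(3) by simp
  note fail = Q.prob_regression_failure_le[OF prob_space_axioms indep dist cutoff_basis_meas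
      cutoff_basis_bound c_nonneg moment' V R1 radius L \<kappa>2 \<tau>, folded U_def D_def]
  have stable: "stable_sample L
      (Sup (projection_ratios \<psi> X m N) + 3 * \<tau> + \<kappa> * (c / \<epsilon>) * sqrt (2 / \<epsilon>)) (\<lambda>l. S l \<omega>)"
    if \<omega>: "\<omega> \<in> space Q" and good1: "U \<omega> < \<kappa>\<^sup>2" and good2: "\<And>v. v \<in> V \<Longrightarrow> D v \<omega> < \<tau>" for \<omega>
  proof (rule stable_sampleI)
    let ?xs = "\<lambda>l. S l \<omega>"
    show "1 \<le> L" "0 \<le> \<kappa>" "\<kappa> \<le> \<epsilon> / 2" "0 \<le> 3 * \<tau>" using L \<kappa> \<tau> by simp_all
    have SX: "S l \<omega> \<in> X" if "l \<in> {1..L}" for l by (rule S(3)[OF that \<omega>])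
    then show "\<And>l. l \<in> {1..L} \<Longrightarrow> S l \<omega> \<in> X" .
    have cut: "cutoff_basis i (S l \<omega>) = \<psi> (Suc i) (S l \<omega>)" if "l \<in> {1..L}" for i l
      by (rule cutoff_basis_on_X[OF SX[OF that]])
    have entry: "sampled_gram L ?xs i j - gram i j
        = (\<Sum>l=1..L. cutoff_basis i (S l \<omega>) * cutoff_basis j (S l \<omega>)) / real L
          - (\<integral>x. cutoff_basis i x * cutoff_basis j x \<partial>N)"
      if "i < m" "j < m" for i j
      unfolding sampled_gram_def cutoff_basis_integrals(1)[OF that]
      by (simp add: cut cong: sum.cong_simp)
    have "(\<Sum>i<m. \<Sum>j<m. (sampled_gram L ?xs i j - gram i j)\<^sup>2) = U \<omega>"
      unfolding U_def by (simp add: entry cong: sum.cong_simp)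
    then show "(\<Sum>i<m. \<Sum>j<m. (sampled_gram L ?xs i j - gram i j)\<^sup>2) \<le> \<kappa>\<^sup>2" using good1 by simp
    fix w :: "nat \<Rightarrow> real" assume wn: "sqrt (\<Sum>i<m. (w i)\<^sup>2) \<le> c / \<epsilon>"
    have "\<bar>w i\<bar> \<le> c / \<epsilon>" if "i < m" for i
    proof -
      have "(w i)\<^sup>2 \<le> (\<Sum>i<m. (w i)\<^sup>2)" using that by (intro member_le_sum) auto
      then have "sqrt ((w i)\<^sup>2) \<le> sqrt (\<Sum>i<m. (w i)\<^sup>2)" by (rule real_sqrt_le_mono)
      then show ?thesis using wn by simp
    qed
    from net[OF this] obtain v where v: "v \<in> V" "\<forall>i<m. \<bar>w i - v i\<bar> \<le> \<tau> / (m * c + 1)"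
      by (rule bexE)
    have D: "D v \<omega> = (\<Sum>l=1..L. \<bar>basis_sum \<psi> m v (S l \<omega>)\<bar>) / real L - (\<integral>x. \<bar>basis_sum \<psi> m v x\<bar> \<partial>N)"
      unfolding D_def cutoff_basis_integrals(2) by (simp add: cut basis_sum_def cong: sum.cong_simp)
    have "p - q < \<tau> \<Longrightarrow> p \<le> q + \<tau>" for p q :: real by linarith
    from this[OF good2[OF v(1), unfolded D]]
    have "(\<Sum>l=1..L. \<bar>basis_sum \<psi> m v (S l \<omega>)\<bar>) / real L \<le> (\<integral>x. \<bar>basis_sum \<psi> m v x\<bar> \<partial>N) + \<tau>" .
    from deviation_of_close_coefficients[OF L SX \<tau> v(2)[rule_format] this]
    show "(\<Sum>l=1..L. \<bar>basis_sum \<psi> m w (S l \<omega>)\<bar>) / real L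
        \<le> (\<integral>x. \<bar>basis_sum \<psi> m w x\<bar> \<partial>N) + 3 * \<tau>" .
  qed
  show ?thesis
  proof (intro exI[of _ ?bad] conjI ballI)
    show "?bad \<in> sets Q" by (rule fail(1))
    show "measure Q ?bad \<le> c\<^sup>2 * \<mu> / (L * \<kappa>\<^sup>2) + 2 * (c / \<epsilon> * sqrt m) * sqrt (\<mu> / L) / \<tau>"
      by (rule fail(2))
    fix \<omega> assume "\<omega> \<in> space Q - ?bad"
    then have "\<omega> \<in> space Q" "U \<omega> < \<kappa>\<^sup>2" "\<And>v. v \<in> V \<Longrightarrow> D v \<omega> < \<tau>" by (auto simp: not_le)
    then show "stable_sample L
      (Sup (projection_ratios \<psi> X m N) + 3 * \<tau> + \<kappa> * (c / \<epsilon>) * sqrt (2 / \<epsilon>)) (\<lambda>l. S l \<omega>)"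
      by (rule stable)
  qed
qed

lemma stable_sample_mono:
  assumes st: "stable_sample L \<Lambda> xs" and le: "\<Lambda> \<le> \<Lambda>'" and L: "1 \<le> L"
  shows "stable_sample L \<Lambda>' xs"
  unfolding stable_sample_def
proof (intro conjI allI impI ballI)
  show "\<epsilon> / 2 * (\<Sum>i<m. (v i)\<^sup>2) \<le> (\<Sum>i<m. \<Sum>j<m. v i * sampled_gram L xs i j * v j)" for v
    using st unfolding stable_sample_def by blast
  fix \<beta> d \<delta> x
  assume \<beta>: "\<forall>i<m. (\<Sum>j<m. sampled_gram L xs i j * \<beta> j) = (\<Sum>l=1..L. d l * \<psi> (Suc i) (xs l)) / real L"
    and d: "\<forall>l\<in>{1..L}. \<bar>d l\<bar> \<le> \<delta>" and x: "x \<in> X"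
  have "\<bar>d 1\<bar> \<le> \<delta>" using d L by simp
  then have \<delta>: "0 \<le> \<delta>" by (rule order.trans[OF abs_ge_zero])
  have "\<bar>basis_sum \<psi> m \<beta> x\<bar> \<le> \<Lambda> * \<delta>" using st \<beta> d x unfolding stable_sample_def by blast
  also have "\<dots> \<le> \<Lambda>' * \<delta>" using le \<delta> by (rule mult_right_mono)
  finally show "\<bar>basis_sum \<psi> m \<beta> x\<bar> \<le> \<Lambda>' * \<delta>" .
qed

text \<open>
  Regression reproduces the near-best approximation \<open>\<gamma>\<close> of \<open>v\<close>, so only the differences
  \<open>y l - basis_comb \<psi> m \<gamma> (xs l)\<close>, of size at most \<open>D + \<Delta>\<close>, are amplified by \<open>\<Lambda>\<close>.
\<close>

lemma regression_step:
  assumes st: "stable_sample L \<Lambda> xs" and L: "1 \<le> L" and xs: "\<And>l. l \<in> {1..L} \<Longrightarrow> xs l \<in> X"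
    and y: "\<And>l. l \<in> {1..L} \<Longrightarrow> \<bar>y l - v (xs l)\<bar> \<le> D"
    and \<gamma>: "\<gamma> \<in> carrier_vec m" "\<And>x. x \<in> X \<Longrightarrow> \<bar>v x - basis_comb \<psi> m \<gamma> x\<bar> \<le> \<Delta>"
    and \<beta>: "\<beta> \<in> carrier_vec m"
    and normal: "\<And>B. B \<in> carrier_mat m m \<Longrightarrow> inverts_mat (sample_gram \<psi> m L xs) B \<Longrightarrow>
      inverts_mat B (sample_gram \<psi> m L xs) \<Longrightarrow> \<beta> = mult_mat_vec B (sample_cross \<psi> m L xs y)"
    and x: "x \<in> X"
  shows "\<bar>basis_comb \<psi> m \<beta> x - v x\<bar> \<le> \<Delta> + \<Lambda> * (D + \<Delta>)"
proof -
  let ?G = "sample_gram \<psi> m L xs" and ?r = "sample_cross \<psi> m L xs y"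
  let ?b = "Matrix.vec_index \<beta>" and ?g = "Matrix.vec_index \<gamma>"
  have G: "?G = Matrix.mat m m (\<lambda>(i, j). sampled_gram L xs i j)"
    unfolding sample_gram_def sampled_gram_def ..
  obtain B where B: "B \<in> carrier_mat m m" "inverts_mat ?G B" "inverts_mat B ?G"
    unfolding G
  proof (rule positive_definite_invertible)
    fix w :: "nat \<Rightarrow> real" assume "\<exists>i<m. w i \<noteq> 0"
    then obtain i where i: "i < m" "w i \<noteq> 0" by blast
    have "0 < (w i)\<^sup>2" using i by simp
    also have "\<dots> \<le> (\<Sum>i<m. (w i)\<^sup>2)" using i by (intro member_le_sum) auto
    finally have "0 < \<epsilon> / 2 * (\<Sum>i<m. (w i)\<^sup>2)" using eps_pos by simp
    also have "\<dots> \<le> (\<Sum>i<m. \<Sum>j<m. w i * sampled_gram L xs i j * w j)"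
      using st unfolding stable_sample_def by blast
    finally show "0 < (\<Sum>i<m. \<Sum>j<m. w i * sampled_gram L xs i j * w j)" .
  qed
  have r: "?r \<in> carrier_vec m" by (simp add: sample_cross_def)
  have Gc: "?G \<in> carrier_mat m m" by (simp add: sample_gram_def)
  have "?G *\<^sub>v \<beta> = (?G * B) *\<^sub>v ?r"
    unfolding normal[OF B] by (rule assoc_mult_mat_vec[symmetric, OF Gc B(1) r])
  also have "?G * B = 1\<^sub>m m" using B(2) Gc by (simp add: inverts_mat_def)
  also have "1\<^sub>m m *\<^sub>v ?r = ?r" using r by simp
  finally have eq: "?G *\<^sub>v \<beta> = ?r" .
  have fit: "(\<Sum>j<m. sampled_gram L xs i j * ?b j) = (\<Sum>l=1..L. y l * \<psi> (Suc i) (xs l)) / real L"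
    if i: "i < m" for i
  proof -
    have "(\<Sum>j<m. sampled_gram L xs i j * ?b j) = Matrix.vec_index (?G *\<^sub>v \<beta>) i"
      using i \<beta> by (auto simp: G scalar_prod_def lessThan_atLeast0 intro!: sum.cong)
    then show ?thesis using eq i by (simp add: sample_cross_def)
  qed
  have reproduce: "(\<Sum>j<m. sampled_gram L xs i j * ?g j)
      = (\<Sum>l=1..L. basis_sum \<psi> m ?g (xs l) * \<psi> (Suc i) (xs l)) / real L" for i
  proof -
    have "(\<Sum>j<m. sampled_gram L xs i j * ?g j)
        = (\<Sum>j<m. \<Sum>l=1..L. \<psi> (Suc i) (xs l) * \<psi> (Suc j) (xs l) * ?g j) / real L"
      by (simp add: sampled_gram_def sum_divide_distrib sum_distrib_right)
    also have "\<dots> = (\<Sum>l=1..L. \<Sum>j<m. \<psi> (Suc i) (xs l) * \<psi> (Suc j) (xs l) * ?g j) / real L"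
      by (subst sum.swap) (rule refl)
    also have "\<dots> = (\<Sum>l=1..L. basis_sum \<psi> m ?g (xs l) * \<psi> (Suc i) (xs l)) / real L"
      by (simp add: basis_sum_def sum_distrib_right sum_distrib_left mult_ac)
    finally show ?thesis .
  qed
  have res: "\<forall>i<m. (\<Sum>j<m. sampled_gram L xs i j * (?b j - ?g j))
      = (\<Sum>l=1..L. (y l - basis_sum \<psi> m ?g (xs l)) * \<psi> (Suc i) (xs l)) / real L"
    using fit reproduce
    by (simp add: right_diff_distrib left_diff_distrib sum_subtractf diff_divide_distrib)
  have d: "\<forall>l\<in>{1..L}. \<bar>y l - basis_sum \<psi> m ?g (xs l)\<bar> \<le> D + \<Delta>"
  proof
    fix l assume l: "l \<in> {1..L}"
    show "\<bar>y l - basis_sum \<psi> m ?g (xs l)\<bar> \<le> D + \<Delta>"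
      using y[OF l] \<gamma>(2)[OF xs[OF l]] unfolding basis_comb_eq_basis_sum[OF \<gamma>(1)] by linarith
  qed
  have "\<bar>basis_sum \<psi> m (\<lambda>j. ?b j - ?g j) x\<bar> \<le> \<Lambda> * (D + \<Delta>)"
    by (rule conjunct2[OF st[unfolded stable_sample_def], THEN spec, THEN spec, THEN spec, THEN mp,
          OF res, THEN mp, OF d, THEN bspec, OF x])
  moreover have "basis_sum \<psi> m (\<lambda>j. ?b j - ?g j) x = basis_comb \<psi> m \<beta> x - basis_comb \<psi> m \<gamma> x"
    unfolding basis_comb_eq_basis_sum[OF \<beta>] basis_comb_eq_basis_sum[OF \<gamma>(1)]
    by (simp add: basis_sum_def left_diff_distrib sum_subtractf)
  ultimately show ?thesis using \<gamma>(2)[OF x] by linarith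
qed

end

lemma (in prob_space) indep_sets_reindex:
  assumes indep: "indep_sets F I" and h: "inj_on h J" "h ` J \<subseteq> I"
  shows "indep_sets (\<lambda>j. F (h j)) J"
proof (rule indep_setsI)
  show "F (h j) \<subseteq> events" if "j \<in> J" for j
    using indep h(2) that unfolding indep_sets_def by blast
  fix A K assume K: "K \<noteq> {}" "K \<subseteq> J" "finite K" and A: "\<forall>j\<in>K. A j \<in> F (h j)"
  have inj: "inj_on h K" using h(1) K(2) by (rule inj_on_subset)
  define A' where "A' i = A (the_inv_into K h i)" for i
  have A': "A' (h j) = A j" if "j \<in> K" for j
    unfolding A'_def using the_inv_into_f_f[OF inj that] by simp
  have "h ` K \<subseteq> I" using h(2) K(2) by blast
  then have "prob (\<Inter>i\<in>h ` K. A' i) = (\<Prod>i\<in>h ` K. prob (A' i))"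
    using K A A' by (intro indep_setsD[OF indep]) auto
  then show "prob (\<Inter>j\<in>K. A j) = (\<Prod>j\<in>K. prob (A j))"
    using A' by (simp add: prod.reindex[OF inj])
qed

lemma (in ddp_run) states_indep:
  assumes t: "t \<in> {1..T}"
  shows "indep_vars (\<lambda>_. borel) (S t) {1..L}"
proof -
  let ?F = "case_sum (\<lambda>(t, l). sets (vimage_algebra (space Q) (S t l) borel))
                (\<lambda>(k, t, l, s). sets (vimage_algebra (space Q) (Z k t l s) borel))"
  have "indep_sets (\<lambda>l. ?F (Inl (t, l))) {1..L}"
    by (rule indep_sets_reindex[OF samples_indep]) (use t in \<open>auto simp: inj_on_def\<close>)
  then have "indep_sets (\<lambda>l. {S t l -` A \<inter> space Q | A. A \<in> sets borel}) {1..L}"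
    by (simp add: sets_vimage_algebra2)
  then show ?thesis unfolding indep_vars_def2 using states_sampled[OF t] by blast
qed

section \<open>Dual values of approximate value functions\<close>

context stochastic_dp
begin

lemma noise_measurable: "s < T \<Longrightarrow> \<xi> s \<in> borel_measurable P"
  using noise_indep by (auto simp: indep_vars_def2)

lemma next_state_measurable:
  assumes "s < T" "y \<in> X" "a \<in> A s"
  shows "(\<lambda>\<omega>. f s y a (\<xi> s \<omega>)) \<in> measurable P (restrict_space borel X)"
proof -
  have "(\<lambda>\<omega>. (y, a, \<xi> s \<omega>)) \<in> measurable P (restrict_space borel (X \<times> A s \<times> UNIV))"
    using noise_measurable[OF assms(1)] assms by (intro measurable_restrict_space2) auto
  from measurable_compose[OF this transition_meas[OF assms(1)]]
  have "(\<lambda>\<omega>. f s y a (\<xi> s \<omega>)) \<in> borel_measurable P" by simp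
  then show ?thesis using transition_in[OF assms] by (intro measurable_restrict_space2) auto
qed

lemma integrable_next_value:
  fixes g :: "real ^ 'n \<Rightarrow> real" and B :: real
  assumes "s < T" "y \<in> X" "a \<in> A s"
    and "g \<in> borel_measurable (restrict_space borel X)" "\<And>x. x \<in> X \<Longrightarrow> \<bar>g x\<bar> \<le> B"
  shows "integrable P (\<lambda>\<omega>. g (f s y a (\<xi> s \<omega>)))"
  by (rule integrable_const_bound[where B = B])
    (use measurable_compose[OF next_state_measurable[OF assms(1-3)] assms(4)]
      assms(5) transition_in[OF assms(1-3)] in auto)

lemma state_path_in:
  assumes "x \<in> X" "\<And>s. s \<in> {t..<T} \<Longrightarrow> a s \<in> A s" "s \<le> T"
  shows "state_path f t x a z s \<in> X"
  using assms(3) by (induction s) (use assms(1,2) transition_in in auto)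

lemma dual_objective_eq:
  "path_cost T f r rT t x a z + penalty P T \<xi> f r W t x a z
    = (\<Sum>s\<in>{t..<T}. (\<integral>\<omega>. r s (state_path f t x a z s) (a s) (\<xi> s \<omega>)
          + W (Suc s) (f s (state_path f t x a z s) (a s) (\<xi> s \<omega>)) \<partial>P)
        - W (Suc s) (state_path f t x a z (Suc s))) + rT (state_path f t x a z T)"
proof -
  let ?y = "state_path f t x a z"
  let ?I = "\<lambda>s. \<integral>\<omega>. r s (?y s) (a s) (\<xi> s \<omega>) + W (Suc s) (f s (?y s) (a s) (\<xi> s \<omega>)) \<partial>P"
  have "(\<Sum>s\<in>{t..<T}. r s (?y s) (a s) (z s))
      + (\<Sum>s\<in>{t..<T}. ?I s - (r s (?y s) (a s) (z s) + W (Suc s) (f s (?y s) (a s) (z s))))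
    = (\<Sum>s\<in>{t..<T}. ?I s - W (Suc s) (?y (Suc s)))"
    unfolding sum.distrib[symmetric] by (rule sum.cong) auto
  then show ?thesis unfolding path_cost_def penalty_def Let_def by linarith
qed

end

text \<open>
  With \<open>\<Phi>\<close> the dual objective, comparing \<open>W\<close> with \<open>V\<close> costs \<open>2 e (s + 1)\<close> in the summand of
  time \<open>s\<close>: once in the conditional expectation, once in the realised next state.  After that
  the Bellman equation makes the sum telescope: from below for every action sequence, and from
  above up to \<open>\<delta>\<close> per step for the sequence that follows near-optimal feedback actions along
  the given noise path.
\<close>

lemma dual_value_error:
  fixes P :: "'w measure" and A :: "nat \<Rightarrow> (real ^ 'm) set"
    and f :: "nat \<Rightarrow> real ^ 'n \<Rightarrow> real ^ 'm \<Rightarrow> real ^ 'd \<Rightarrow> real ^ 'n"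
  assumes "stochastic_dp P T X A \<xi> f r rT"
    and V_meas: "\<And>t. t \<le> T \<Longrightarrow> V t \<in> borel_measurable (restrict_space borel X)"
    and V_terminal: "\<And>x. x \<in> X \<Longrightarrow> V T x = rT x"
    and V_bellman: "\<And>t x. t < T \<Longrightarrow> x \<in> X \<Longrightarrow>
      ereal (V t x) =
        (INF a\<in>A t. ereal (\<integral>\<omega>. r t x a (\<xi> t \<omega>) + V (Suc t) (f t x a (\<xi> t \<omega>)) \<partial>P))"
    and V_bounded: "\<And>t. t \<le> T \<Longrightarrow> bounded (V t ` X)"
    and t: "t \<le> T" and x: "x \<in> X"
    and W_meas: "\<And>s. s \<in> {Suc t..T} \<Longrightarrow> W s \<in> borel_measurable borel"
    and W_close: "\<And>s x. s \<in> {Suc t..T} \<Longrightarrow> x \<in> X \<Longrightarrow> \<bar>W s x - V s x\<bar> \<le> e s"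
  shows "\<bar>dual_value P T A \<xi> f r rT W t x z - V t x\<bar> \<le> 2 * (\<Sum>s\<in>{Suc t..T}. e s)"
proof -
  interpret stochastic_dp P T X A \<xi> f r rT by fact
  define IV where "IV s y a = (\<integral>\<omega>. r s y a (\<xi> s \<omega>) + V (Suc s) (f s y a (\<xi> s \<omega>)) \<partial>P)" for s y a
  define IW where "IW s y a = (\<integral>\<omega>. r s y a (\<xi> s \<omega>) + W (Suc s) (f s y a (\<xi> s \<omega>)) \<partial>P)" for s y a
  define E where "E = (\<Sum>s\<in>{Suc t..T}. e s)"
  have E: "(\<Sum>s\<in>{t..<T}. e (Suc s)) = E" unfolding E_def
    by (simp add: sum.shift_bounds_Suc_ivl[symmetric] atLeastLessThanSuc_atLeastAtMost)
  have I_close: "\<bar>IW s y a - IV s y a\<bar> \<le> e (Suc s)" if s: "s \<in> {t..<T}" and y: "y \<in> X" and a: "a \<in> A s"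
    for s y a
  proof -
    have sT: "s < T" and s': "Suc s \<in> {Suc t..T}" using s by auto
    obtain B where B: "\<And>x. x \<in> X \<Longrightarrow> \<bar>V (Suc s) x\<bar> \<le> B"
      using V_bounded[of "Suc s"] sT by (auto simp: bounded_iff)
    have iV: "integrable P (\<lambda>\<omega>. V (Suc s) (f s y a (\<xi> s \<omega>)))"
      using V_meas[of "Suc s"] sT by (intro integrable_next_value[OF sT y a _ B]) auto
    have iW: "integrable P (\<lambda>\<omega>. W (Suc s) (f s y a (\<xi> s \<omega>)))"
    proof (rule integrable_next_value[OF sT y a])
      show "W (Suc s) \<in> borel_measurable (restrict_space borel X)"
        using W_meas[OF s'] by (rule measurable_restrict_space1)
      show "\<bar>W (Suc s) x\<bar> \<le> B + e (Suc s)" if "x \<in> X" for x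
        using B[OF that] W_close[OF s' that] by linarith
    qed
    have ir: "integrable P (\<lambda>\<omega>. r s y a (\<xi> s \<omega>))" by (rule cost_integrable[OF sT y a])
    have "IW s y a - IV s y a = (\<integral>\<omega>. W (Suc s) (f s y a (\<xi> s \<omega>)) - V (Suc s) (f s y a (\<xi> s \<omega>)) \<partial>P)"
      unfolding IW_def IV_def using iV iW ir by simp
    also have "\<bar>\<dots>\<bar> \<le> (\<integral>\<omega>. \<bar>W (Suc s) (f s y a (\<xi> s \<omega>)) - V (Suc s) (f s y a (\<xi> s \<omega>))\<bar> \<partial>P)"
      by (rule integral_abs_bound)
    also have "\<dots> \<le> (\<integral>\<omega>. e (Suc s) \<partial>P)"
      using iV iW W_close[OF s'] transition_in[OF sT y a] by (intro integral_mono) auto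
    finally show ?thesis by (simp add: prob_space)
  qed
  have bellman_le: "V s y \<le> IV s y a" if "s < T" "y \<in> X" "a \<in> A s" for s y a
  proof -
    have "ereal (V s y) \<le> ereal (IV s y a)"
      unfolding V_bellman[OF that(1,2)] IV_def using that(3) by (rule INF_lower)
    then show ?thesis by simp
  qed
  have bellman_near: "\<exists>a\<in>A s. IV s y a \<le> V s y + \<delta>" if "s < T" "y \<in> X" "0 < \<delta>" for s y \<delta>
  proof (rule ccontr)
    assume "\<not> ?thesis"
    then have "ereal (V s y + \<delta>) \<le> (INF a\<in>A s. ereal (IV s y a))"
      by (intro INF_greatest) (auto simp: not_le less_imp_le)
    then show False using V_bellman[OF that(1,2)] that(3) unfolding IV_def[symmetric]
      by (metis ereal_less_eq(3) add_le_same_cancel1 not_le)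
  qed
  define \<Phi> where "\<Phi> a = path_cost T f r rT t x a z + penalty P T \<xi> f r W t x a z" for a
  have \<Phi>: "\<Phi> a = (\<Sum>s\<in>{t..<T}. IW s (state_path f t x a z s) (a s)
      - W (Suc s) (state_path f t x a z (Suc s))) + V T (state_path f t x a z T)"
    if a: "\<And>s. s \<in> {t..<T} \<Longrightarrow> a s \<in> A s" for a
    unfolding \<Phi>_def dual_objective_eq IW_def
    using V_terminal[OF state_path_in[OF x a order.refl]] by simp
  have tele: "(\<Sum>s\<in>{t..<T}. V s (y s) - V (Suc s) (y (Suc s))) + V T (y T) = V t (y t)" for y
    using sum_Suc_diff'[OF t, of "\<lambda>s. - V s (y s)"] by simp
  have start: "state_path f t x a z t = x" for a by (cases t) auto
  have lower: "V t x - 2 * E \<le> \<Phi> a" if a: "\<And>s. s \<in> {t..<T} \<Longrightarrow> a s \<in> A s" for a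
  proof -
    let ?y = "state_path f t x a z"
    have yX: "?y u \<in> X" if "u \<le> T" for u using x a that by (rule state_path_in)
    have "(\<Sum>s\<in>{t..<T}. V s (?y s) - V (Suc s) (?y (Suc s)) - 2 * e (Suc s))
        \<le> (\<Sum>s\<in>{t..<T}. IW s (?y s) (a s) - W (Suc s) (?y (Suc s)))"
    proof (rule sum_mono)
      fix s assume s: "s \<in> {t..<T}"
      have y: "?y s \<in> X" "?y (Suc s) \<in> X" using s by (auto intro!: yX simp del: state_path.simps)
      show "V s (?y s) - V (Suc s) (?y (Suc s)) - 2 * e (Suc s) \<le> IW s (?y s) (a s) - W (Suc s) (?y (Suc s))"
        using I_close[OF s y(1) a[OF s]] bellman_le[OF _ y(1) a[OF s]] W_close[OF _ y(2), of "Suc s"] s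
        by (simp add: abs_le_iff)
    qed
    moreover have "\<Phi> a = (\<Sum>s\<in>{t..<T}. IW s (?y s) (a s) - W (Suc s) (?y (Suc s))) + V T (?y T)"
      by (rule \<Phi>) (rule a)
    ultimately show ?thesis unfolding sum_subtractf[of _ "\<lambda>s. 2 * e (Suc s)"]
      using tele[of ?y] E start
      by (simp add: sum_distrib_left[symmetric] del: state_path.simps)
  qed
  have lower': "V t x - 2 * E \<le> \<Phi> a" if "a \<in> (\<Pi>\<^sub>E s\<in>{t..<T}. A s)" for a
    by (rule lower) (rule PiE_mem[OF that])
  have upper: "\<exists>a\<in>(\<Pi>\<^sub>E s\<in>{t..<T}. A s). \<Phi> a \<le> V t x + 2 * E + real T * \<delta>" if \<delta>: "0 < \<delta>" for \<delta> :: real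
  proof -
    define c where "c s y = (SOME a. a \<in> A s \<and> IV s y a \<le> V s y + \<delta>)" for s y
    have c: "c s y \<in> A s" "IV s y (c s y) \<le> V s y + \<delta>" if "s < T" "y \<in> X" for s y
      using someI_ex[of "\<lambda>a. a \<in> A s \<and> IV s y a \<le> V s y + \<delta>"] bellman_near[OF that \<delta>]
      unfolding c_def by blast+
    define y where "y = state_path (\<lambda>s x (_::unit) z. f s x (c s x) z) t x (\<lambda>_. ()) z"
    define a where "a = (\<lambda>s\<in>{t..<T}. c s (y s))"
    have yX: "y s \<in> X" if "s \<le> T" for s
      using that by (induction s) (use x c transition_in in \<open>auto simp: y_def\<close>)
    have a: "a s \<in> A s" if "s \<in> {t..<T}" for s using that c yX by (auto simp: a_def)
    have path: "state_path f t x a z s = y s" if "s \<le> T" for s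
      using that by (induction s) (auto simp: y_def a_def)
    have "(\<Sum>s\<in>{t..<T}. IW s (y s) (a s) - W (Suc s) (y (Suc s)))
        \<le> (\<Sum>s\<in>{t..<T}. V s (y s) - V (Suc s) (y (Suc s)) + (2 * e (Suc s) + \<delta>))"
    proof (rule sum_mono)
      fix s assume s: "s \<in> {t..<T}"
      have y: "y s \<in> X" "y (Suc s) \<in> X" using yX s by auto
      have "IV s (y s) (a s) \<le> V s (y s) + \<delta>" using c(2)[OF _ y(1)] s by (simp add: a_def)
      then show "IW s (y s) (a s) - W (Suc s) (y (Suc s)) \<le> V s (y s) - V (Suc s) (y (Suc s)) + (2 * e (Suc s) + \<delta>)"
        using I_close[OF s y(1) a[OF s]] W_close[OF _ y(2), of "Suc s"] s
        by (simp add: abs_le_iff)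
    qed
    moreover have "(\<Sum>s\<in>{t..<T}. IW s (state_path f t x a z s) (a s) - W (Suc s) (state_path f t x a z (Suc s)))
        = (\<Sum>s\<in>{t..<T}. IW s (y s) (a s) - W (Suc s) (y (Suc s)))"
      by (rule sum.cong) (auto simp: path simp del: state_path.simps)
    moreover have "(\<Sum>s\<in>{t..<T}. 2 * e (Suc s) + \<delta>) \<le> 2 * E + real T * \<delta>"
      using \<delta> t E by (simp add: sum.distrib sum_distrib_left[symmetric] of_nat_diff mult_right_mono)
    moreover have "\<Phi> a = (\<Sum>s\<in>{t..<T}. IW s (state_path f t x a z s) (a s)
        - W (Suc s) (state_path f t x a z (Suc s))) + V T (state_path f t x a z T)"
      by (rule \<Phi>) (rule a)
    ultimately have "\<Phi> a \<le> V t x + 2 * E + real T * \<delta>"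
      unfolding path[OF order.refl] sum.distrib[of _ "\<lambda>s. 2 * e (Suc s) + \<delta>"]
      using tele[of y] path[OF t] start[of a] by (simp add: sum.distrib del: state_path.simps)
    moreover have "a \<in> (\<Pi>\<^sub>E s\<in>{t..<T}. A s)" using a by (auto simp: a_def)
    ultimately show ?thesis by blast
  qed
  have bdd: "bdd_below (\<Phi> ` (\<Pi>\<^sub>E s\<in>{t..<T}. A s))"
    using lower' by (rule bdd_belowI2)
  have dv: "dual_value P T A \<xi> f r rT W t x z = (INF a\<in>(\<Pi>\<^sub>E s\<in>{t..<T}. A s). \<Phi> a)"
    unfolding dual_value_def \<Phi>_def ..
  have "V t x - 2 * E \<le> (INF a\<in>(\<Pi>\<^sub>E s\<in>{t..<T}. A s). \<Phi> a)"
    using upper[of 1] lower' by (intro cINF_greatest) auto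
  moreover have "(INF a\<in>(\<Pi>\<^sub>E s\<in>{t..<T}. A s). \<Phi> a) \<le> V t x + 2 * E"
  proof (rule field_le_epsilon)
    fix \<eta> :: real assume \<eta>: "0 < \<eta>"
    obtain a where a: "a \<in> (\<Pi>\<^sub>E s\<in>{t..<T}. A s)" "\<Phi> a \<le> V t x + 2 * E + real T * (\<eta> / real T)"
      using upper[of "\<eta> / real T"] \<eta> horizon by auto
    have "(INF a\<in>(\<Pi>\<^sub>E s\<in>{t..<T}. A s). \<Phi> a) \<le> \<Phi> a" by (rule cINF_lower[OF bdd a(1)])
    then show "(INF a\<in>(\<Pi>\<^sub>E s\<in>{t..<T}. A s). \<Phi> a) \<le> V t x + 2 * E + \<eta>"
      using a(2) horizon by simp
  qed
  ultimately show ?thesis unfolding dv E_def[symmetric] by linarith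
qed

section \<open>Propagation of the error through the iterations\<close>

lemma geometric_recursion:
  fixes a b :: real
  assumes "t \<le> T"
  shows "a + b * (\<Sum>s\<in>{Suc t..T}. a * (1 + b) ^ (T - s)) = a * (1 + b) ^ (T - t)"
  using assms
proof (induction "T - t" arbitrary: t)
  case (Suc n)
  then have t: "Suc t \<le> T" and n: "n = T - Suc t" by auto
  have "T - t = Suc (T - Suc t)" using t by simp
  moreover have "(\<Sum>s\<in>{Suc t..T}. a * (1 + b) ^ (T - s))
      = a * (1 + b) ^ (T - Suc t) + (\<Sum>s\<in>{Suc (Suc t)..T}. a * (1 + b) ^ (T - s))"
    using t by (rule sum.atLeast_Suc_atMost)
  ultimately show ?case using Suc(1)[OF n t] by (simp add: algebra_simps)
qed simp

lemma clip_error_le: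
  fixes v y K :: real
  assumes "\<bar>v\<bar> \<le> K"
  shows "\<bar>max (- K) (min K y) - v\<bar> \<le> \<bar>y - v\<bar>" "\<bar>max (- K) (min K y) - v\<bar> \<le> 2 * K"
  using assms by (auto simp: max_def min_def abs_le_iff)

text \<open>
  Iteration \<open>k\<close> is accurate at time \<open>t\<close> once \<open>k > T - t\<close>: at time \<open>T\<close> the targets are exact, and
  each further iteration passes the accuracy on to one earlier time.
\<close>

lemma coefficient_error:
  fixes P :: "'w measure" and Q :: "'v measure" and A :: "nat \<Rightarrow> (real ^ 'm) set"
    and f :: "nat \<Rightarrow> real ^ 'n \<Rightarrow> real ^ 'm \<Rightarrow> real ^ 'd \<Rightarrow> real ^ 'n"
  assumes dp: "stochastic_dp P T X A \<xi> f r rT"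
    and V_meas: "\<And>t. t \<le> T \<Longrightarrow> V t \<in> borel_measurable (restrict_space borel X)"
    and V_terminal: "\<And>x. x \<in> X \<Longrightarrow> V T x = rT x"
    and V_bellman: "\<And>t x. t < T \<Longrightarrow> x \<in> X \<Longrightarrow>
      ereal (V t x) =
        (INF a\<in>A t. ereal (\<integral>\<omega>. r t x a (\<xi> t \<omega>) + V (Suc t) (f t x a (\<xi> t \<omega>)) \<partial>P))"
    and V_bounded: "\<And>t. t \<le> T \<Longrightarrow> bounded (V t ` X)"
    and run: "ddp_run Q P T X A \<xi> f r rT G \<psi> x0 M L S Z \<beta>"
    and basis: "\<And>t. t \<in> {1..T} \<Longrightarrow> regression_basis (G t) X \<psi> M c \<epsilon>"
    and \<omega>: "\<omega> \<in> space Q" and L: "1 \<le> L" and \<Lambda>: "0 \<le> \<Lambda>"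
    and st: "\<And>t. t \<in> {1..T} \<Longrightarrow> regression_basis.stable_sample X \<psi> M \<epsilon> L \<Lambda> (\<lambda>l. S t l \<omega>)"
    and approx: "\<And>t. t \<in> {1..T} \<Longrightarrow> \<exists>\<gamma>\<in>carrier_vec M. \<forall>x\<in>X. \<bar>V t x - basis_comb \<psi> M \<gamma> x\<bar> \<le> \<Delta>"
    and t: "t \<in> {1..T}" and k: "k \<in> {T - t + 1..T + 1}" and x: "x \<in> X"
  shows "\<bar>basis_comb \<psi> M (\<beta> k t \<omega>) x - V t x\<bar> \<le> (1 + \<Lambda>) * \<Delta> * (1 + 2 * \<Lambda>) ^ (T - t)"
  using t k x
proof (induction "T - t" arbitrary: t k x rule: less_induct)
  case less
  interpret ddp_run Q P T X A \<xi> f r rT G \<psi> x0 M L S Z \<beta> by (rule run)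
  interpret B: regression_basis "G t" X \<psi> M c \<epsilon> by (rule basis[OF less.prems(1)])
  have t: "t \<in> {1..T}" and k: "k \<in> {1..T + 1}" using less.prems by auto
  define e where "e s = (1 + \<Lambda>) * \<Delta> * (1 + 2 * \<Lambda>) ^ (T - s)" for s
  let ?W = "\<lambda>s. basis_comb \<psi> M (\<beta> (k - 1) s \<omega>)"
  have carrier: "\<beta> (k - 1) s \<omega> \<in> carrier_vec M" if "s \<in> {Suc t..T}" for s
    using less.prems that by (intro coeff_carrier \<omega>) auto
  have W_meas: "?W s \<in> borel_measurable borel" if "s \<in> {Suc t..T}" for s
    unfolding basis_comb_eq_basis_sum[OF carrier[OF that], abs_def] by (rule B.basis_sum_meas)
  have W_close: "\<bar>?W s y - V s y\<bar> \<le> e s" if s: "s \<in> {Suc t..T}" and y: "y \<in> X" for s y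
    unfolding e_def using less.prems s by (intro less.hyps y) auto
  have SX: "S t l \<omega> \<in> X" if "l \<in> {1..L}" for l
    using states_sampled[OF t that] \<omega> by auto
  have J: "\<bar>dual_sample P T A \<xi> f r rT \<psi> x0 M S Z \<beta> k t l \<omega> - V t (S t l \<omega>)\<bar> \<le> 2 * (\<Sum>s\<in>{Suc t..T}. e s)"
    if l: "l \<in> {1..L}" for l
  proof -
    have "t \<le> T" "t \<noteq> 0" using t by auto
    then show ?thesis unfolding dual_sample_def
      using dual_value_error[OF dp V_meas V_terminal V_bellman V_bounded \<open>t \<le> T\<close> SX[OF l] W_meas W_close]
      by simp
  qed
  obtain \<gamma> where \<gamma>: "\<gamma> \<in> carrier_vec M" "\<And>x. x \<in> X \<Longrightarrow> \<bar>V t x - basis_comb \<psi> M \<gamma> x\<bar> \<le> \<Delta>"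
    using approx[OF t] by blast
  have "\<bar>basis_comb \<psi> M (\<beta> k t \<omega>) x - V t x\<bar> \<le> \<Delta> + \<Lambda> * (2 * (\<Sum>s\<in>{Suc t..T}. e s) + \<Delta>)"
    by (rule B.regression_step[OF st[OF t] L SX J \<gamma> coeff_carrier[OF k t \<omega>] regression[OF k t \<omega>] less.prems(3)])
  also have "\<dots> = (1 + \<Lambda>) * \<Delta> + 2 * \<Lambda> * (\<Sum>s\<in>{Suc t..T}. e s)" by (simp add: algebra_simps)
  also have "\<dots> = (1 + \<Lambda>) * \<Delta> * (1 + 2 * \<Lambda>) ^ (T - t)"
    unfolding e_def using t by (intro geometric_recursion) auto
  finally show ?case .
qed

lemma output_error:
  fixes P :: "'w measure" and Q :: "'v measure" and A :: "nat \<Rightarrow> (real ^ 'm) set"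
    and f :: "nat \<Rightarrow> real ^ 'n \<Rightarrow> real ^ 'm \<Rightarrow> real ^ 'd \<Rightarrow> real ^ 'n"
  assumes dp: "stochastic_dp P T X A \<xi> f r rT"
    and V_meas: "\<And>t. t \<le> T \<Longrightarrow> V t \<in> borel_measurable (restrict_space borel X)"
    and V_terminal: "\<And>x. x \<in> X \<Longrightarrow> V T x = rT x"
    and V_bellman: "\<And>t x. t < T \<Longrightarrow> x \<in> X \<Longrightarrow>
      ereal (V t x) =
        (INF a\<in>A t. ereal (\<integral>\<omega>. r t x a (\<xi> t \<omega>) + V (Suc t) (f t x a (\<xi> t \<omega>)) \<partial>P))"
    and V_bounded: "\<And>t. t \<le> T \<Longrightarrow> bounded (V t ` X)"
    and run: "ddp_run Q P T X A \<xi> f r rT G \<psi> x0 M L S Z \<beta>"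
    and basis: "\<And>t. t \<in> {1..T} \<Longrightarrow> regression_basis (G t) X \<psi> M c \<epsilon>"
    and \<omega>: "\<omega> \<in> space Q" and L: "1 \<le> L" and \<Lambda>: "1 \<le> \<Lambda>"
    and st: "\<And>t. t \<in> {1..T} \<Longrightarrow> regression_basis.stable_sample X \<psi> M \<epsilon> L \<Lambda> (\<lambda>l. S t l \<omega>)"
    and approx: "\<And>t. t \<in> {1..T} \<Longrightarrow> \<exists>\<gamma>\<in>carrier_vec M. \<forall>x\<in>X. \<bar>V t x - basis_comb \<psi> M \<gamma> x\<bar> \<le> \<Delta>"
    and \<Delta>: "0 \<le> \<Delta>" and x0: "x0 \<in> X" and K: "\<bar>V 0 x0\<bar> \<le> K"
  shows "\<bar>ddp_output P T A \<xi> f r rT \<psi> x0 K M L S Z \<beta> \<omega> - V 0 x0\<bar> \<le> (1 + \<Lambda>) * \<Delta> * (1 + 2 * \<Lambda>) ^ T"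
proof -
  interpret D: stochastic_dp P T X A \<xi> f r rT by (rule dp)
  interpret ddp_run Q P T X A \<xi> f r rT G \<psi> x0 M L S Z \<beta> by (rule run)
  interpret B: regression_basis "G 1" X \<psi> M c \<epsilon> by (rule basis) (use D.horizon in simp)
  define e where "e s = (1 + \<Lambda>) * \<Delta> * (1 + 2 * \<Lambda>) ^ (T - s)" for s
  have e0: "0 \<le> e s" for s unfolding e_def using \<Delta> \<Lambda> by simp
  let ?W = "\<lambda>s. basis_comb \<psi> M (\<beta> T s \<omega>)"
  let ?J = "\<lambda>l. dual_sample P T A \<xi> f r rT \<psi> x0 M S Z \<beta> (T + 1) 0 l \<omega>"
  have carrier: "\<beta> T s \<omega> \<in> carrier_vec M" if "s \<in> {Suc 0..T}" for s
    using that by (intro coeff_carrier \<omega>) auto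
  have W_meas: "?W s \<in> borel_measurable borel" if "s \<in> {Suc 0..T}" for s
    unfolding basis_comb_eq_basis_sum[OF carrier[OF that], abs_def] by (rule B.basis_sum_meas)
  have W_close: "\<bar>?W s y - V s y\<bar> \<le> e s" if s: "s \<in> {Suc 0..T}" and y: "y \<in> X" for s y
    unfolding e_def
    using s \<Lambda> by (intro coefficient_error[OF dp V_meas V_terminal V_bellman V_bounded run basis \<omega> L _ st approx _ _ y]) auto
  have J: "\<bar>?J l - V 0 x0\<bar> \<le> 2 * (\<Sum>s\<in>{Suc 0..T}. e s)" for l
    unfolding dual_sample_def
    using dual_value_error[OF dp V_meas V_terminal V_bellman V_bounded _ x0 W_meas W_close] by simp
  have mean: "(\<Sum>l=1..L. ?J l) / L - V 0 x0 = (\<Sum>l=1..L. ?J l - V 0 x0) / L"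
    using L by (simp add: sum_subtractf diff_divide_distrib)
  have "\<bar>(\<Sum>l=1..L. ?J l) / L - V 0 x0\<bar> \<le> (\<Sum>l=1..L. 2 * (\<Sum>s\<in>{Suc 0..T}. e s)) / L"
    unfolding mean abs_divide abs_of_nat
    by (rule divide_right_mono[OF order.trans[OF sum_abs sum_mono[OF J]]]) simp
  also have "\<dots> = 2 * (\<Sum>s\<in>{Suc 0..T}. e s)" using L by simp
  also have "\<dots> \<le> 2 * \<Lambda> * (\<Sum>s\<in>{Suc 0..T}. e s)"
    using \<Lambda> e0 by (intro mult_right_mono sum_nonneg) auto
  also have "\<dots> \<le> (1 + \<Lambda>) * \<Delta> + 2 * \<Lambda> * (\<Sum>s\<in>{Suc 0..T}. e s)" using \<Delta> \<Lambda> by simp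
  also have "\<dots> = (1 + \<Lambda>) * \<Delta> * (1 + 2 * \<Lambda>) ^ (T - 0)"
    unfolding e_def by (rule geometric_recursion) simp
  finally have "\<bar>(\<Sum>l=1..L. ?J l) / L - V 0 x0\<bar> \<le> (1 + \<Lambda>) * \<Delta> * (1 + 2 * \<Lambda>) ^ T" by simp
  then show ?thesis unfolding ddp_output_def
    using clip_error_le(1)[OF K] by (rule order.trans[rotated])
qed

section \<open>The error bound\<close>

text \<open>
  The two failure probabilities with the tolerances \<open>\<epsilon> \<eta> / (2 M)\<close> for the Gram error and
  \<open>\<eta>\<close> for the deviation, and with the bounds \<open>C0 * M\<close> for both the length of the basis
  vector and its second moment.  The choice \<open>L = M ^ 6 / \<eta> ^ 4\<close> is the definition of \<open>\<eta>\<close> solved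
  for the sample size.
\<close>

lemma gram_failure_rate:
  fixes C0 \<epsilon> \<eta> M L :: real
  assumes "0 \<le> C0" "0 < \<epsilon>" "0 < \<eta>" "\<eta> \<le> 1" "1 \<le> M" and L: "L = M ^ 6 / \<eta> ^ 4"
  shows "(C0 * M)\<^sup>2 * (C0 * M) / (L * (\<epsilon> * \<eta> / (2 * M))\<^sup>2) \<le> 4 * C0 ^ 3 / \<epsilon>\<^sup>2 * \<eta>"
proof -
  have "(C0 * M)\<^sup>2 * (C0 * M) / (L * (\<epsilon> * \<eta> / (2 * M))\<^sup>2) = 4 * C0 ^ 3 / \<epsilon>\<^sup>2 * (\<eta>\<^sup>2 / M)"
    using assms by (simp add: L field_simps power2_eq_square power3_eq_cube eval_nat_numeral)
  also have "\<dots> \<le> 4 * C0 ^ 3 / \<epsilon>\<^sup>2 * \<eta>"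
  proof (rule mult_left_mono)
    have "\<eta>\<^sup>2 / M \<le> \<eta>\<^sup>2 / 1" using assms by (intro divide_left_mono) auto
    also have "\<dots> \<le> \<eta>" using assms by (simp add: power2_eq_square mult_left_le)
    finally show "\<eta>\<^sup>2 / M \<le> \<eta>" .
  qed (use assms in simp)
  finally show ?thesis .
qed

lemma deviation_failure_rate:
  fixes C0 \<epsilon> \<eta> M L :: real
  assumes "0 \<le> C0" "0 < \<epsilon>" "0 < \<eta>" "1 \<le> M" and L: "L = M ^ 6 / \<eta> ^ 4"
  shows "2 * (C0 * M / \<epsilon> * sqrt M) * sqrt (C0 * M / L) / \<eta> \<le> 2 * C0 * sqrt C0 / \<epsilon> * \<eta>"
proof -
  have "C0 * M / L = C0 * M * (\<eta>\<^sup>2 / M ^ 3)\<^sup>2"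
    using assms by (simp add: L power_divide flip: power_mult)
  then have "sqrt (C0 * M / L) = sqrt C0 * sqrt M * (\<eta>\<^sup>2 / M ^ 3)"
    using assms by (simp add: real_sqrt_mult)
  then have "2 * (C0 * M / \<epsilon> * sqrt M) * sqrt (C0 * M / L) / \<eta>
      = 2 * C0 * sqrt C0 / \<epsilon> * (sqrt M * sqrt M * M * \<eta>\<^sup>2 / (M ^ 3 * \<eta>))"
    by (simp add: field_simps)
  also have "sqrt M * sqrt M * M * \<eta>\<^sup>2 / (M ^ 3 * \<eta>) = \<eta> / M"
    using assms by (simp add: power2_eq_square power3_eq_cube)
  also have "2 * C0 * sqrt C0 / \<epsilon> * (\<eta> / M) \<le> 2 * C0 * sqrt C0 / \<epsilon> * \<eta>"
  proof (rule mult_left_mono)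
    show "\<eta> / M \<le> \<eta>" using assms by (simp add: divide_le_eq mult_left_le)
  qed (use assms in simp)
  finally show ?thesis .
qed

lemma approx_error_nonneg_le:
  assumes X: "X \<noteq> {}" and V: "\<And>t x. t \<le> T \<Longrightarrow> x \<in> X \<Longrightarrow> \<bar>V t x\<bar> \<le> B"
    and psi: "\<And>\<gamma>. \<gamma> \<in> carrier_vec M \<Longrightarrow> \<exists>b. \<forall>x\<in>X. \<bar>basis_comb \<psi> M \<gamma> x\<bar> \<le> b"
  shows "0 \<le> approx_error \<psi> X T V M" and "approx_error \<psi> X T V M \<le> B"
    and "t \<le> T \<Longrightarrow> approx_error \<psi> X T V M < \<Delta> \<Longrightarrow>
      \<exists>\<gamma>\<in>carrier_vec M. \<forall>x\<in>X. \<bar>V t x - basis_comb \<psi> M \<gamma> x\<bar> \<le> \<Delta>"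
proof -
  define E where "E t \<gamma> = sup_norm X (\<lambda>x. V t x - basis_comb \<psi> M \<gamma> x)" for t \<gamma>
  define e where "e t = (INF \<gamma>\<in>carrier_vec M. E t \<gamma>)" for t
  have ae: "approx_error \<psi> X T V M = (MAX t\<in>{0..T}. e t)"
    unfolding approx_error_def e_def E_def ..
  have bdd: "bdd_above ((\<lambda>x. \<bar>V t x - basis_comb \<psi> M \<gamma> x\<bar>) ` X)" if t: "t \<le> T" and \<gamma>: "\<gamma> \<in> carrier_vec M" for t \<gamma>
  proof -
    obtain b where b: "\<forall>x\<in>X. \<bar>basis_comb \<psi> M \<gamma> x\<bar> \<le> b" using psi[OF \<gamma>] by blast
    show ?thesis
    proof (rule bdd_aboveI2)
      fix x assume "x \<in> X"
      then show "\<bar>V t x - basis_comb \<psi> M \<gamma> x\<bar> \<le> B + b" using V[OF t] b by (smt (verit))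
    qed
  qed
  have E_ge: "\<bar>V t x - basis_comb \<psi> M \<gamma> x\<bar> \<le> E t \<gamma>" if "t \<le> T" "\<gamma> \<in> carrier_vec M" "x \<in> X" for t \<gamma> x
    unfolding E_def by (rule sup_norm_ge[OF bdd[OF that(1,2)] that(3)])
  obtain x where x: "x \<in> X" using X by blast
  have E0: "0 \<le> E t \<gamma>" if "t \<le> T" "\<gamma> \<in> carrier_vec M" for t \<gamma>
    using E_ge[OF that x] by linarith
  have ne: "(carrier_vec M :: real Matrix.vec set) \<noteq> {}" using zero_carrier_vec by blast
  have e0: "0 \<le> e t" if "t \<le> T" for t
    unfolding e_def using E0[OF that] ne by (intro cINF_greatest)
  have eB: "e t \<le> B" if t: "t \<le> T" for t
  proof -
    have "e t \<le> E t (0\<^sub>v M)"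
      unfolding e_def using E0[OF t] by (intro cINF_lower bdd_belowI2[of _ 0]) auto
    also have "\<dots> \<le> B" unfolding E_def
      using V[OF t] by (intro sup_norm_le[OF X]) (simp add: basis_comb_eq_basis_sum basis_sum_def)
    finally show ?thesis .
  qed
  have "e T \<le> (MAX t\<in>{0..T}. e t)" by (rule Max_ge) auto
  then show "0 \<le> approx_error \<psi> X T V M" unfolding ae using e0[of T] by linarith
  show "approx_error \<psi> X T V M \<le> B" unfolding ae using eB by (intro Max.boundedI) auto
  show "\<exists>\<gamma>\<in>carrier_vec M. \<forall>x\<in>X. \<bar>V t x - basis_comb \<psi> M \<gamma> x\<bar> \<le> \<Delta>"
    if t: "t \<le> T" and \<Delta>: "approx_error \<psi> X T V M < \<Delta>"
  proof -
    have "e t \<le> (MAX t\<in>{0..T}. e t)" using t by (intro Max_ge) auto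
    then have "e t < \<Delta>" using \<Delta> unfolding ae by linarith
    then obtain \<gamma> where "\<gamma> \<in> carrier_vec M" "E t \<gamma> < \<Delta>"
      unfolding e_def using cInf_lessD[of "E t ` carrier_vec M" \<Delta>] ne by auto
    then show ?thesis using E_ge[OF t] by (intro bexI[of _ \<gamma>]) fastforce+
  qed
qed

text \<open>
  Absorbs every error term into one constant \<open>C\<close>: \<open>2 * c1\<close> accounts for the ratio of the geometric
  recursion, the terms in parentheses for its initial value, where the product \<open>c1 * \<eta> * \<Delta>\<close> is a
  multiple of \<open>\<eta>\<close> because the approximation error is bounded, and \<open>q\<close> for the bad event.
\<close>

lemma final_bound:
  fixes l \<eta> \<Delta> B c1 C q :: real
  assumes l: "1 \<le> l" and \<eta>: "0 < \<eta>" "\<eta> \<le> 1" and \<Delta>: "0 \<le> \<Delta>" "\<Delta> \<le> B" and c1: "0 \<le> c1" and q: "0 \<le> q"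
    and C: "2 * c1 + (1 + c1 * B + c1) + q \<le> C"
  shows "(1 + (l + c1 * \<eta>)) * (\<Delta> + \<eta> / (1 + l)) * (1 + 2 * (l + c1 * \<eta>)) ^ T + q * \<eta>
    \<le> (1 + 2 * l + C * \<eta>) ^ T * ((1 + l) * \<Delta> + C * \<eta>)"
proof -
  let ?p = "1 + 2 * l + 2 * c1 * \<eta>"
  have B: "0 \<le> B" using \<Delta> by linarith
  have p1: "1 \<le> ?p ^ T" using l c1 \<eta> by (intro one_le_power) simp
  have "(1 + (l + c1 * \<eta>)) * (\<Delta> + \<eta> / (1 + l)) = (1 + l) * \<Delta> + \<eta> + c1 * \<eta> * \<Delta> + c1 * \<eta> * (\<eta> / (1 + l))"
    using l by (simp add: field_simps)
  also have "c1 * \<eta> * \<Delta> \<le> c1 * \<eta> * B" using c1 \<eta> \<Delta> by (intro mult_left_mono) auto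
  also have "c1 * \<eta> * (\<eta> / (1 + l)) \<le> c1 * \<eta> * 1"
    using c1 \<eta> l by (intro mult_left_mono) auto
  finally have a: "(1 + (l + c1 * \<eta>)) * (\<Delta> + \<eta> / (1 + l)) \<le> (1 + l) * \<Delta> + (1 + c1 * B + c1) * \<eta>"
    by (simp add: algebra_simps)
  have C': "2 * c1 \<le> C" "1 + c1 * B + c1 + q \<le> C" using C c1 B q by (auto intro: order.trans[rotated])
  have "(1 + (l + c1 * \<eta>)) * (\<Delta> + \<eta> / (1 + l)) * (1 + 2 * (l + c1 * \<eta>)) ^ T + q * \<eta>
      \<le> ((1 + l) * \<Delta> + (1 + c1 * B + c1) * \<eta>) * ?p ^ T + q * \<eta> * ?p ^ T"
  proof (rule add_mono)
    show "(1 + (l + c1 * \<eta>)) * (\<Delta> + \<eta> / (1 + l)) * (1 + 2 * (l + c1 * \<eta>)) ^ T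
        \<le> ((1 + l) * \<Delta> + (1 + c1 * B + c1) * \<eta>) * ?p ^ T"
      using mult_right_mono[OF a, of "?p ^ T"] p1 by (simp add: algebra_simps)
    show "q * \<eta> \<le> q * \<eta> * ?p ^ T" using mult_left_mono[OF p1, of "q * \<eta>"] q \<eta> by simp
  qed
  also have "\<dots> = ?p ^ T * ((1 + l) * \<Delta> + (1 + c1 * B + c1 + q) * \<eta>)" by (simp add: algebra_simps)
  also have "\<dots> \<le> (1 + 2 * l + C * \<eta>) ^ T * ((1 + l) * \<Delta> + C * \<eta>)"
  proof (rule mult_mono)
    have "2 * c1 * \<eta> \<le> C * \<eta>" using C'(1) \<eta> by (intro mult_right_mono) auto
    moreover have "0 \<le> 2 * c1 * \<eta>" using c1 \<eta> by simp
    ultimately have "?p \<le> 1 + 2 * l + C * \<eta>" "0 \<le> ?p" "0 \<le> 1 + 2 * l + C * \<eta>"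
      using l by linarith+
    then show "?p ^ T \<le> (1 + 2 * l + C * \<eta>) ^ T" and "0 \<le> (1 + 2 * l + C * \<eta>) ^ T"
      by (simp_all only: power_mono zero_le_power)
    show "(1 + l) * \<Delta> + (1 + c1 * B + c1 + q) * \<eta> \<le> (1 + l) * \<Delta> + C * \<eta>"
      using C'(2) \<eta> by (intro add_left_mono mult_right_mono) auto
    show "0 \<le> (1 + l) * \<Delta> + (1 + c1 * B + c1 + q) * \<eta>"
      using l \<Delta>(1) c1 B q \<eta> by (intro add_nonneg_nonneg mult_nonneg_nonneg) auto
  qed
  finally show ?thesis .
qed

theorem theorem4p5:
  fixes P :: "'w measure"
    and T :: nat
    and X :: "(real ^ 'n) set"
    and A :: "nat \<Rightarrow> (real ^ 'm) set"
    and \<xi> :: "nat \<Rightarrow> 'w \<Rightarrow> real ^ 'd"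
    and f :: "nat \<Rightarrow> real ^ 'n \<Rightarrow> real ^ 'm \<Rightarrow> real ^ 'd \<Rightarrow> real ^ 'n"
    and r :: "nat \<Rightarrow> real ^ 'n \<Rightarrow> real ^ 'm \<Rightarrow> real ^ 'd \<Rightarrow> real"
    and rT :: "real ^ 'n \<Rightarrow> real"
    and V :: "nat \<Rightarrow> real ^ 'n \<Rightarrow> real"
    and G :: "nat \<Rightarrow> (real ^ 'n) measure"
    and F :: "(real ^ 'n) measure"
    and \<psi> :: "nat \<Rightarrow> real ^ 'n \<Rightarrow> real"
    and x0 :: "real ^ 'n"
    and K \<epsilon> D C0 :: real
  assumes dp: "stochastic_dp P T X A \<xi> f r rT"
    and V_def: "\<And>t x. t \<le> T \<Longrightarrow> x \<in> X \<Longrightarrow>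
      ereal (V t x) = optimal_cost_to_go P T A \<xi> f r rT t x"
    and V_meas: "\<And>t. t \<le> T \<Longrightarrow> V t \<in> borel_measurable (restrict_space borel X)"
    and V_terminal: "\<And>x. x \<in> X \<Longrightarrow> V T x = rT x"
    and V_bellman: "\<And>t x. t < T \<Longrightarrow> x \<in> X \<Longrightarrow>
      ereal (V t x) =
        (INF a\<in>A t. ereal (\<integral>\<omega>. r t x a (\<xi> t \<omega>) + V (Suc t) (f t x a (\<xi> t \<omega>)) \<partial>P))"
    and psi_meas: "\<And>m. m \<ge> 1 \<Longrightarrow> \<psi> m \<in> borel_measurable borel"
    and samplers: "\<And>t. t \<in> {1..T} \<Longrightarrow>
      prob_space (G t) \<and> sets (G t) = sets borel \<and> (AE x in G t. x \<in> X)"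
    and x0: "x0 \<in> X"
    and K: "\<bar>V 0 x0\<bar> \<le> K"
    and F_sets: "sets F = sets borel"
    and F_support: "measure_support F = X"
    and F_orthonormal: "\<And>i j. i \<ge> 1 \<Longrightarrow> j \<ge> 1 \<Longrightarrow>
      integrable F (\<lambda>x. \<psi> i x * \<psi> j x) \<and>
      (\<integral>x. \<psi> i x * \<psi> j x \<partial>F) = (if i = j then 1 else 0)"
    and eps_pos: "0 < \<epsilon>" and D_pos: "0 < D"
    and G_density: "\<And>t. t \<in> {1..T} \<Longrightarrow>
      absolutely_continuous F (G t) \<and>
      (\<exists>g. g \<in> borel_measurable F \<and> G t = density F (\<lambda>x. ennreal (g x)) \<and>
           (\<forall>x\<in>X. \<epsilon> < g x \<and> g x < D))"
    and psi_growth: "\<And>M x. M \<ge> 1 \<Longrightarrow> x \<in> X \<Longrightarrow> sqrt (\<Sum>m=1..M. (\<psi> m x)\<^sup>2) \<le> C0 * real M"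
    and psi_moment: "\<And>t m. t \<in> {1..T} \<Longrightarrow> m \<ge> 1 \<Longrightarrow>
      integrable (G t) (\<lambda>x. (\<psi> m x)\<^sup>2) \<and> (\<integral>x. (\<psi> m x)\<^sup>2 \<partial>G t) \<le> C0"
    and V_bounded: "\<And>t. t \<le> T \<Longrightarrow> bounded (V t ` X)"
  shows "\<exists>C>0. \<forall>M\<ge>1. \<forall>L\<ge>1. \<forall>(Q :: 'v measure) S Z \<beta>.
    ddp_run Q P T X A \<xi> f r rT G \<psi> x0 M L S Z \<beta> \<longrightarrow>
    (\<integral>\<omega>. \<bar>ddp_output P T A \<xi> f r rT \<psi> x0 K M L S Z \<beta> \<omega> - V 0 x0\<bar> \<partial>Q)
      \<le> (1 + 2 * lebesgue_constant \<psi> X T G M + C * (real M ^ 6 / real L) powr (1/4)) ^ T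
         * ((1 + lebesgue_constant \<psi> X T G M) * approx_error \<psi> X T V M
            + C * (real M ^ 6 / real L) powr (1/4))"
proof -
  interpret D: stochastic_dp P T X A \<xi> f r rT by (rule dp)
  have X_ne: "X \<noteq> {}" using x0 by auto
  obtain B where B: "\<And>t x. t \<le> T \<Longrightarrow> x \<in> X \<Longrightarrow> \<bar>V t x\<bar> \<le> B"
  proof -
    have "bounded (\<Union>t\<in>{..T}. V t ` X)" using V_bounded by (intro bounded_UN) auto
    then show ?thesis using that unfolding bounded_iff by fastforce
  qed
  have B0: "0 \<le> B" using B[OF _ x0, of 0] by linarith
  have K0: "0 \<le> K" using K by linarith
  have C0: "0 \<le> C0"
  proof -
    have "0 \<le> sqrt (\<Sum>m=1..1. (\<psi> m x0)\<^sup>2)" by simp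
    also have "\<dots> \<le> C0 * real 1" by (rule psi_growth[OF _ x0]) simp
    finally show ?thesis by simp
  qed
  define p where "p = 4 * C0 ^ 3 / \<epsilon>\<^sup>2 + 2 * C0 * sqrt C0 / \<epsilon>"
  define c1 where "c1 = 3 + C0 / 2 * sqrt (2 / \<epsilon>)"
  define q where "q = 2 * K * (T * p)"
  define C where "C = 2 * c1 + (1 + c1 * B + c1) + q + 2 * K"
  have p0: "0 \<le> p" unfolding p_def using C0 eps_pos by simp
  have c10: "0 \<le> c1" unfolding c1_def using C0 eps_pos by simp
  have q0: "0 \<le> q" unfolding q_def using K0 p0 by simp
  have c1B: "0 \<le> c1 * B" using c10 B0 by simp
  have C_pos: "0 < C" unfolding C_def using c10 c1B q0 K0 by linarith
  have C_ge: "2 * c1 + (1 + c1 * B + c1) + q \<le> C" "2 * K \<le> C"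
    unfolding C_def using c10 c1B q0 K0 by linarith+
  have growth: "(\<Sum>i<M. (\<psi> (Suc i) x)\<^sup>2) \<le> (C0 * M)\<^sup>2" if "1 \<le> M" "x \<in> X" for M x
  proof -
    have "sqrt (\<Sum>i<M. (\<psi> (Suc i) x)\<^sup>2) \<le> C0 * M"
      using psi_growth[OF that] by (simp add: sum.atLeast1_atMost_eq)
    then show ?thesis by (rule sqrt_le_D)
  qed
  show ?thesis
  proof (intro exI[of _ C] conjI allI impI C_pos)
    fix M L :: nat and Q :: "'v measure" and S Z \<beta>
    assume M: "1 \<le> M" and L: "1 \<le> L" and run: "ddp_run Q P T X A \<xi> f r rT G \<psi> x0 M L S Z \<beta>"
    interpret R: ddp_run Q P T X A \<xi> f r rT G \<psi> x0 M L S Z \<beta> by (rule run)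
    have basis: "regression_basis (G t) X \<psi> M (C0 * M) \<epsilon>" if t: "t \<in> {1..T}" for t
    proof -
      obtain g where g: "g \<in> borel_measurable F" "G t = density F (\<lambda>x. ennreal (g x))" "\<forall>x\<in>X. \<epsilon> < g x \<and> g x < D"
        using G_density[OF t] by blast
      show ?thesis
        using samplers[OF t] D.compact_states X_ne F_sets F_support psi_meas F_orthonormal eps_pos g growth[OF M] C0
        by (intro regression_basis_of_density[of "G t" X F \<psi> \<epsilon> g]) auto
    qed
    define l where "l = lebesgue_constant \<psi> X T G M"
    define \<Delta> where "\<Delta> = approx_error \<psi> X T V M"
    define \<eta> where "\<eta> = (real M ^ 6 / real L) powr (1/4)"
    let ?out = "ddp_output P T A \<xi> f r rT \<psi> x0 K M L S Z \<beta>"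
    let ?err = "\<lambda>\<omega>. \<bar>?out \<omega> - V 0 x0\<bar>"
    have l_max: "l = (MAX t\<in>{1..T}. Sup (projection_ratios \<psi> X M (G t)))"
      unfolding l_def lebesgue_constant_def projection_ratios_def ..
    have l_ge: "Sup (projection_ratios \<psi> X M (G t)) \<le> l" if "t \<in> {1..T}" for t
      unfolding l_max using that by (intro Max_ge) auto
    have T1: "1 \<in> {1..T}" using D.horizon by simp
    interpret B1: regression_basis "G 1" X \<psi> M "C0 * M" \<epsilon> by (rule basis[OF T1])
    have l1: "1 \<le> l" using B1.one_le_Lebesgue[OF M] l_ge[OF T1] by linarith
    have comb_bound: "\<exists>b. \<forall>x\<in>X. \<bar>basis_comb \<psi> M \<gamma> x\<bar> \<le> b" if "\<gamma> \<in> carrier_vec M" for \<gamma>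
      unfolding basis_comb_eq_basis_sum[OF that] using B1.basis_sum_bound by blast
    note approx = approx_error_nonneg_le[where \<psi> = \<psi> and V = V and T = T and M = M, OF X_ne B comb_bound, folded \<Delta>_def]
    have \<Delta>: "0 \<le> \<Delta>" "\<Delta> \<le> B" by (rule approx(1); simp) (rule approx(2); simp)
    have \<eta>0: "0 < \<eta>" unfolding \<eta>_def using M L by simp
    have \<eta>4: "\<eta> ^ 4 = real M ^ 6 / real L"
    proof -
      have "\<eta> ^ 4 = \<eta> powr real 4" by (rule powr_realpow[OF \<eta>0, symmetric])
      also have "\<dots> = (real M ^ 6 / real L) powr (1 / 4 * real 4)" unfolding \<eta>_def powr_powr ..
      also have "\<dots> = real M ^ 6 / real L" using M L by simp
      finally show ?thesis .
    qed
    have L_eq: "real L = real M ^ 6 / \<eta> ^ 4" unfolding \<eta>4 using M L by simp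
    have err_le: "?err \<omega> \<le> 2 * K" for \<omega>
      unfolding ddp_output_def by (rule clip_error_le(2)[OF K])
    have out_meas[measurable]: "?out \<in> borel_measurable Q"
    proof -
      have [measurable]: "dual_sample P T A \<xi> f r rT \<psi> x0 M S Z \<beta> (T + 1) 0 l \<in> borel_measurable Q" if "l \<in> {1..L}" for l
        using that by (intro R.dual_sample_meas) auto
      show ?thesis unfolding ddp_output_def by measurable
    qed
    have int_err: "integrable Q ?err"
      by (rule R.integrable_const_bound[where B = "2 * K"]) (use err_le in auto)
    have "(\<integral>\<omega>. ?err \<omega> \<partial>Q) \<le> (1 + 2 * l + C * \<eta>) ^ T * ((1 + l) * \<Delta> + C * \<eta>)"
    proof (cases "\<eta> \<le> 1")
      case False
      have "(\<integral>\<omega>. ?err \<omega> \<partial>Q) \<le> (\<integral>\<omega>. 2 * K \<partial>Q)"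
        using int_err err_le by (intro integral_mono) auto
      also have "\<dots> = 2 * K" by (simp add: R.prob_space)
      also have "\<dots> \<le> C * 1" using C_ge by simp
      also have "\<dots> \<le> C * \<eta>" using False C_pos by (intro mult_left_mono) auto
      also have "\<dots> \<le> 1 * ((1 + l) * \<Delta> + C * \<eta>)" using l1 \<Delta> by simp
      also have "\<dots> \<le> (1 + 2 * l + C * \<eta>) ^ T * ((1 + l) * \<Delta> + C * \<eta>)"
        using l1 C_pos \<eta>0 \<Delta> by (intro mult_right_mono one_le_power add_nonneg_nonneg) auto
      finally show ?thesis .
    next
      case \<eta>1: True
      \<comment> \<open>The tolerance \<open>\<kappa>\<close> is divided by \<open>M\<close> to absorb the factor \<open>C0 * M\<close> from the length of the
        representers in the perturbation term.\<close>
      define \<Lambda> where "\<Lambda> = l + c1 * \<eta>"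
      define \<kappa> where "\<kappa> = \<epsilon> * \<eta> / (2 * real M)"
      have \<kappa>: "0 < \<kappa>" "\<kappa> \<le> \<epsilon> / 2"
      proof -
        show "0 < \<kappa>" unfolding \<kappa>_def using eps_pos \<eta>0 M by simp
        have "\<epsilon> * \<eta> \<le> \<epsilon> * real M" using \<eta>1 M eps_pos by (intro mult_left_mono) auto
        then show "\<kappa> \<le> \<epsilon> / 2" unfolding \<kappa>_def using M by (simp add: field_simps)
      qed
      have "\<exists>bad. bad \<in> sets Q \<and> measure Q bad \<le> p * \<eta> \<and>
          (\<forall>\<omega>\<in>space Q - bad. regression_basis.stable_sample X \<psi> M \<epsilon> L \<Lambda> (\<lambda>l. S t l \<omega>))"
        if t: "t \<in> {1..T}" for t
      proof -
        interpret Bt: regression_basis "G t" X \<psi> M "C0 * M" \<epsilon> by (rule basis[OF t])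
        have moment: "(\<integral>x. (\<Sum>i<M. (\<psi> (Suc i) x)\<^sup>2) \<partial>G t) \<le> C0 * M"
        proof -
          have "(\<integral>x. (\<Sum>i<M. (\<psi> (Suc i) x)\<^sup>2) \<partial>G t) = (\<Sum>i<M. (\<integral>x. (\<psi> (Suc i) x)\<^sup>2 \<partial>G t))"
            using psi_moment[OF t] by (intro Bochner_Integration.integral_sum) auto
          also have "\<dots> \<le> (\<Sum>i<M. C0)" using psi_moment[OF t] by (intro sum_mono) auto
          finally show ?thesis by (simp add: mult.commute)
        qed
        have S_dist: "distr Q borel (S t l) = G t" and S_X: "\<omega> \<in> space Q \<Longrightarrow> S t l \<omega> \<in> X"
          if "l \<in> {1..L}" for l \<omega>
          using R.states_sampled[OF t that] by auto
        obtain bad where bad: "bad \<in> sets Q"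
          and prob: "measure Q bad \<le> (C0 * M)\<^sup>2 * (C0 * M) / (L * \<kappa>\<^sup>2)
            + 2 * (C0 * M / \<epsilon> * sqrt M) * sqrt (C0 * M / L) / \<eta>"
          and st: "\<And>\<omega>. \<omega> \<in> space Q - bad \<Longrightarrow> Bt.stable_sample L
            (Sup (projection_ratios \<psi> X M (G t)) + 3 * \<eta> + \<kappa> * (C0 * M / \<epsilon>) * sqrt (2 / \<epsilon>)) (\<lambda>l. S t l \<omega>)"
          using Bt.unstable_sample_event[OF R.prob_space_axioms L R.states_indep[OF t] S_dist S_X moment \<kappa> \<eta>0]
          by auto
        have M': "1 \<le> real M" using M by simp
        have rate1: "(C0 * M)\<^sup>2 * (C0 * M) / (L * \<kappa>\<^sup>2) \<le> 4 * C0 ^ 3 / \<epsilon>\<^sup>2 * \<eta>"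
          unfolding \<kappa>_def by (rule gram_failure_rate[OF C0 eps_pos \<eta>0 \<eta>1 M' L_eq])
        have rate2: "2 * (C0 * M / \<epsilon> * sqrt M) * sqrt (C0 * M / L) / \<eta> \<le> 2 * C0 * sqrt C0 / \<epsilon> * \<eta>"
          by (rule deviation_failure_rate[OF C0 eps_pos \<eta>0 M' L_eq])
        have "measure Q bad \<le> p * \<eta>"
          unfolding p_def distrib_right by (rule order.trans[OF prob add_mono[OF rate1 rate2]])
        moreover have "Sup (projection_ratios \<psi> X M (G t)) + 3 * \<eta> + \<kappa> * (C0 * M / \<epsilon>) * sqrt (2 / \<epsilon>) \<le> \<Lambda>"
        proof -
          have eq: "\<kappa> * (C0 * M / \<epsilon>) = C0 / 2 * \<eta>" unfolding \<kappa>_def using M eps_pos by (simp add: field_simps)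
          show ?thesis unfolding eq \<Lambda>_def c1_def using l_ge[OF t] by (simp add: algebra_simps)
        qed
        ultimately show ?thesis
          using bad by (intro exI[of _ bad] conjI ballI Bt.stable_sample_mono[OF st _ L])
      qed
      then have "\<forall>t\<in>{1..T}. \<exists>bad. bad \<in> sets Q \<and> measure Q bad \<le> p * \<eta> \<and>
          (\<forall>\<omega>\<in>space Q - bad. regression_basis.stable_sample X \<psi> M \<epsilon> L \<Lambda> (\<lambda>l. S t l \<omega>))"
        by (rule ballI)
      from bchoice[OF this] obtain bad where all: "\<forall>t\<in>{1..T}. bad t \<in> sets Q \<and> measure Q (bad t) \<le> p * \<eta> \<and>
          (\<forall>\<omega>\<in>space Q - bad t. regression_basis.stable_sample X \<psi> M \<epsilon> L \<Lambda> (\<lambda>l. S t l \<omega>))"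
        by (rule exE)
      have bad: "bad t \<in> sets Q" and prob: "measure Q (bad t) \<le> p * \<eta>"
        and st: "\<And>\<omega>. \<omega> \<in> space Q - bad t \<Longrightarrow>
          regression_basis.stable_sample X \<psi> M \<epsilon> L \<Lambda> (\<lambda>l. S t l \<omega>)" if "t \<in> {1..T}" for t
        using bspec[OF all that] by simp_all
      define Bad where "Bad = (\<Union>t\<in>{1..T}. bad t)"
      have Bad: "Bad \<in> sets Q" unfolding Bad_def using bad by auto
      have prob_Bad: "measure Q Bad \<le> T * (p * \<eta>)"
      proof -
        have "measure Q Bad \<le> (\<Sum>t\<in>{1..T}. measure Q (bad t))"
          unfolding Bad_def using bad by (intro measure_UNION_le) auto
        also have "\<dots> \<le> (\<Sum>t\<in>{1..T}. p * \<eta>)" using prob by (intro sum_mono)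
        finally show ?thesis by simp
      qed
      have \<Lambda>1: "1 \<le> \<Lambda>" unfolding \<Lambda>_def using l1 c10 \<eta>0 by (simp add: add_increasing2)
      \<comment> \<open>The infimum in the approximation error need not be attained.  The slack \<open>\<eta> / (1 + l)\<close> is small
        enough to contribute only a multiple of \<open>\<eta>\<close> after multiplication by \<open>1 + \<Lambda>\<close>.\<close>
      define a where "a = (1 + \<Lambda>) * (\<Delta> + \<eta> / (1 + l)) * (1 + 2 * \<Lambda>) ^ T"
      have \<Delta>': "\<Delta> < \<Delta> + \<eta> / (1 + l)" using \<eta>0 l1 by simp
      have a0: "0 \<le> a" unfolding a_def using \<Lambda>1 \<Delta> \<Delta>' by (intro mult_nonneg_nonneg) auto
      have good: "?err \<omega> \<le> a" if "\<omega> \<in> space Q - Bad" for \<omega>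
        unfolding a_def
      proof (rule output_error[OF dp V_meas V_terminal V_bellman V_bounded run basis _ L \<Lambda>1 _ _ _ x0 K])
        show "\<omega> \<in> space Q" using that by simp
        show "regression_basis.stable_sample X \<psi> M \<epsilon> L \<Lambda> (\<lambda>l. S t l \<omega>)" if t: "t \<in> {1..T}" for t
          using \<open>\<omega> \<in> space Q - Bad\<close> t unfolding Bad_def by (intro st) auto
        show "\<exists>\<gamma>\<in>carrier_vec M. \<forall>x\<in>X. \<bar>V t x - basis_comb \<psi> M \<gamma> x\<bar> \<le> \<Delta> + \<eta> / (1 + l)"
          if "t \<in> {1..T}" for t
          using that by (intro approx(3)[OF _ _ _ _ \<Delta>']) auto
        show "0 \<le> \<Delta> + \<eta> / (1 + l)" using \<Delta> \<Delta>' by simp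
      qed
      have int_Bad: "integrable Q (indicator Bad :: 'v \<Rightarrow> real)"
        by (rule R.integrable_const_bound[where B = 1]) (use Bad in \<open>auto simp: indicator_def\<close>)
      have "(\<integral>\<omega>. ?err \<omega> \<partial>Q) \<le> (\<integral>\<omega>. a + 2 * K * indicator Bad \<omega> \<partial>Q)"
      proof (rule integral_mono[OF int_err])
        show "integrable Q (\<lambda>\<omega>. a + 2 * K * indicator Bad \<omega>)" using int_Bad by simp
        show "?err \<omega> \<le> a + 2 * K * indicator Bad \<omega>" if "\<omega> \<in> space Q" for \<omega>
        proof (cases "\<omega> \<in> Bad")
          case True
          have "2 * K \<le> a + 2 * K * indicator Bad \<omega>" using a0 True by simp
          with err_le[of \<omega>] show ?thesis by (rule order.trans)
        next
          case False
          have "a \<le> a + 2 * K * indicator Bad \<omega>" using False by simp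
          moreover have "?err \<omega> \<le> a" using good that False by blast
          ultimately show ?thesis by (rule order.trans[rotated])
        qed
      qed
      also have "\<dots> = a + 2 * K * measure Q Bad"
        using int_Bad Bad by (simp add: R.prob_space)
      also have "\<dots> \<le> a + q * \<eta>"
        using mult_left_mono[OF prob_Bad, of "2 * K"] K0 by (simp add: q_def mult_ac)
      also have "\<dots> \<le> (1 + 2 * l + C * \<eta>) ^ T * ((1 + l) * \<Delta> + C * \<eta>)"
        unfolding a_def \<Lambda>_def
        by (rule final_bound[OF l1 \<eta>0 \<eta>1 \<Delta> c10 q0 C_ge(1)])
      finally show ?thesis .
    qed
    then show "(\<integral>\<omega>. \<bar>ddp_output P T A \<xi> f r rT \<psi> x0 K M L S Z \<beta> \<omega> - V 0 x0\<bar> \<partial>Q)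
      \<le> (1 + 2 * lebesgue_constant \<psi> X T G M + C * (real M ^ 6 / real L) powr (1/4)) ^ T
         * ((1 + lebesgue_constant \<psi> X T G M) * approx_error \<psi> X T V M
            + C * (real M ^ 6 / real L) powr (1/4))"
      unfolding l_def \<Delta>_def \<eta>_def .
  qed
qed

end
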